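(* Let $H$ be a Hopf algebra with invertible antipode, $B$ a $\sigma$-twisted left $H$-module algebra, $(\Omega^\bullet(B),\mathrm{d}_B)$ a $\sigma$-twisted $H$-module DC on $B$ and $(\Omega^\bullet(H),\mathrm{d}_H)$ a DC on $H$ with respect to which $\Delta:H\to H\otimes H$ is differentiable. Let $(\Omega^\bullet(B\#_\sigma H),\mathrm{d}_{\#_\sigma})$ be the crossed product DC. If $\Omega^m(B)$ is flat as a right $B$-module for all $m>0$, then $$0\longrightarrow\Omega^{m+1}(B)\wedge\Omega^{n-1}(B\#_\sigma H)\overset{i}{\longrightarrow}\Omega^m(B)\wedge\Omega^n(B\#_\sigma H)\overset{\mathrm{ver}^{m,n}}{\longrightarrow}\Omega^m(B)\otimes_B(B\#_\sigma H)\otimes{}^{\mathrm{co}H}\Omega^n(H)\longrightarrow0,$$ where $i$ is the inclusion, is exact for all $n>0$ and $m\ge0$.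
   Context: Everything is over a field $\Bbbk$; algebras are associative and unital; Sweedler notation $\Delta(h)=h_1\otimes h_2$. $B$ is a $\sigma$-twisted left $H$-module algebra: there are a linear map $\cdot:H\otimes B\to B$ (a measure) with $h\cdot 1_B=\varepsilon(h)1_B$, $h\cdot(bb')=(h_1\cdot b)(h_2\cdot b')$, and a convolution invertible linear map $\sigma:H\otimes H\to B$ with convolution inverse $\sigma^{-1}$, such that $1_H\cdot b=b$, $h\cdot(h'\cdot b)=\sigma(h_1\otimes h'_1)(h_2h'_2\cdot b)\sigma^{-1}(h_3\otimes h'_3)$, $\sigma(h\otimes1_H)=\varepsilon(h)1_B=\sigma(1_H\otimes h)$ and $(h_1\cdot\sigma(h'_1\otimes h''_1))\sigma(h_2\otimes h'_2h''_2)=\sigma(h_1\otimes h'_1)\sigma(h_2h'_2\otimes h'')$. The crossed product algebra $B\#_\sigma H$ is $B\otimes H$ with unit $1_B\otimes1_H$ and product $(b\otimes h)(b'\otimes h')=b(h_1\cdot b')\sigma(h_2\otimes h'_1)\otimes h_3h'_2$. A differential calculus (DC) on an algebra $A$ is an $\mathbb N$-graded differential graded algebra $(\Omega^\bullet(A),\wedge,\mathrm{d})$ with $\Omega^0(A)=A$ such that $\Omega^n(A)$ is spanned by the elements $a^0\mathrm{d}a^1\wedge\cdots\wedge\mathrm{d}a^n$. An algebra map $f:A\to A'$ between algebras with DCi is differentiable if it extends to a (unique) morphism of differential graded algebras $\Omega^\bullet(f)$. $H\otimes H$ carries the graded tensor product DC $\Omega^n(H\otimes H)=\bigoplus_{k}\Omega^k(H)\otimes\Omega^{n-k}(H)$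 (Koszul signs). If $\Delta$ is differentiable, for $\gamma\in\Omega^j(H)$ and $k+l=j$ write $\gamma_{<1,k>}\otimes\gamma_{<2,l>}$ for the component of $\Omega^\bullet(\Delta)(\gamma)$ in $\Omega^k(H)\otimes\Omega^l(H)$ (and put it equal to $0$ if $k+l\ne j$). The case $k=0$ gives the left $H$-coaction $\gamma\mapsto\gamma_{-1}\otimes\gamma_0$; $\gamma_{-2}\otimes\gamma_{-1}\otimes\gamma_0$ is its iteration, and ${}^{\mathrm{co}H}\Omega^n(H)=\{\gamma\in\Omega^n(H):\gamma_{-1}\otimes\gamma_0=1_H\otimes\gamma\}$. A DC $(\Omega^\bullet(B),\mathrm{d}_B)$ is a $\sigma$-twisted $H$-module DC if there are linear maps $\cdot:H\otimes\Omega^n(B)\to\Omega^n(B)$, $n\ge1$, with $h\cdot(b^0\mathrm{d}_Bb^1\wedge\cdots\wedge\mathrm{d}_Bb^n)=(h_1\cdot b^0)(h_2\cdot\mathrm{d}_Bb^1)\wedge\cdots\wedge(h_{n+1}\cdot\mathrm{d}_Bb^n)$, $h\cdot\mathrm{d}_Bb=\mathrm{d}_B(h\cdot b)$ and $\mathrm{d}_B\circ\sigma=0$. The crossed product DC on $B\#_\sigma H$ is $\Omega^n(B\#_\sigma H)=\bigoplus_{i=0}^n\Omega^{n-i}(B)\otimes\Omega^i(H)$ with $(\omega\otimes\gamma)\wedge(\omega'\otimes\gamma')=(-1)^{jk}(\omega\wedge(\gamma_{-2}\cdot\omega')\sigma(\gamma_{-1}\otimes\gamma'_{-1}))\otimes(\gamma_0\wedge\gamma'_0)$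 and $\mathrm{d}_{\#_\sigma}(\omega\otimes\gamma)=\mathrm{d}_B\omega\otimes\gamma+(-1)^i\omega\otimes\mathrm{d}_H\gamma$ for $\omega\in\Omega^i(B)$, $\gamma\in\Omega^j(H)$, $\omega'\in\Omega^k(B)$. $\Omega^m(B)$ is regarded inside $\Omega^m(B\#_\sigma H)$ as $\Omega^m(B)\otimes\Bbbk1_H$, and $\Omega^m(B)\wedge\Omega^n(B\#_\sigma H)\subseteq\Omega^{m+n}(B\#_\sigma H)$ is the span of products. The vertical maps are $\mathrm{ver}^{m,n}:\Omega^{m+n}(B\#_\sigma H)\to\Omega^m(B\#_\sigma H)\otimes{}^{\mathrm{co}H}\Omega^n(H)$, given for $\omega^i\in\Omega^i(B)$, $\gamma^j\in\Omega^j(H)$ by $\sum_{i+j=m+n}\omega^i\otimes\gamma^j\mapsto\sum_{i+j=m+n}\omega^i\otimes\gamma^j_{<1,k>}\otimes S((\gamma^j_{<2,n>})_{-1})(\gamma^j_{<2,n>})_0$ with $k=j-n$ (terms with $j<n$ vanish). In the sequence, $\mathrm{ver}^{m,n}$ denotes its restriction to $\Omega^m(B)\wedge\Omega^n(B\#_\sigma H)$, whose values lie in $\Omega^m(B)\otimes H\otimes{}^{\mathrm{co}H}\Omega^n(H)$, identified with $\Omega^m(B)\otimes_B(B\#_\sigma H)\otimes{}^{\mathrm{co}H}\Omega^n(H)$. *)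

theory Defs
  imports Complex_Main "HOL-Library.Function_Algebras"
begin

section \<open>Tensor products over a field\<close>

text \<open>
  Vector spaces over a field \<open>'k\<close> are types of sort \<open>ab_group_add\<close> with an explicit scalar
  multiplication. Algebras are types of sort \<open>{ring, monoid_mult}\<close>, so that, unlike with
  \<open>ring_1\<close>, the zero algebra is allowed.
\<close>

abbreviation linear_map ::
  "('k::field \<Rightarrow> 'a \<Rightarrow> 'a::ab_group_add) \<Rightarrow> ('k \<Rightarrow> 'b \<Rightarrow> 'b::ab_group_add) \<Rightarrow> ('a \<Rightarrow> 'b) \<Rightarrow> bool" where
  "linear_map \<equiv> Vector_Spaces.linear"

definition bilinear_map ::
  "('k::field \<Rightarrow> 'a \<Rightarrow> 'a::ab_group_add) \<Rightarrow> ('k \<Rightarrow> 'b \<Rightarrow> 'b::ab_group_add) \<Rightarrow>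
   ('k \<Rightarrow> 'c \<Rightarrow> 'c::ab_group_add) \<Rightarrow> ('a \<Rightarrow> 'b \<Rightarrow> 'c) \<Rightarrow> bool" where
  "bilinear_map s1 s2 s3 f \<longleftrightarrow>
     (\<forall>b. linear_map s1 s3 (\<lambda>a. f a b)) \<and> (\<forall>a. linear_map s2 s3 (f a))"

text \<open>
  Over a field the vector space \<open>A \<otimes> B\<close> embeds into its double dual, and the dual of \<open>A \<otimes> B\<close> is the
  space of bilinear forms on \<open>A \<times> B\<close>. So \<open>a \<otimes> b\<close> is modelled by evaluation of bilinear forms at
  \<open>(a, b)\<close>, and \<open>A \<otimes> B\<close> is the span of these elements in the space of all functionals on forms.
  The universal property is proved below.
\<close>

type_synonym ('k, 'a, 'b) tensor = "('a \<Rightarrow> 'b \<Rightarrow> 'k) \<Rightarrow> 'k"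

definition tscale :: "'k::field \<Rightarrow> ('k, 'a, 'b) tensor \<Rightarrow> ('k, 'a, 'b) tensor" where
  "tscale c t = (\<lambda>\<phi>. c * t \<phi>)"

abbreviation tspan :: "('k::field, 'a, 'b) tensor set \<Rightarrow> ('k, 'a, 'b) tensor set" where
  "tspan \<equiv> module.span tscale"

definition tens ::
  "('k::field \<Rightarrow> 'a \<Rightarrow> 'a::ab_group_add) \<Rightarrow> ('k \<Rightarrow> 'b \<Rightarrow> 'b::ab_group_add) \<Rightarrow> 'a \<Rightarrow> 'b \<Rightarrow> ('k, 'a, 'b) tensor" where
  "tens s1 s2 a b = (\<lambda>\<phi>. if bilinear_map s1 s2 (*) \<phi> then \<phi> a b else 0)"

text \<open>
  For subspaces \<open>U\<close> and \<open>W\<close> the canonical map from \<open>U \<otimes> W\<close> to \<open>A \<otimes> B\<close> is injective (over a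
  field), so \<open>U \<otimes> W\<close> is taken inside \<open>A \<otimes> B\<close>.
\<close>

definition tprod ::
  "('k::field \<Rightarrow> 'a \<Rightarrow> 'a::ab_group_add) \<Rightarrow> ('k \<Rightarrow> 'b \<Rightarrow> 'b::ab_group_add) \<Rightarrow>
   'a set \<Rightarrow> 'b set \<Rightarrow> ('k, 'a, 'b) tensor set" where
  "tprod s1 s2 U W = tspan {tens s1 s2 a b | a b. a \<in> U \<and> b \<in> W}"

text \<open>
  The linear map on \<open>A \<otimes> B\<close> induced by a bilinear map \<open>f\<close>; its values outside
  \<open>tprod s1 s2 UNIV UNIV\<close> are irrelevant.
\<close>

definition tlift ::
  "('k::field \<Rightarrow> 'a \<Rightarrow> 'a::ab_group_add) \<Rightarrow> ('k \<Rightarrow> 'b \<Rightarrow> 'b::ab_group_add) \<Rightarrow>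
   ('k \<Rightarrow> 'c \<Rightarrow> 'c::ab_group_add) \<Rightarrow> ('a \<Rightarrow> 'b \<Rightarrow> 'c) \<Rightarrow> ('k, 'a, 'b) tensor \<Rightarrow> 'c" where
  "tlift s1 s2 s3 f = (SOME g. linear_map tscale s3 g \<and> (\<forall>a b. g (tens s1 s2 a b) = f a b))"

lemma vector_space_tscale: "vector_space tscale"
  by unfold_locales (auto simp: tscale_def fun_eq_iff algebra_simps)

lemma vector_space_mult: "vector_space ((*) :: 'k::field \<Rightarrow> 'k \<Rightarrow> 'k)"
  by unfold_locales (auto simp: algebra_simps)

lemma bilinear_tens:
  assumes "vector_space s1" "vector_space s2"
  shows "bilinear_map s1 s2 tscale (tens s1 s2)"
proof -
  interpret v1: vector_space s1 by fact
  interpret v2: vector_space s2 by fact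
  interpret t: vector_space tscale by (rule vector_space_tscale)
  have add: "\<phi> (x + y) b = \<phi> x b + \<phi> y b" "\<phi> (s1 c x) b = c * \<phi> x b"
    "\<phi> x (b + d) = \<phi> x b + \<phi> x d" "\<phi> x (s2 c b) = c * \<phi> x b"
    if "bilinear_map s1 s2 (*) \<phi>" for \<phi> x y b d c
  proof -
    interpret l: Vector_Spaces.linear s1 "(*)" "\<lambda>a. \<phi> a b"
      using that unfolding bilinear_map_def by blast
    interpret r: Vector_Spaces.linear s2 "(*)" "\<phi> x"
      using that unfolding bilinear_map_def by blast
    show "\<phi> (x + y) b = \<phi> x b + \<phi> y b" by (rule l.add)
    show "\<phi> (s1 c x) b = c * \<phi> x b" by (rule l.scale)
    show "\<phi> x (b + d) = \<phi> x b + \<phi> x d" by (rule r.add)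
    show "\<phi> x (s2 c b) = c * \<phi> x b" by (rule r.scale)
  qed
  have "linear_map s1 tscale (\<lambda>a. tens s1 s2 a b)" for b
    by unfold_locales (simp_all add: tens_def tscale_def fun_eq_iff add)
  moreover have "linear_map s2 tscale (tens s1 s2 a)" for a
    by unfold_locales (simp_all add: tens_def tscale_def fun_eq_iff add)
  ultimately show ?thesis unfolding bilinear_map_def by blast
qed

lemma linear_extension_of_family:
  fixes sV :: "'k::field \<Rightarrow> 'v \<Rightarrow> 'v::ab_group_add" and sW :: "'k \<Rightarrow> 'w \<Rightarrow> 'w::ab_group_add"
  assumes "vector_space sV" "vector_space sW"
    and rel: "\<And>J c. finite J \<Longrightarrow> J \<subseteq> I \<Longrightarrow> (\<Sum>i\<in>J. sV (c i) (T i)) = 0 \<Longrightarrow> (\<Sum>i\<in>J. sW (c i) (F i)) = 0"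
  shows "\<exists>g. linear_map sV sW g \<and> (\<forall>i\<in>I. g (T i) = F i)"
proof -
  interpret V: vector_space sV by fact
  interpret W: vector_space sW by fact
  interpret P: vector_space_pair sV sW ..
  obtain B where B: "B \<subseteq> T ` I" "V.independent B" "T ` I \<subseteq> V.span B"
    using V.maximal_independent_subset by blast
  obtain r where r: "\<And>b. b \<in> B \<Longrightarrow> r b \<in> I \<and> T (r b) = b"
  proof -
    have "\<forall>b\<in>B. \<exists>i\<in>I. T i = b" using B(1) by blast
    from bchoice[OF this[unfolded Bex_def]] that show thesis by blast
  qed
  obtain g where g: "linear_map sV sW g" "\<And>b. b \<in> B \<Longrightarrow> g b = F (r b)"
    using P.linear_independent_extend[OF B(2), of "\<lambda>b. F (r b)"] by blast
  interpret g: Vector_Spaces.linear sV sW g by (rule g(1))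
  have rinj: "inj_on r B"
  proof (rule inj_onI)
    fix x y assume xy: "x \<in> B" "y \<in> B" and "r x = r y"
    then have "T (r x) = T (r y)" by (simp only:)
    then show "x = y" using r[OF xy(1)] r[OF xy(2)] by (simp only:)
  qed
  have "g (T i) = F i" if "i \<in> I" for i
  proof (cases "i \<in> r ` B")
    case True
    then show ?thesis using r g(2) by auto
  next
    case False
    have "T i \<in> V.span B" using B that by auto
    then obtain S u where S: "finite S" "S \<subseteq> B" "T i = (\<Sum>b\<in>S. sV (u b) b)"
      unfolding V.span_explicit by blast
    define J where "J = insert i (r ` S)"
    define c where "c = (\<lambda>j. if j = i then - 1 else u (T j))"
    have iS: "i \<notin> r ` S" using False S by auto
    have rS: "inj_on r S" using rinj S(2) by (rule inj_on_subset)
    have J: "finite J" "J \<subseteq> I" using S r that by (auto simp: J_def)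
    have 1: "(\<Sum>j\<in>r ` S. sV (c j) (T j)) = (\<Sum>b\<in>S. sV (u b) b)"
      unfolding sum.reindex[OF rS] o_def
      by (rule sum.cong) (use S r iS in \<open>auto simp: c_def\<close>)
    have 2: "(\<Sum>j\<in>r ` S. sW (c j) (F j)) = (\<Sum>b\<in>S. sW (u b) (F (r b)))"
      unfolding sum.reindex[OF rS] o_def
      by (rule sum.cong) (use S r iS in \<open>auto simp: c_def\<close>)
    have "(\<Sum>j\<in>J. sV (c j) (T j)) = 0"
      unfolding J_def using iS S(1) 1 by (simp add: S(3)[symmetric]) (simp add: c_def)
    then have "(\<Sum>j\<in>J. sW (c j) (F j)) = 0" using rel J by blast
    then have "F i = (\<Sum>b\<in>S. sW (u b) (F (r b)))"
      unfolding J_def using iS S(1) 2 by (simp add: c_def)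
    also have "\<dots> = g (T i)"
      unfolding S(3) g.sum g.scale by (rule sum.cong) (use S g in auto)
    finally show ?thesis by simp
  qed
  then show ?thesis using g(1) by blast
qed

lemma functionals_separate:
  fixes s :: "'k::field \<Rightarrow> 'v \<Rightarrow> 'v::ab_group_add"
  assumes "vector_space s" and "\<And>\<psi>. linear_map s (*) \<psi> \<Longrightarrow> \<psi> v = 0"
  shows "v = 0"
proof (rule ccontr)
  assume v: "v \<noteq> 0"
  interpret V: vector_space s by fact
  interpret K: vector_space "(*) :: 'k \<Rightarrow> 'k \<Rightarrow> 'k" by (rule vector_space_mult)
  interpret P: vector_space_pair s "(*) :: 'k \<Rightarrow> 'k \<Rightarrow> 'k" ..
  have "V.independent {v}" using v by simp
  from P.linear_independent_extend[OF this, of "\<lambda>_. 1"] assms(2) show False by force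
qed

lemma tlift:
  fixes s1 :: "'k::field \<Rightarrow> 'a \<Rightarrow> 'a::ab_group_add" and s2 :: "'k \<Rightarrow> 'b \<Rightarrow> 'b::ab_group_add"
    and s3 :: "'k \<Rightarrow> 'c \<Rightarrow> 'c::ab_group_add"
  assumes f: "bilinear_map s1 s2 s3 f"
  shows "linear_map tscale s3 (tlift s1 s2 s3 f)" and "tlift s1 s2 s3 f (tens s1 s2 a b) = f a b"
proof -
  have s3: "vector_space s3"
    using f unfolding bilinear_map_def Vector_Spaces.linear_def by auto
  have "\<exists>g. linear_map tscale s3 g \<and> (\<forall>i\<in>UNIV. g (case_prod (tens s1 s2) i) = case_prod f i)"
  proof (rule linear_extension_of_family[OF vector_space_tscale s3])
    fix J and c :: "'a \<times> 'b \<Rightarrow> 'k"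
    assume J: "finite J" and 0: "(\<Sum>i\<in>J. tscale (c i) (case_prod (tens s1 s2) i)) = 0"
    show "(\<Sum>i\<in>J. s3 (c i) (case_prod f i)) = 0"
    proof (rule functionals_separate[OF s3])
      fix \<psi> assume \<psi>: "linear_map s3 (*) \<psi>"
      interpret \<psi>: Vector_Spaces.linear s3 "(*)" \<psi> by fact
      have bl: "bilinear_map s1 s2 (*) (\<lambda>a b. \<psi> (f a b))"
        using f \<psi> unfolding bilinear_map_def
        by (auto intro: Vector_Spaces.linear_compose[unfolded o_def])
      have ev: "(\<Sum>i\<in>J. t i) \<phi> = (\<Sum>i\<in>J. t i \<phi>)"
        for t :: "'a \<times> 'b \<Rightarrow> ('k, 'a, 'b) tensor" and \<phi>
        using J by (induction J) auto
      have "(\<Sum>i\<in>J. tscale (c i) (case_prod (tens s1 s2) i)) (\<lambda>a b. \<psi> (f a b)) = 0"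
        by (simp add: 0)
      then show "\<psi> (\<Sum>i\<in>J. s3 (c i) (case_prod f i)) = 0"
        using bl by (simp add: ev tscale_def tens_def case_prod_beta \<psi>.sum \<psi>.scale)
    qed
  qed
  then have "\<exists>g. linear_map tscale s3 g \<and> (\<forall>a b. g (tens s1 s2 a b) = f a b)" by auto
  from someI_ex[OF this, folded tlift_def]
  show "linear_map tscale s3 (tlift s1 s2 s3 f)" "tlift s1 s2 s3 f (tens s1 s2 a b) = f a b"
    by auto
qed

lemma tensor_maps_eqI:
  assumes "linear_map tscale s3 g" "linear_map tscale s3 g'"
    and "\<And>a b. a \<in> U \<Longrightarrow> b \<in> W \<Longrightarrow> g (tens s1 s2 a b) = g' (tens s1 s2 a b)"
    and "t \<in> tprod s1 s2 U W"
  shows "g t = g' t"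
proof -
  interpret vector_space_pair tscale s3
    using assms(1) by (intro vector_space_pair.intro) (auto dest: Vector_Spaces.linear.axioms intro: vector_space_tscale)
  show ?thesis
    by (rule linear_eq_on[OF assms(1,2) assms(4)[unfolded tprod_def]]) (use assms(3) in auto)
qed


section \<open>Tensor products over an algebra and flatness\<close>

text \<open>
  A module over a \<open>'k\<close>-algebra \<open>'r\<close>, carried by a subspace of an ambient vector space. Left and
  right modules share this record: \<open>mact r m\<close> is \<open>r \<cdot> m\<close> for left and \<open>m \<cdot> r\<close> for right modules.
\<close>

record ('k, 'r, 'm) rmodule =
  mscale :: "'k \<Rightarrow> 'm \<Rightarrow> 'm"
  mcar :: "'m set"
  mact :: "'r \<Rightarrow> 'm \<Rightarrow> 'm"

definition is_left_module ::
  "('k::field \<Rightarrow> 'r \<Rightarrow> 'r::{ring,monoid_mult}) \<Rightarrow> ('k, 'r, 'm::ab_group_add) rmodule \<Rightarrow> bool" where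
  "is_left_module sR N \<longleftrightarrow>
     vector_space (mscale N) \<and> module.subspace (mscale N) (mcar N) \<and>
     (\<forall>r. \<forall>x\<in>mcar N. mact N r x \<in> mcar N) \<and>
     (\<forall>r. \<forall>x\<in>mcar N. \<forall>y\<in>mcar N. mact N r (x + y) = mact N r x + mact N r y) \<and>
     (\<forall>r r'. \<forall>x\<in>mcar N. mact N (r + r') x = mact N r x + mact N r' x) \<and>
     (\<forall>r r'. \<forall>x\<in>mcar N. mact N (r * r') x = mact N r (mact N r' x)) \<and>
     (\<forall>x\<in>mcar N. mact N 1 x = x) \<and>
     (\<forall>c. \<forall>x\<in>mcar N. mact N (sR c 1) x = mscale N c x)"

definition is_module_map ::
  "('k, 'r, 'm::ab_group_add) rmodule \<Rightarrow> ('k, 'r, 'n::ab_group_add) rmodule \<Rightarrow> ('m \<Rightarrow> 'n) \<Rightarrow> bool" where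
  "is_module_map N N' f \<longleftrightarrow>
     f ` mcar N \<subseteq> mcar N' \<and>
     (\<forall>x\<in>mcar N. \<forall>y\<in>mcar N. f (x + y) = f x + f y) \<and>
     (\<forall>r. \<forall>x\<in>mcar N. f (mact N r x) = mact N' r (f x))"

text \<open>
  \<open>M \<otimes>\<^sub>R N\<close> for a right module \<open>M\<close> and a left module \<open>N\<close>: its \<open>'k\<close>-dual is the space of
  \<open>R\<close>-balanced bilinear forms, and it is modelled in its double dual as above.
\<close>

definition balanced_form ::
  "('k::field, 'r, 'm::ab_group_add) rmodule \<Rightarrow> ('k, 'r, 'n::ab_group_add) rmodule \<Rightarrow>
   ('m \<Rightarrow> 'n \<Rightarrow> 'k) \<Rightarrow> bool" where
  "balanced_form M N \<phi> \<longleftrightarrow>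
     (\<forall>x\<in>mcar M. \<forall>x'\<in>mcar M. \<forall>y\<in>mcar N. \<phi> (x + x') y = \<phi> x y + \<phi> x' y) \<and>
     (\<forall>x\<in>mcar M. \<forall>y\<in>mcar N. \<forall>y'\<in>mcar N. \<phi> x (y + y') = \<phi> x y + \<phi> x y') \<and>
     (\<forall>c. \<forall>x\<in>mcar M. \<forall>y\<in>mcar N. \<phi> (mscale M c x) y = c * \<phi> x y) \<and>
     (\<forall>c. \<forall>x\<in>mcar M. \<forall>y\<in>mcar N. \<phi> x (mscale N c y) = c * \<phi> x y) \<and>
     (\<forall>r. \<forall>x\<in>mcar M. \<forall>y\<in>mcar N. \<phi> (mact M r x) y = \<phi> x (mact N r y))"

definition btens ::
  "('k::field, 'r, 'm::ab_group_add) rmodule \<Rightarrow> ('k, 'r, 'n::ab_group_add) rmodule \<Rightarrow>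
   'm \<Rightarrow> 'n \<Rightarrow> ('k, 'm, 'n) tensor" where
  "btens M N x y = (\<lambda>\<phi>. if balanced_form M N \<phi> then \<phi> x y else 0)"

definition btprod ::
  "('k::field, 'r, 'm::ab_group_add) rmodule \<Rightarrow> ('k, 'r, 'n::ab_group_add) rmodule \<Rightarrow>
   ('k, 'm, 'n) tensor set" where
  "btprod M N = tspan {btens M N x y | x y. x \<in> mcar M \<and> y \<in> mcar N}"

definition blift ::
  "('k::field, 'r, 'm::ab_group_add) rmodule \<Rightarrow> ('k, 'r, 'n::ab_group_add) rmodule \<Rightarrow>
   ('k \<Rightarrow> 'c \<Rightarrow> 'c::ab_group_add) \<Rightarrow> ('m \<Rightarrow> 'n \<Rightarrow> 'c) \<Rightarrow> ('k, 'm, 'n) tensor \<Rightarrow> 'c" where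
  "blift M N s f =
     (SOME g. linear_map tscale s g \<and> (\<forall>x\<in>mcar M. \<forall>y\<in>mcar N. g (btens M N x y) = f x y))"

lemma blift:
  fixes M :: "('k::field, 'r, 'm::ab_group_add) rmodule" and N :: "('k, 'r, 'n::ab_group_add) rmodule"
    and s :: "'k \<Rightarrow> 'c \<Rightarrow> 'c::ab_group_add"
  assumes s: "vector_space s"
    and f: "\<And>x x' y. x \<in> mcar M \<Longrightarrow> x' \<in> mcar M \<Longrightarrow> y \<in> mcar N \<Longrightarrow> f (x + x') y = f x y + f x' y"
      "\<And>x y y'. x \<in> mcar M \<Longrightarrow> y \<in> mcar N \<Longrightarrow> y' \<in> mcar N \<Longrightarrow> f x (y + y') = f x y + f x y'"
      "\<And>c x y. x \<in> mcar M \<Longrightarrow> y \<in> mcar N \<Longrightarrow> f (mscale M c x) y = s c (f x y)"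
      "\<And>c x y. x \<in> mcar M \<Longrightarrow> y \<in> mcar N \<Longrightarrow> f x (mscale N c y) = s c (f x y)"
      "\<And>r x y. x \<in> mcar M \<Longrightarrow> y \<in> mcar N \<Longrightarrow> f (mact M r x) y = f x (mact N r y)"
  shows "linear_map tscale s (blift M N s f)"
    and "x \<in> mcar M \<Longrightarrow> y \<in> mcar N \<Longrightarrow> blift M N s f (btens M N x y) = f x y"
proof -
  have "\<exists>g. linear_map tscale s g \<and> (\<forall>i\<in>mcar M \<times> mcar N. g (case_prod (btens M N) i) = case_prod f i)"
  proof (rule linear_extension_of_family[OF vector_space_tscale s])
    fix J and c :: "'m \<times> 'n \<Rightarrow> 'k"
    assume J: "finite J" and sub: "J \<subseteq> mcar M \<times> mcar N"
      and 0: "(\<Sum>i\<in>J. tscale (c i) (case_prod (btens M N) i)) = 0"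
    show "(\<Sum>i\<in>J. s (c i) (case_prod f i)) = 0"
    proof (rule functionals_separate[OF s])
      fix \<psi> assume \<psi>: "linear_map s (*) \<psi>"
      interpret \<psi>: Vector_Spaces.linear s "(*)" \<psi> by fact
      have bl: "balanced_form M N (\<lambda>a b. \<psi> (f a b))"
        unfolding balanced_form_def by (intro conjI ballI allI) (simp_all only: f \<psi>.add \<psi>.scale)
      have ev: "(\<Sum>i\<in>J. t i) \<phi> = (\<Sum>i\<in>J. t i \<phi>)"
        for t :: "'m \<times> 'n \<Rightarrow> ('k, 'm, 'n) tensor" and \<phi>
        using J by (induction J) auto
      have "(\<Sum>i\<in>J. tscale (c i) (case_prod (btens M N) i)) (\<lambda>a b. \<psi> (f a b)) = 0"
        by (simp add: 0)
      then show "\<psi> (\<Sum>i\<in>J. s (c i) (case_prod f i)) = 0"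
        using bl by (simp add: ev tscale_def btens_def case_prod_beta \<psi>.sum \<psi>.scale)
    qed
  qed
  then have "\<exists>g. linear_map tscale s g \<and> (\<forall>x\<in>mcar M. \<forall>y\<in>mcar N. g (btens M N x y) = f x y)" by auto
  from someI_ex[OF this, folded blift_def]
  show "linear_map tscale s (blift M N s f)"
    "x \<in> mcar M \<Longrightarrow> y \<in> mcar N \<Longrightarrow> blift M N s f (btens M N x y) = f x y"
    by auto
qed

text \<open>
  \<open>M \<otimes>\<^sub>R _\<close> preserves injectivity of maps of left modules. The test modules range over all left
  module structures on subspaces of the type \<open>nat \<times> 'r \<Rightarrow> 'k\<close>. Every countably generated left module
  is isomorphic to one of these, having \<open>'k\<close>-dimension at most the cardinality of \<open>nat \<times> 'r\<close>; since
  an element of a tensor product, and a relation witnessing that it vanishes, only involve finitely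
  generated submodules, this is flatness with respect to all left modules.
\<close>

definition flat_right_module ::
  "('k::field \<Rightarrow> 'r \<Rightarrow> 'r::{ring,monoid_mult}) \<Rightarrow> ('k, 'r, 'm::ab_group_add) rmodule \<Rightarrow> bool" where
  "flat_right_module sR M \<longleftrightarrow>
     (\<forall>(N :: ('k, 'r, nat \<times> 'r \<Rightarrow> 'k) rmodule) (N' :: ('k, 'r, nat \<times> 'r \<Rightarrow> 'k) rmodule) f.
        is_left_module sR N \<and> is_left_module sR N' \<and> is_module_map N N' f \<and> inj_on f (mcar N) \<longrightarrow>
        inj_on (blift M N tscale (\<lambda>x y. btens M N' x (f y))) (btprod M N))"


section \<open>Hopf algebras and twisted module algebras\<close>

definition is_algebra :: "('k::field \<Rightarrow> 'a \<Rightarrow> 'a::{ring,monoid_mult}) \<Rightarrow> bool" where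
  "is_algebra s \<longleftrightarrow>
     vector_space s \<and> (\<forall>c x y. s c (x * y) = s c x * y) \<and> (\<forall>c x y. s c (x * y) = x * s c y)"

record ('k, 'h) hopf =
  hscale :: "'k \<Rightarrow> 'h \<Rightarrow> 'h"
  comul :: "'h \<Rightarrow> ('k, 'h, 'h) tensor"
  counit :: "'h \<Rightarrow> 'k"
  antipode :: "'h \<Rightarrow> 'h"

text \<open>
  Sweedler notation: \<open>sw H s f h\<close> is \<open>f h\<^sub>1 h\<^sub>2\<close> and \<open>sw3 H s f h\<close> is \<open>f h\<^sub>1 h\<^sub>2 h\<^sub>3\<close> (summation
  understood), for \<open>f\<close> multilinear with values in a space with scalar multiplication \<open>s\<close>.
\<close>

definition sw ::
  "('k::field, 'h::{ring,monoid_mult}) hopf \<Rightarrow> ('k \<Rightarrow> 'c \<Rightarrow> 'c::ab_group_add) \<Rightarrow>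
   ('h \<Rightarrow> 'h \<Rightarrow> 'c) \<Rightarrow> 'h \<Rightarrow> 'c" where
  "sw H s f h = tlift (hscale H) (hscale H) s f (comul H h)"

definition sw3 ::
  "('k::field, 'h::{ring,monoid_mult}) hopf \<Rightarrow> ('k \<Rightarrow> 'c \<Rightarrow> 'c::ab_group_add) \<Rightarrow>
   ('h \<Rightarrow> 'h \<Rightarrow> 'h \<Rightarrow> 'c) \<Rightarrow> 'h \<Rightarrow> 'c" where
  "sw3 H s f h = sw H s (\<lambda>h1 x. sw H s (\<lambda>h2 h3. f h1 h2 h3) x) h"

abbreviation htens ::
  "('k::field, 'h::{ring,monoid_mult}) hopf \<Rightarrow> 'h \<Rightarrow> 'h \<Rightarrow> ('k, 'h, 'h) tensor" where
  "htens H \<equiv> tens (hscale H) (hscale H)"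

definition is_hopf :: "('k::field, 'h::{ring,monoid_mult}) hopf \<Rightarrow> bool" where
  "is_hopf H \<longleftrightarrow>
     is_algebra (hscale H) \<and>
     linear_map (hscale H) tscale (comul H) \<and>
     range (comul H) \<subseteq> tprod (hscale H) (hscale H) UNIV UNIV \<and>
     linear_map (hscale H) (*) (counit H) \<and>
     \<comment> \<open>coassociativity, in \<open>H \<otimes> (H \<otimes> H)\<close>\<close>
     (\<forall>h. sw H tscale (\<lambda>x z. sw H tscale (\<lambda>x1 x2. tens (hscale H) tscale x1 (htens H x2 z)) x) h =
          sw H tscale (\<lambda>x z. sw H tscale (\<lambda>z1 z2. tens (hscale H) tscale x (htens H z1 z2)) z) h) \<and>
     (\<forall>h. sw H (hscale H) (\<lambda>h1 h2. hscale H (counit H h1) h2) h = h) \<and>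
     (\<forall>h. sw H (hscale H) (\<lambda>h1 h2. hscale H (counit H h2) h1) h = h) \<and>
     (\<forall>g h. comul H (g * h) =
        sw H tscale (\<lambda>g1 g2. sw H tscale (\<lambda>h1 h2. htens H (g1 * h1) (g2 * h2)) h) g) \<and>
     comul H 1 = htens H 1 1 \<and>
     (\<forall>g h. counit H (g * h) = counit H g * counit H h) \<and>
     counit H 1 = 1 \<and>
     linear_map (hscale H) (hscale H) (antipode H) \<and>
     (\<forall>h. sw H (hscale H) (\<lambda>h1 h2. antipode H h1 * h2) h = hscale H (counit H h) 1) \<and>
     (\<forall>h. sw H (hscale H) (\<lambda>h1 h2. h1 * antipode H h2) h = hscale H (counit H h) 1)"

text \<open>Linear maps on \<open>H \<otimes> B\<close> and \<open>H \<otimes> H\<close> are given as bilinear maps.\<close>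

record ('k, 'h, 'b) twisted_alg =
  bscale :: "'k \<Rightarrow> 'b \<Rightarrow> 'b"
  meas :: "'h \<Rightarrow> 'b \<Rightarrow> 'b"
  cocyc :: "'h \<Rightarrow> 'h \<Rightarrow> 'b"
  cocyc_inv :: "'h \<Rightarrow> 'h \<Rightarrow> 'b"

definition is_twisted_module_algebra ::
  "('k::field, 'h::{ring,monoid_mult}) hopf \<Rightarrow> ('k, 'h, 'b::{ring,monoid_mult}) twisted_alg \<Rightarrow> bool" where
  "is_twisted_module_algebra H B \<longleftrightarrow>
     is_algebra (bscale B) \<and>
     bilinear_map (hscale H) (bscale B) (bscale B) (meas B) \<and>
     (\<forall>h. meas B h 1 = bscale B (counit H h) 1) \<and>
     (\<forall>h b b'. meas B h (b * b') = sw H (bscale B) (\<lambda>h1 h2. meas B h1 b * meas B h2 b') h) \<and>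
     bilinear_map (hscale H) (hscale H) (bscale B) (cocyc B) \<and>
     bilinear_map (hscale H) (hscale H) (bscale B) (cocyc_inv B) \<and>
     (\<forall>h h'. sw H (bscale B) (\<lambda>h1 h2. sw H (bscale B) (\<lambda>h1' h2'.
          cocyc B h1 h1' * cocyc_inv B h2 h2') h') h = bscale B (counit H h * counit H h') 1) \<and>
     (\<forall>h h'. sw H (bscale B) (\<lambda>h1 h2. sw H (bscale B) (\<lambda>h1' h2'.
          cocyc_inv B h1 h1' * cocyc B h2 h2') h') h = bscale B (counit H h * counit H h') 1) \<and>
     (\<forall>b. meas B 1 b = b) \<and>
     (\<forall>h h' b. meas B h (meas B h' b) =
        sw3 H (bscale B) (\<lambda>h1 h2 h3. sw3 H (bscale B) (\<lambda>h1' h2' h3'.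
          cocyc B h1 h1' * meas B (h2 * h2') b * cocyc_inv B h3 h3') h') h) \<and>
     (\<forall>h. cocyc B h 1 = bscale B (counit H h) 1) \<and>
     (\<forall>h. cocyc B 1 h = bscale B (counit H h) 1) \<and>
     (\<forall>h h' h''.
        sw H (bscale B) (\<lambda>h1 h2. sw H (bscale B) (\<lambda>h1' h2'. sw H (bscale B) (\<lambda>h1'' h2''.
          meas B h1 (cocyc B h1' h1'') * cocyc B h2 (h2' * h2'')) h'') h') h =
        sw H (bscale B) (\<lambda>h1 h2. sw H (bscale B) (\<lambda>h1' h2'.
          cocyc B h1 h1' * cocyc B (h2 * h2') h'') h') h)"

text \<open>The product of the crossed product algebra, on the vector space \<open>B \<otimes> H\<close>.\<close>

definition cp_mult ::
  "('k::field, 'h::{ring,monoid_mult}) hopf \<Rightarrow> ('k, 'h, 'b::{ring,monoid_mult}) twisted_alg \<Rightarrow>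
   ('k, 'b, 'h) tensor \<Rightarrow> ('k, 'b, 'h) tensor \<Rightarrow> ('k, 'b, 'h) tensor" where
  "cp_mult H B u u' =
     tlift (bscale B) (hscale H) tscale (\<lambda>b h. tlift (bscale B) (hscale H) tscale (\<lambda>b' h'.
       sw3 H tscale (\<lambda>h1 h2 h3. sw H tscale (\<lambda>h1' h2'.
         tens (bscale B) (hscale H) (b * meas B h1 b' * cocyc B h2 h1') (h3 * h2')) h') h) u') u"


section \<open>Differential calculi\<close>

text \<open>
  \<open>dcincl\<close> is the identification of the algebra with the degree 0 part. In the
  constructions below the graded pieces span only a subspace of the underlying type, whereas
  \<open>is_dga\<close> requires them to fill it.
\<close>

record ('k, 'a, 'o) dcalc =
  dscale :: "'k \<Rightarrow> 'o \<Rightarrow> 'o"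
  dpart :: "nat \<Rightarrow> 'o set"
  wedge :: "'o \<Rightarrow> 'o \<Rightarrow> 'o"
  dunit :: "'o"
  dd :: "'o \<Rightarrow> 'o"
  dcincl :: "'a \<Rightarrow> 'o"

abbreviation sgn_scale :: "('k::field, 'a, 'o) dcalc \<Rightarrow> nat \<Rightarrow> 'o \<Rightarrow> 'o" where
  "sgn_scale \<Omega> n \<equiv> dscale \<Omega> ((- 1) ^ n)"

definition is_decomp :: "('k, 'a, 'o::ab_group_add) dcalc \<Rightarrow> 'o \<Rightarrow> (nat \<Rightarrow> 'o) \<Rightarrow> bool" where
  "is_decomp \<Omega> x c \<longleftrightarrow>
     (\<forall>n. c n \<in> dpart \<Omega> n) \<and> finite {n. c n \<noteq> 0} \<and> x = (\<Sum>n | c n \<noteq> 0. c n)"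

definition hcomp :: "('k, 'a, 'o::ab_group_add) dcalc \<Rightarrow> nat \<Rightarrow> 'o \<Rightarrow> 'o" where
  "hcomp \<Omega> n x = (THE c. is_decomp \<Omega> x c) n"

text \<open>
  Additive extension to all of \<open>\<Omega>\<close> of a family of maps \<open>f n\<close> given on the homogeneous elements of
  degree \<open>n\<close>.
\<close>

definition hext ::
  "('k, 'a, 'o::ab_group_add) dcalc \<Rightarrow> (nat \<Rightarrow> 'o \<Rightarrow> 'c::comm_monoid_add) \<Rightarrow> 'o \<Rightarrow> 'c" where
  "hext \<Omega> f x = (\<Sum>n | hcomp \<Omega> n x \<noteq> 0. f n (hcomp \<Omega> n x))"

definition is_dga :: "('k::field, 'a, 'o::ab_group_add) dcalc \<Rightarrow> bool" where
  "is_dga \<Omega> \<longleftrightarrow>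
     vector_space (dscale \<Omega>) \<and>
     (\<forall>n. module.subspace (dscale \<Omega>) (dpart \<Omega> n)) \<and>
     (\<forall>x. \<exists>!c. is_decomp \<Omega> x c) \<and>
     bilinear_map (dscale \<Omega>) (dscale \<Omega>) (dscale \<Omega>) (wedge \<Omega>) \<and>
     (\<forall>x y z. wedge \<Omega> (wedge \<Omega> x y) z = wedge \<Omega> x (wedge \<Omega> y z)) \<and>
     dunit \<Omega> \<in> dpart \<Omega> 0 \<and>
     (\<forall>x. wedge \<Omega> (dunit \<Omega>) x = x \<and> wedge \<Omega> x (dunit \<Omega>) = x) \<and>
     (\<forall>m n. \<forall>x\<in>dpart \<Omega> m. \<forall>y\<in>dpart \<Omega> n. wedge \<Omega> x y \<in> dpart \<Omega> (m + n)) \<and>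
     linear_map (dscale \<Omega>) (dscale \<Omega>) (dd \<Omega>) \<and>
     (\<forall>n. \<forall>x\<in>dpart \<Omega> n. dd \<Omega> x \<in> dpart \<Omega> (Suc n)) \<and>
     (\<forall>x. dd \<Omega> (dd \<Omega> x) = 0) \<and>
     (\<forall>n. \<forall>x\<in>dpart \<Omega> n. \<forall>y.
        dd \<Omega> (wedge \<Omega> x y) = wedge \<Omega> (dd \<Omega> x) y + sgn_scale \<Omega> n (wedge \<Omega> x (dd \<Omega> y)))"

fun wedge_list :: "('k, 'a, 'o) dcalc \<Rightarrow> 'o list \<Rightarrow> 'o" where
  "wedge_list \<Omega> [] = dunit \<Omega>"
| "wedge_list \<Omega> [x] = x"
| "wedge_list \<Omega> (x # y # xs) = wedge \<Omega> x (wedge_list \<Omega> (y # xs))"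

text \<open>The factors of \<open>a\<^sup>0 da\<^sup>1 \<and> \<dots> \<and> da\<^sup>n\<close>, where \<open>as\<close> is the list of \<open>a\<^sup>1, \<dots>, a\<^sup>n\<close>.\<close>

definition form_factors :: "('k, 'a, 'o) dcalc \<Rightarrow> 'a \<Rightarrow> 'a list \<Rightarrow> 'o list" where
  "form_factors \<Omega> a0 as = dcincl \<Omega> a0 # map (\<lambda>a. dd \<Omega> (dcincl \<Omega> a)) as"

definition is_dc ::
  "('k::field \<Rightarrow> 'a \<Rightarrow> 'a::{ring,monoid_mult}) \<Rightarrow> ('k, 'a, 'o::ab_group_add) dcalc \<Rightarrow> bool" where
  "is_dc s \<Omega> \<longleftrightarrow>
     is_dga \<Omega> \<and>
     linear_map s (dscale \<Omega>) (dcincl \<Omega>) \<and> inj (dcincl \<Omega>) \<and> range (dcincl \<Omega>) = dpart \<Omega> 0 \<and>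
     dcincl \<Omega> 1 = dunit \<Omega> \<and>
     (\<forall>a b. dcincl \<Omega> (a * b) = wedge \<Omega> (dcincl \<Omega> a) (dcincl \<Omega> b)) \<and>
     (\<forall>n. dpart \<Omega> n =
        module.span (dscale \<Omega>) {wedge_list \<Omega> (form_factors \<Omega> a0 as) | a0 as. length as = n})"

text \<open>
  \<open>F\<close> is a morphism of differential graded algebras extending the algebra map \<open>f\<close>; \<open>\<Omega>\<close> is assumed
  to fill its type, while \<open>\<Omega>'\<close> need not.
\<close>

definition dc_morphism ::
  "('k::field, 'a, 'o::ab_group_add) dcalc \<Rightarrow> ('k, 'a', 'p::ab_group_add) dcalc \<Rightarrow>
   ('a \<Rightarrow> 'a') \<Rightarrow> ('o \<Rightarrow> 'p) \<Rightarrow> bool" where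
  "dc_morphism \<Omega> \<Omega>' f F \<longleftrightarrow>
     linear_map (dscale \<Omega>) (dscale \<Omega>') F \<and>
     (\<forall>n. F ` dpart \<Omega> n \<subseteq> dpart \<Omega>' n) \<and>
     (\<forall>x y. F (wedge \<Omega> x y) = wedge \<Omega>' (F x) (F y)) \<and>
     F (dunit \<Omega>) = dunit \<Omega>' \<and>
     (\<forall>x. F (dd \<Omega> x) = dd \<Omega>' (F x)) \<and>
     (\<forall>a. F (dcincl \<Omega> a) = dcincl \<Omega>' (f a))"

definition differentiable_map ::
  "('k::field, 'a, 'o::ab_group_add) dcalc \<Rightarrow> ('k, 'a', 'p::ab_group_add) dcalc \<Rightarrow> ('a \<Rightarrow> 'a') \<Rightarrow> bool" where
  "differentiable_map \<Omega> \<Omega>' f \<longleftrightarrow> (\<exists>F. dc_morphism \<Omega> \<Omega>' f F)"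

definition dc_ext ::
  "('k::field, 'a, 'o::ab_group_add) dcalc \<Rightarrow> ('k, 'a', 'p::ab_group_add) dcalc \<Rightarrow> ('a \<Rightarrow> 'a') \<Rightarrow> 'o \<Rightarrow> 'p" where
  "dc_ext \<Omega> \<Omega>' f = (THE F. dc_morphism \<Omega> \<Omega>' f F)"

abbreviation otens ::
  "('k::field, 'a, 'o::ab_group_add) dcalc \<Rightarrow> ('k, 'a', 'p::ab_group_add) dcalc \<Rightarrow>
   'o \<Rightarrow> 'p \<Rightarrow> ('k, 'o, 'p) tensor" where
  "otens \<Omega> \<Omega>' \<equiv> tens (dscale \<Omega>) (dscale \<Omega>')"

abbreviation olift ::
  "('k::field, 'a, 'o::ab_group_add) dcalc \<Rightarrow> ('k, 'a', 'p::ab_group_add) dcalc \<Rightarrow>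
   ('k \<Rightarrow> 'c \<Rightarrow> 'c::ab_group_add) \<Rightarrow> ('o \<Rightarrow> 'p \<Rightarrow> 'c) \<Rightarrow> ('k, 'o, 'p) tensor \<Rightarrow> 'c" where
  "olift \<Omega> \<Omega>' \<equiv> tlift (dscale \<Omega>) (dscale \<Omega>')"

text \<open>Grading, differential and inclusion shared by tensor product and crossed product calculi.\<close>

definition tensor_part ::
  "('k::field, 'a, 'o::ab_group_add) dcalc \<Rightarrow> ('k, 'a', 'p::ab_group_add) dcalc \<Rightarrow> nat \<Rightarrow> ('k, 'o, 'p) tensor set" where
  "tensor_part \<Omega> \<Omega>' n =
     tspan (\<Union>i\<le>n. tprod (dscale \<Omega>) (dscale \<Omega>') (dpart \<Omega> (n - i)) (dpart \<Omega>' i))"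

definition tensor_dd ::
  "('k::field, 'a, 'o::ab_group_add) dcalc \<Rightarrow> ('k, 'a', 'p::ab_group_add) dcalc \<Rightarrow>
   ('k, 'o, 'p) tensor \<Rightarrow> ('k, 'o, 'p) tensor" where
  "tensor_dd \<Omega> \<Omega>' =
     olift \<Omega> \<Omega>' tscale (\<lambda>\<omega> \<gamma>. otens \<Omega> \<Omega>' (dd \<Omega> \<omega>) \<gamma> +
       hext \<Omega> (\<lambda>i \<omega>. tscale ((- 1) ^ i) (otens \<Omega> \<Omega>' \<omega> (dd \<Omega>' \<gamma>))) \<omega>)"

definition tensor_incl ::
  "('k::field \<Rightarrow> 'a \<Rightarrow> 'a::ab_group_add) \<Rightarrow> ('k \<Rightarrow> 'a' \<Rightarrow> 'a'::ab_group_add) \<Rightarrow>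
   ('k, 'a, 'o::ab_group_add) dcalc \<Rightarrow> ('k, 'a', 'p::ab_group_add) dcalc \<Rightarrow>
   ('k, 'a, 'a') tensor \<Rightarrow> ('k, 'o, 'p) tensor" where
  "tensor_incl s s' \<Omega> \<Omega>' = tlift s s' tscale (\<lambda>a a'. otens \<Omega> \<Omega>' (dcincl \<Omega> a) (dcincl \<Omega>' a'))"

definition tensor_dc ::
  "('k::field \<Rightarrow> 'a \<Rightarrow> 'a::ab_group_add) \<Rightarrow> ('k \<Rightarrow> 'a' \<Rightarrow> 'a'::ab_group_add) \<Rightarrow>
   ('k, 'a, 'o::ab_group_add) dcalc \<Rightarrow> ('k, 'a', 'p::ab_group_add) dcalc \<Rightarrow>
   ('k, ('k, 'a, 'a') tensor, ('k, 'o, 'p) tensor) dcalc" where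
  "tensor_dc s s' \<Omega> \<Omega>' = \<lparr>
     dscale = tscale,
     dpart = tensor_part \<Omega> \<Omega>',
     wedge = (\<lambda>u u'. olift \<Omega> \<Omega>' tscale (\<lambda>x y. olift \<Omega> \<Omega>' tscale (\<lambda>x' y'.
       hext \<Omega>' (\<lambda>j y. hext \<Omega> (\<lambda>k x'.
         tscale ((- 1) ^ (j * k)) (otens \<Omega> \<Omega>' (wedge \<Omega> x x') (wedge \<Omega>' y y'))) x') y) u') u),
     dunit = otens \<Omega> \<Omega>' (dunit \<Omega>) (dunit \<Omega>'),
     dd = tensor_dd \<Omega> \<Omega>',
     dcincl = tensor_incl s s' \<Omega> \<Omega>' \<rparr>"


section \<open>The calculus on the Hopf algebra\<close>

definition comul_differentiable ::
  "('k::field, 'h::{ring,monoid_mult}) hopf \<Rightarrow> ('k, 'h, 'o::ab_group_add) dcalc \<Rightarrow> bool" where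
  "comul_differentiable H \<Omega>H \<longleftrightarrow>
     differentiable_map \<Omega>H (tensor_dc (hscale H) (hscale H) \<Omega>H \<Omega>H) (comul H)"

definition dcomul ::
  "('k::field, 'h::{ring,monoid_mult}) hopf \<Rightarrow> ('k, 'h, 'o::ab_group_add) dcalc \<Rightarrow>
   'o \<Rightarrow> ('k, 'o, 'o) tensor" where
  "dcomul H \<Omega>H = dc_ext \<Omega>H (tensor_dc (hscale H) (hscale H) \<Omega>H \<Omega>H) (comul H)"

text \<open>
  \<open>dsw H \<Omega>H k l s f \<gamma>\<close> is \<open>f \<gamma>\<^bsub><1,k>\<^esub> \<gamma>\<^bsub><2,l>\<^esub>\<close>; for \<open>\<gamma>\<close> of degree \<open>j \<noteq> k + l\<close> the component in
  bidegree \<open>(k, l)\<close> vanishes.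
\<close>

definition dsw ::
  "('k::field, 'h::{ring,monoid_mult}) hopf \<Rightarrow> ('k, 'h, 'o::ab_group_add) dcalc \<Rightarrow> nat \<Rightarrow> nat \<Rightarrow>
   ('k \<Rightarrow> 'c \<Rightarrow> 'c::ab_group_add) \<Rightarrow> ('o \<Rightarrow> 'o \<Rightarrow> 'c) \<Rightarrow> 'o \<Rightarrow> 'c" where
  "dsw H \<Omega>H k l s f \<gamma> =
     olift \<Omega>H \<Omega>H s (\<lambda>x y. f (hcomp \<Omega>H k x) (hcomp \<Omega>H l y)) (dcomul H \<Omega>H \<gamma>)"

text \<open>
  The left coaction. A homogeneous \<open>\<gamma>\<close> of degree \<open>j\<close> goes to its component in
  \<open>\<Omega>\<^sup>0(H) \<otimes> \<Omega>\<^sup>j(H)\<close>, read in \<open>H \<otimes> \<Omega>\<^sup>j(H)\<close>.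
\<close>

definition coact ::
  "('k::field, 'h::{ring,monoid_mult}) hopf \<Rightarrow> ('k, 'h, 'o::ab_group_add) dcalc \<Rightarrow>
   'o \<Rightarrow> ('k, 'h, 'o) tensor" where
  "coact H \<Omega>H = hext \<Omega>H (\<lambda>j.
     dsw H \<Omega>H 0 j tscale (\<lambda>x y. tens (hscale H) (dscale \<Omega>H) (inv (dcincl \<Omega>H) x) y))"

text \<open>
  \<open>csw H \<Omega>H s f \<gamma>\<close> is \<open>f \<gamma>\<^bsub>-1\<^esub> \<gamma>\<^sub>0\<close> and \<open>csw3 H \<Omega>H s f \<gamma>\<close> is \<open>f \<gamma>\<^bsub>-2\<^esub> \<gamma>\<^bsub>-1\<^esub> \<gamma>\<^sub>0\<close>.
\<close>

definition csw ::
  "('k::field, 'h::{ring,monoid_mult}) hopf \<Rightarrow> ('k, 'h, 'o::ab_group_add) dcalc \<Rightarrow>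
   ('k \<Rightarrow> 'c \<Rightarrow> 'c::ab_group_add) \<Rightarrow> ('h \<Rightarrow> 'o \<Rightarrow> 'c) \<Rightarrow> 'o \<Rightarrow> 'c" where
  "csw H \<Omega>H s f \<gamma> = tlift (hscale H) (dscale \<Omega>H) s f (coact H \<Omega>H \<gamma>)"

definition csw3 ::
  "('k::field, 'h::{ring,monoid_mult}) hopf \<Rightarrow> ('k, 'h, 'o::ab_group_add) dcalc \<Rightarrow>
   ('k \<Rightarrow> 'c \<Rightarrow> 'c::ab_group_add) \<Rightarrow> ('h \<Rightarrow> 'h \<Rightarrow> 'o \<Rightarrow> 'c) \<Rightarrow> 'o \<Rightarrow> 'c" where
  "csw3 H \<Omega>H s f \<gamma> = csw H \<Omega>H s (\<lambda>h1 x. csw H \<Omega>H s (\<lambda>h2 \<gamma>0. f h1 h2 \<gamma>0) x) \<gamma>"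

definition coinv ::
  "('k::field, 'h::{ring,monoid_mult}) hopf \<Rightarrow> ('k, 'h, 'o::ab_group_add) dcalc \<Rightarrow> nat \<Rightarrow> 'o set" where
  "coinv H \<Omega>H n = {\<gamma> \<in> dpart \<Omega>H n. coact H \<Omega>H \<gamma> = tens (hscale H) (dscale \<Omega>H) 1 \<gamma>}"


section \<open>Twisted module calculi and the crossed product calculus\<close>

text \<open>\<open>sw_wedge_list h [x\<^sub>0, \<dots>, x\<^sub>n]\<close> is \<open>(h\<^sub>1 \<cdot> x\<^sub>0) \<and> \<dots> \<and> (h\<^bsub>n+1\<^esub> \<cdot> x\<^sub>n)\<close>.\<close>

fun sw_wedge_list ::
  "('k::field, 'h::{ring,monoid_mult}) hopf \<Rightarrow> ('k, 'b, 'o::ab_group_add) dcalc \<Rightarrow> ('h \<Rightarrow> 'o \<Rightarrow> 'o) \<Rightarrow>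
   'h \<Rightarrow> 'o list \<Rightarrow> 'o" where
  "sw_wedge_list H \<Omega>B act h [] = dscale \<Omega>B (counit H h) (dunit \<Omega>B)"
| "sw_wedge_list H \<Omega>B act h [x] = act h x"
| "sw_wedge_list H \<Omega>B act h (x # y # xs) =
     sw H (dscale \<Omega>B) (\<lambda>h1 h2. wedge \<Omega>B (act h1 x) (sw_wedge_list H \<Omega>B act h2 (y # xs))) h"

text \<open>\<open>act\<close> comprises the maps on all \<open>\<Omega>\<^sup>n(B)\<close>, and on \<open>\<Omega>\<^sup>0(B) = B\<close> it is the given measure.\<close>

definition is_twisted_module_dc ::
  "('k::field, 'h::{ring,monoid_mult}) hopf \<Rightarrow> ('k, 'h, 'b::{ring,monoid_mult}) twisted_alg \<Rightarrow>
   ('k, 'b, 'o::ab_group_add) dcalc \<Rightarrow> ('h \<Rightarrow> 'o \<Rightarrow> 'o) \<Rightarrow> bool" where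
  "is_twisted_module_dc H B \<Omega>B act \<longleftrightarrow>
     is_dc (bscale B) \<Omega>B \<and>
     bilinear_map (hscale H) (dscale \<Omega>B) (dscale \<Omega>B) act \<and>
     (\<forall>h n. act h ` dpart \<Omega>B n \<subseteq> dpart \<Omega>B n) \<and>
     (\<forall>h b. act h (dcincl \<Omega>B b) = dcincl \<Omega>B (meas B h b)) \<and>
     (\<forall>h b0 bs. act h (wedge_list \<Omega>B (form_factors \<Omega>B b0 bs)) =
        sw_wedge_list H \<Omega>B act h (form_factors \<Omega>B b0 bs)) \<and>
     (\<forall>h b. act h (dd \<Omega>B (dcincl \<Omega>B b)) = dd \<Omega>B (dcincl \<Omega>B (meas B h b))) \<and>
     (\<forall>h h'. dd \<Omega>B (dcincl \<Omega>B (cocyc B h h')) = 0)"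

definition crossed_dc ::
  "('k::field, 'h::{ring,monoid_mult}) hopf \<Rightarrow> ('k, 'h, 'b::{ring,monoid_mult}) twisted_alg \<Rightarrow>
   ('k, 'b, 'o::ab_group_add) dcalc \<Rightarrow> ('h \<Rightarrow> 'o \<Rightarrow> 'o) \<Rightarrow> ('k, 'h, 'p::ab_group_add) dcalc \<Rightarrow>
   ('k, ('k, 'b, 'h) tensor, ('k, 'o, 'p) tensor) dcalc" where
  "crossed_dc H B \<Omega>B act \<Omega>H = \<lparr>
     dscale = tscale,
     dpart = tensor_part \<Omega>B \<Omega>H,
     wedge = (\<lambda>u u'. olift \<Omega>B \<Omega>H tscale (\<lambda>\<omega> \<gamma>. olift \<Omega>B \<Omega>H tscale (\<lambda>\<omega>' \<gamma>'.
       hext \<Omega>H (\<lambda>j \<gamma>. hext \<Omega>B (\<lambda>k \<omega>'.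
         tscale ((- 1) ^ (j * k))
           (csw3 H \<Omega>H tscale (\<lambda>\<gamma>m2 \<gamma>m1 \<gamma>0. csw H \<Omega>H tscale (\<lambda>\<gamma>m1' \<gamma>0'.
              otens \<Omega>B \<Omega>H
                (wedge \<Omega>B (wedge \<Omega>B \<omega> (act \<gamma>m2 \<omega>')) (dcincl \<Omega>B (cocyc B \<gamma>m1 \<gamma>m1')))
                (wedge \<Omega>H \<gamma>0 \<gamma>0')) \<gamma>') \<gamma>)) \<omega>') \<gamma>) u') u),
     dunit = otens \<Omega>B \<Omega>H (dunit \<Omega>B) (dunit \<Omega>H),
     dd = tensor_dd \<Omega>B \<Omega>H,
     dcincl = tensor_incl (bscale B) (hscale H) \<Omega>B \<Omega>H \<rparr>"

text \<open>\<open>\<Omega>\<^sup>m(B) \<and> \<Omega>\<^sup>n(B #\<^sub>\<sigma> H)\<close>\<close>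

definition base_wedge ::
  "('k::field, 'h::{ring,monoid_mult}) hopf \<Rightarrow> ('k, 'h, 'b::{ring,monoid_mult}) twisted_alg \<Rightarrow>
   ('k, 'b, 'o::ab_group_add) dcalc \<Rightarrow> ('h \<Rightarrow> 'o \<Rightarrow> 'o) \<Rightarrow> ('k, 'h, 'p::ab_group_add) dcalc \<Rightarrow>
   nat \<Rightarrow> nat \<Rightarrow> ('k, 'o, 'p) tensor set" where
  "base_wedge H B \<Omega>B act \<Omega>H m n =
     tspan {wedge (crossed_dc H B \<Omega>B act \<Omega>H) (otens \<Omega>B \<Omega>H \<omega> (dunit \<Omega>H)) x | \<omega> x.
              \<omega> \<in> dpart \<Omega>B m \<and> x \<in> dpart (crossed_dc H B \<Omega>B act \<Omega>H) n}"

text \<open>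
  The map \<open>ver\<^bsup>m,n\<^esup>\<close> with values in \<open>(\<Omega>(B) \<otimes> \<Omega>(H)) \<otimes> \<Omega>(H)\<close>. The formula does not involve \<open>m\<close>,
  which only fixes the domain \<open>\<Omega>\<^bsup>m+n\<^esup>(B #\<^sub>\<sigma> H)\<close>.
\<close>

definition ver ::
  "('k::field, 'h::{ring,monoid_mult}) hopf \<Rightarrow> ('k, 'b, 'o::ab_group_add) dcalc \<Rightarrow>
   ('k, 'h, 'p::ab_group_add) dcalc \<Rightarrow> nat \<Rightarrow>
   ('k, 'o, 'p) tensor \<Rightarrow> ('k, ('k, 'o, 'p) tensor, 'p) tensor" where
  "ver H \<Omega>B \<Omega>H n =
     olift \<Omega>B \<Omega>H tscale (\<lambda>\<omega> \<gamma>. hext \<Omega>H (\<lambda>j \<gamma>.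
       if j < n then 0
       else dsw H \<Omega>H (j - n) n tscale (\<lambda>\<gamma>1 \<gamma>2.
              tens tscale (dscale \<Omega>H) (otens \<Omega>B \<Omega>H \<omega> \<gamma>1)
                (csw H \<Omega>H (dscale \<Omega>H) (\<lambda>h \<gamma>0. wedge \<Omega>H (dcincl \<Omega>H (antipode H h)) \<gamma>0) \<gamma>2)) \<gamma>) \<gamma>)"

definition forms_right_module ::
  "('k, 'b, 'o) dcalc \<Rightarrow> nat \<Rightarrow> ('k, 'b, 'o) rmodule" where
  "forms_right_module \<Omega>B m =
     \<lparr>mscale = dscale \<Omega>B, mcar = dpart \<Omega>B m, mact = (\<lambda>b \<omega>. wedge \<Omega>B \<omega> (dcincl \<Omega>B b))\<rparr>"

definition crossed_left_module ::
  "('k::field, 'h::{ring,monoid_mult}) hopf \<Rightarrow> ('k, 'h, 'b::{ring,monoid_mult}) twisted_alg \<Rightarrow>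
   ('k, 'b, ('k, 'b, 'h) tensor) rmodule" where
  "crossed_left_module H B =
     \<lparr>mscale = tscale, mcar = tprod (bscale B) (hscale H) UNIV UNIV,
      mact = (\<lambda>b u. cp_mult H B (tens (bscale B) (hscale H) b 1) u)\<rparr>"

text \<open>\<open>(\<Omega>\<^sup>m(B) \<otimes>\<^sub>B (B #\<^sub>\<sigma> H)) \<otimes> \<^sup>c\<^sup>o\<^sup>H\<Omega>\<^sup>n(H)\<close>\<close>

definition ver_target ::
  "('k::field, 'h::{ring,monoid_mult}) hopf \<Rightarrow> ('k, 'h, 'b::{ring,monoid_mult}) twisted_alg \<Rightarrow>
   ('k, 'b, 'o::ab_group_add) dcalc \<Rightarrow> ('k, 'h, 'p::ab_group_add) dcalc \<Rightarrow> nat \<Rightarrow> nat \<Rightarrow>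
   ('k, ('k, 'o, ('k, 'b, 'h) tensor) tensor, 'p) tensor set" where
  "ver_target H B \<Omega>B \<Omega>H m n =
     tprod tscale (dscale \<Omega>H)
       (btprod (forms_right_module \<Omega>B m) (crossed_left_module H B)) (coinv H \<Omega>H n)"

text \<open>
  The identification of \<open>\<Omega>\<^sup>m(B) \<otimes> H \<otimes> \<Omega>(H)\<close> with \<open>\<Omega>\<^sup>m(B) \<otimes>\<^sub>B (B #\<^sub>\<sigma> H) \<otimes> \<Omega>(H)\<close>, sending
  \<open>\<omega> \<otimes> h \<otimes> \<gamma>\<close> to \<open>\<omega> \<otimes>\<^sub>B (1 \<otimes> h) \<otimes> \<gamma>\<close>; it is determined on the span of these elements.
\<close>

definition target_ident ::
  "('k::field, 'h::{ring,monoid_mult}) hopf \<Rightarrow> ('k, 'h, 'b::{ring,monoid_mult}) twisted_alg \<Rightarrow>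
   ('k, 'b, 'o::ab_group_add) dcalc \<Rightarrow> ('k, 'h, 'p::ab_group_add) dcalc \<Rightarrow> nat \<Rightarrow>
   ('k, ('k, 'o, 'p) tensor, 'p) tensor \<Rightarrow> ('k, ('k, 'o, ('k, 'b, 'h) tensor) tensor, 'p) tensor" where
  "target_ident H B \<Omega>B \<Omega>H m =
     (SOME g. linear_map tscale tscale g \<and>
        (\<forall>\<omega>\<in>dpart \<Omega>B m. \<forall>h \<gamma>.
           g (tens tscale (dscale \<Omega>H) (otens \<Omega>B \<Omega>H \<omega> (dcincl \<Omega>H h)) \<gamma>) =
           tens tscale (dscale \<Omega>H)
             (btens (forms_right_module \<Omega>B m) (crossed_left_module H B) \<omega>
                (tens (bscale B) (hscale H) 1 h)) \<gamma>))"

text \<open>Exactness of \<open>0 \<rightarrow> X \<rightarrow> Y \<rightarrow> Z \<rightarrow> 0\<close> for subspaces of the ambient vector spaces.\<close>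

definition short_exact ::
  "('k::field \<Rightarrow> 'x \<Rightarrow> 'x::ab_group_add) \<Rightarrow> ('k \<Rightarrow> 'y \<Rightarrow> 'y::ab_group_add) \<Rightarrow>
   ('k \<Rightarrow> 'z \<Rightarrow> 'z::ab_group_add) \<Rightarrow> 'x set \<Rightarrow> 'y set \<Rightarrow> 'z set \<Rightarrow> ('x \<Rightarrow> 'y) \<Rightarrow> ('y \<Rightarrow> 'z) \<Rightarrow> bool" where
  "short_exact sX sY sZ X Y Z i p \<longleftrightarrow>
     linear_map sX sY i \<and> linear_map sY sZ p \<and>
     module.subspace sX X \<and> module.subspace sY Y \<and> module.subspace sZ Z \<and>
     i ` X \<subseteq> Y \<and> p ` Y \<subseteq> Z \<and>
     inj_on i X \<and> i ` X = {y \<in> Y. p y = 0} \<and> p ` Y = Z"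

end

theory Submission
  imports Defs
begin

text \<open>
  The sequence splits off the top summand of a direct sum. Multiplying \<open>\<omega>' \<otimes> \<gamma>\<close> from the left by
  \<open>\<omega> \<otimes> 1\<close> gives \<open>(\<omega> \<and> \<omega>') \<otimes> \<gamma>\<close>, because \<open>1\<close> acts as the identity on forms, \<open>\<sigma>(1 \<otimes> h) = \<epsilon>(h)\<close> and the
  coaction of \<open>H\<close> on \<open>\<Omega>(H)\<close> is counital. Hence \<open>\<Omega>\<^sup>m(B) \<and> \<Omega>\<^sup>n(B #\<^sub>\<sigma> H)\<close> is the sum of the spaces
  \<open>\<Omega>\<^bsup>m+n-i\<^esup>(B) \<otimes> \<Omega>\<^sup>i(H)\<close> with \<open>i \<le> n\<close> (lemma \<open>base_wedge_eq\<close>). Replacing \<open>(m, n)\<close> by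
  \<open>(m + 1, n - 1)\<close> leaves out exactly the summand \<open>i = n\<close>. The vertical map vanishes on the summands
  \<open>i < n\<close> for degree reasons, and on the top summand \<open>\<Omega>\<^sup>m(B) \<otimes> \<Omega>\<^sup>n(H)\<close> it is
  \<open>\<omega> \<otimes> \<gamma> \<mapsto> \<omega> \<otimes> \<gamma>\<^bsub>-2\<^esub> \<otimes> S(\<gamma>\<^bsub>-1\<^esub>)\<gamma>\<^sub>0\<close>. So everything reduces to two isomorphisms.

  The first is the fundamental theorem of Hopf modules for \<open>\<Omega>\<^sup>n(H)\<close>: the map
  \<open>\<gamma> \<mapsto> \<gamma>\<^bsub>-2\<^esub> \<otimes> S(\<gamma>\<^bsub>-1\<^esub>)\<gamma>\<^sub>0\<close> takes values in \<open>H \<otimes> \<^sup>c\<^sup>o\<^sup>H\<Omega>\<^sup>n(H)\<close> (\<open>coact_coinv_proj\<close>) and is inverse to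
  \<open>h \<otimes> \<gamma> \<mapsto> h\<gamma>\<close> (\<open>mult_coinv_proj\<close> and \<open>CSW_coinv_proj_mult\<close>). The second is
  \<open>\<Omega>\<^sup>m(B) \<otimes>\<^sub>B (B #\<^sub>\<sigma> H) \<cong> \<Omega>\<^sup>m(B) \<otimes> H\<close>, which holds because \<open>b(b' \<otimes> h) = bb' \<otimes> h\<close> makes \<open>B #\<^sub>\<sigma> H\<close> the free
  left \<open>B\<close>-module \<open>B \<otimes> H\<close> (\<open>cp_mult_base\<close>, \<open>balanced_retraction\<close>, \<open>btens_move\<close>).

  That \<open>\<Omega>(H)\<close> is a Hopf module comes from the extension \<open>\<Omega>(\<Delta>)\<close> of the comultiplication. The coaction is
  \<open>\<Omega>(\<Delta>)\<close> followed by the projection of the left factor to degree \<open>0\<close>. This projection is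
  multiplicative and kills every product with an exact factor, so that
  \<open>(a\<gamma>)\<^bsub>-1\<^esub> \<otimes> (a\<gamma>)\<^sub>0 = a\<^sub>1\<gamma>\<^bsub>-1\<^esub> \<otimes> a\<^sub>2\<gamma>\<^sub>0\<close> and \<open>(da \<and> \<gamma>)\<^bsub>-1\<^esub> \<otimes> (da \<and> \<gamma>)\<^sub>0 = a\<^sub>1\<gamma>\<^bsub>-1\<^esub> \<otimes> da\<^sub>2 \<and> \<gamma>\<^sub>0\<close>
  (\<open>CSW_mult\<close>, \<open>CSW_diff\<close>). Coassociativity and counitality of the coaction then follow from those of
  \<open>\<Delta>\<close> by induction on the number of factors \<open>a\<close> and \<open>da\<close> of a form.
\<close>

section \<open>Multilinear maps and finite tensor representations\<close>

text \<open>
  The rules in \<open>lin\<close> say that a composite of (multi)linear operations is linear in each variable, so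
  that \<open>intro lin\<close> proves linearity of an explicit term. The rule for a linear operation has the form
  of a composition with an inner linear map, so that it also applies when the variable is buried below
  other operations. The scalar multiplication of the codomain is instantiated explicitly in many
  places below, because \<open>intro lin\<close> need not terminate when it is a unification variable.
\<close>

named_theorems lin

lemmas linear_map_iff = Vector_Spaces.linear_iff

lemma linear_mapD:
  assumes "linear_map s s' f"
  shows linear_map_vs1: "vector_space s" and linear_map_vs2: "vector_space s'"
    and linear_map_add: "f (x + y) = f x + f y" and linear_map_scale: "f (s c x) = s' c (f x)"
    and linear_map_zero: "f 0 = 0"
proof -
  interpret Vector_Spaces.linear s s' f by fact
  show "vector_space s" "vector_space s'" "f (x + y) = f x + f y" "f (s c x) = s' c (f x)" "f 0 = 0"
    by (rule vs1.vector_space_axioms vs2.vector_space_axioms add scale zero)+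
qed

lemma linear_map_sum:
  assumes "linear_map s s' f" shows "f (\<Sum>i\<in>I. g i) = (\<Sum>i\<in>I. f (g i))"
proof -
  interpret Vector_Spaces.linear s s' f by fact
  show ?thesis by (rule sum)
qed

lemma linear_map_sum_list:
  assumes "linear_map s s' f" shows "f (\<Sum>i\<leftarrow>is. g i) = (\<Sum>i\<leftarrow>is. f (g i))"
  by (induction "is") (auto simp: linear_map_add[OF assms] linear_map_zero[OF assms])

declare vector_space_tscale [lin] vector_space_mult [lin]

lemma lin_id [lin]: "vector_space s \<Longrightarrow> linear_map s s (\<lambda>x. x)"
  by (simp add: linear_map_iff)

lemma lin_zero [lin]: "vector_space s \<Longrightarrow> vector_space s' \<Longrightarrow> linear_map s s' (\<lambda>x. 0)"
  by (simp add: linear_map_iff module.scale_zero_right vector_space_def module_def)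

lemma lin_add [lin]:
  "linear_map s s' f \<Longrightarrow> linear_map s s' g \<Longrightarrow> linear_map s s' (\<lambda>x. f x + g x)"
  unfolding linear_map_iff by (auto simp: vector_space_def algebra_simps)

lemma lin_scale [lin]: "linear_map s s' f \<Longrightarrow> linear_map s s' (\<lambda>x. s' c (f x))"
  unfolding linear_map_iff by (auto simp: vector_space_def algebra_simps)

lemma lin_scale_left [lin]:
  "vector_space s' \<Longrightarrow> linear_map s (*) f \<Longrightarrow> linear_map s s' (\<lambda>x. s' (f x) v)"
  unfolding linear_map_iff by (auto simp: vector_space_def algebra_simps)

lemma lin_if [lin]:
  "(P \<Longrightarrow> linear_map s s' f) \<Longrightarrow> (\<not> P \<Longrightarrow> linear_map s s' g) \<Longrightarrow>
    linear_map s s' (\<lambda>x. if P then f x else g x)"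
  by (cases P) simp_all

lemma linear_map_comp:
  "linear_map s2 s3 g \<Longrightarrow> linear_map s1 s2 f \<Longrightarrow> linear_map s1 s3 (\<lambda>x. g (f x))"
  unfolding linear_map_iff by auto

lemma lin_sum: "vector_space s \<Longrightarrow> vector_space s' \<Longrightarrow> (\<And>i. linear_map s s' (f i)) \<Longrightarrow>
    linear_map s s' (\<lambda>x. \<Sum>i\<in>I. f i x)"
  by (induction I rule: infinite_finite_induct) (auto intro!: lin_zero lin_add)

lemma lin_sum_list: "vector_space s \<Longrightarrow> vector_space s' \<Longrightarrow> (\<And>i. linear_map s s' (f i)) \<Longrightarrow>
    linear_map s s' (\<lambda>x. \<Sum>i\<leftarrow>is. f i x)"
  by (induction "is") (auto intro!: lin_zero lin_add)

lemma linear_eq_on_span: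
  assumes "linear_map s s' f" "linear_map s s' g" "x \<in> module.span s S" "\<And>y. y \<in> S \<Longrightarrow> f y = g y"
  shows "f x = g x"
proof -
  interpret vector_space_pair s s'
    using assms(1) by (intro vector_space_pair.intro linear_map_vs1 linear_map_vs2)
  show ?thesis by (rule linear_eq_on[OF assms(1-3)]) (rule assms(4))
qed

lemma linear_image_span:
  assumes f: "linear_map s s' f" and x: "x \<in> module.span s S"
    and S: "module.subspace s' V" "\<And>y. y \<in> S \<Longrightarrow> f y \<in> V"
  shows "f x \<in> V"
proof -
  interpret Vector_Spaces.linear s s' f by fact
  have "f ` vs1.span S \<subseteq> V"
    unfolding span_image[symmetric] by (rule vs2.span_minimal) (use S in auto)
  then show ?thesis using x by auto
qed

lemma bilinear_mapI [lin]:
  "(\<And>b. linear_map s1 s3 (\<lambda>a. f a b)) \<Longrightarrow> (\<And>a. linear_map s2 s3 (\<lambda>b. f a b)) \<Longrightarrow> bilinear_map s1 s2 s3 f"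
  unfolding bilinear_map_def by blast

lemma bilinear_mapD:
  assumes "bilinear_map s1 s2 s3 f"
  shows "linear_map s s1 g \<Longrightarrow> linear_map s s3 (\<lambda>x. f (g x) b)"
    and "linear_map s s2 h \<Longrightarrow> linear_map s s3 (\<lambda>x. f a (h x))"
  using assms unfolding bilinear_map_def by (auto intro: linear_map_comp)

lemma bilinear_map_vs:
  assumes "bilinear_map s1 s2 s3 f"
  shows "vector_space s1" "vector_space s2" "vector_space s3"
  using assms unfolding bilinear_map_def by (auto intro: linear_map_vs1 linear_map_vs2)

definition trilinear_map ::
  "('k::field \<Rightarrow> 'a \<Rightarrow> 'a::ab_group_add) \<Rightarrow> ('k \<Rightarrow> 'b \<Rightarrow> 'b::ab_group_add) \<Rightarrow>
   ('k \<Rightarrow> 'c \<Rightarrow> 'c::ab_group_add) \<Rightarrow> ('k \<Rightarrow> 'd \<Rightarrow> 'd::ab_group_add) \<Rightarrow> ('a \<Rightarrow> 'b \<Rightarrow> 'c \<Rightarrow> 'd) \<Rightarrow> bool" where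
  "trilinear_map s1 s2 s3 s4 f \<longleftrightarrow>
     (\<forall>b c. linear_map s1 s4 (\<lambda>a. f a b c)) \<and> (\<forall>a c. linear_map s2 s4 (\<lambda>b. f a b c)) \<and>
     (\<forall>a b. linear_map s3 s4 (\<lambda>c. f a b c))"

lemma trilinear_mapI [lin]:
  "(\<And>b c. linear_map s1 s4 (\<lambda>a. f a b c)) \<Longrightarrow> (\<And>a c. linear_map s2 s4 (\<lambda>b. f a b c)) \<Longrightarrow>
   (\<And>a b. linear_map s3 s4 (\<lambda>c. f a b c)) \<Longrightarrow> trilinear_map s1 s2 s3 s4 f"
  unfolding trilinear_map_def by blast

lemma trilinear_mapD:
  assumes "trilinear_map s1 s2 s3 s4 f"
  shows "linear_map s s1 g \<Longrightarrow> linear_map s s4 (\<lambda>x. f (g x) b c)"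
    and "linear_map s s2 h \<Longrightarrow> linear_map s s4 (\<lambda>x. f a (h x) c)"
    and "linear_map s s3 k \<Longrightarrow> linear_map s s4 (\<lambda>x. f a b (k x))"
  using assms linear_map_comp unfolding trilinear_map_def by blast+

lemma trilinear_map_vs:
  assumes "trilinear_map s1 s2 s3 s4 f"
  shows "vector_space s1" "vector_space s2" "vector_space s3" "vector_space s4"
  using assms unfolding trilinear_map_def by (blast intro: linear_map_vs1 linear_map_vs2)+

lemma lin_tens [lin]:
  assumes "vector_space s1" "vector_space s2"
  shows "linear_map s s1 f \<Longrightarrow> linear_map s tscale (\<lambda>x. tens s1 s2 (f x) b)"
    and "linear_map s s2 g \<Longrightarrow> linear_map s tscale (\<lambda>x. tens s1 s2 a (g x))"
  by (rule bilinear_mapD[OF bilinear_tens[OF assms]]; assumption)+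

lemma lin_tlift [lin]:
  "bilinear_map s1 s2 s3 f \<Longrightarrow> linear_map s tscale g \<Longrightarrow> linear_map s s3 (\<lambda>x. tlift s1 s2 s3 f (g x))"
  by (rule linear_map_comp[OF tlift(1)])

lemma subspace_tprod: "module.subspace tscale (tprod s1 s2 U W)"
proof -
  interpret t: vector_space tscale by (rule vector_space_tscale)
  show ?thesis unfolding tprod_def by simp
qed

lemma tens_in_tprod: "a \<in> U \<Longrightarrow> b \<in> W \<Longrightarrow> tens s1 s2 a b \<in> tprod s1 s2 U W"
proof -
  interpret t: vector_space tscale by (rule vector_space_tscale)
  assume "a \<in> U" "b \<in> W" then show ?thesis unfolding tprod_def by (intro t.span_base) auto
qed

lemma tprod_mono: "U \<subseteq> U' \<Longrightarrow> W \<subseteq> W' \<Longrightarrow> tprod s1 s2 U W \<subseteq> tprod s1 s2 U' W'"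
proof -
  interpret t: vector_space tscale by (rule vector_space_tscale)
  assume "U \<subseteq> U'" "W \<subseteq> W'" then show ?thesis unfolding tprod_def by (intro t.span_mono) auto
qed

lemma tprod_image:
  assumes f: "linear_map tscale s f" and V: "module.subspace s V" and t: "t \<in> tprod s1 s2 U W"
    and gen: "\<And>a b. a \<in> U \<Longrightarrow> b \<in> W \<Longrightarrow> f (tens s1 s2 a b) \<in> V"
  shows "f t \<in> V"
  by (rule linear_image_span[OF f t[unfolded tprod_def] V]) (auto intro: gen)

text \<open>
  Iterated Sweedler sums are handled by fixing for every tensor one way of writing it as a finite sum
  of pure tensors. Then \<open>tsum\<close> makes sense for arbitrary functions \<open>f\<close>, linear maps can be pulled out and
  sums interchanged without any condition on \<open>f\<close>, and bilinearity is only required to identify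
  the value with the induced linear map.
\<close>

definition tensor_rep ::
  "('k::field \<Rightarrow> 'a \<Rightarrow> 'a::ab_group_add) \<Rightarrow> ('k \<Rightarrow> 'b \<Rightarrow> 'b::ab_group_add) \<Rightarrow> ('k, 'a, 'b) tensor \<Rightarrow> ('a \<times> 'b) list" where
  "tensor_rep s1 s2 t = (SOME ps. t = (\<Sum>p\<leftarrow>ps. tens s1 s2 (fst p) (snd p)))"

definition tsum ::
  "('k::field \<Rightarrow> 'a \<Rightarrow> 'a::ab_group_add) \<Rightarrow> ('k \<Rightarrow> 'b \<Rightarrow> 'b::ab_group_add) \<Rightarrow>
   ('a \<Rightarrow> 'b \<Rightarrow> 'c::comm_monoid_add) \<Rightarrow> ('k, 'a, 'b) tensor \<Rightarrow> 'c" where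
  "tsum s1 s2 f t = (\<Sum>p\<leftarrow>tensor_rep s1 s2 t. f (fst p) (snd p))"

lemma tsum_tens:
  assumes "vector_space s1" "vector_space s2" and t: "t \<in> tprod s1 s2 UNIV UNIV"
  shows "tsum s1 s2 (tens s1 s2) t = t"
proof -
  interpret t: vector_space tscale by (rule vector_space_tscale)
  have "\<exists>ps. t = (\<Sum>p\<leftarrow>ps. tens s1 s2 (fst p) (snd p))"
    using t unfolding tprod_def
  proof (induction rule: t.span_induct_alt)
    case base
    then show ?case by (intro exI[of _ "[]"]) simp
  next
    case (step c x y)
    then obtain a b ps where "x = tens s1 s2 a b" "y = (\<Sum>p\<leftarrow>ps. tens s1 s2 (fst p) (snd p))"
      by auto
    moreover have "tscale c (tens s1 s2 a b) = tens s1 s2 (s1 c a) b"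
      using linear_map_scale[OF lin_tens(1)[OF assms(1,2) lin_id[OF assms(1)]]] by simp
    ultimately show ?case by (intro exI[of _ "(s1 c a, b) # ps"]) simp
  qed
  from someI_ex[OF this] show ?thesis unfolding tsum_def tensor_rep_def by simp
qed

lemma tlift_eq_tsum:
  assumes f: "bilinear_map s1 s2 s3 f" and t: "t \<in> tprod s1 s2 UNIV UNIV"
  shows "tlift s1 s2 s3 f t = tsum s1 s2 f t"
proof -
  have "tlift s1 s2 s3 f t = tlift s1 s2 s3 f (tsum s1 s2 (tens s1 s2) t)"
    using tsum_tens[OF bilinear_map_vs(1,2)[OF f] t] by simp
  also have "\<dots> = tsum s1 s2 f t"
    unfolding tsum_def by (simp add: linear_map_sum_list[OF tlift(1)[OF f]] tlift(2)[OF f])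
  finally show ?thesis .
qed

lemma tsum_linear:
  "linear_map s s' g \<Longrightarrow> g (tsum s1 s2 f t) = tsum s1 s2 (\<lambda>a b. g (f a b)) t"
  unfolding tsum_def by (rule linear_map_sum_list)

lemma tsum_cong: "(\<And>a b. f a b = g a b) \<Longrightarrow> tsum s1 s2 f t = tsum s1 s2 g t"
  unfolding tsum_def by simp

lemma tsum_swap:
  "tsum s1 s2 (\<lambda>a b. tsum s3 s4 (\<lambda>c d. F a b c d) u) t = tsum s3 s4 (\<lambda>c d. tsum s1 s2 (\<lambda>a b. F a b c d) t) u"
proof -
  have "(\<Sum>p\<leftarrow>ps. \<Sum>q\<leftarrow>qs. G p q) = (\<Sum>q\<leftarrow>qs. \<Sum>p\<leftarrow>ps. G p q)"
    for ps :: "'p list" and qs :: "'q list" and G :: "'p \<Rightarrow> 'q \<Rightarrow> 'z::comm_monoid_add"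
    by (induction ps) (auto simp: sum_list_addf)
  then show ?thesis unfolding tsum_def .
qed

lemma tsum_in_subspace:
  assumes "vector_space s" and "module.subspace s V" "\<And>a b. f a b \<in> V"
  shows "tsum s1 s2 f t \<in> V"
proof -
  interpret vector_space s by fact
  have "(\<Sum>p\<leftarrow>ps. f (fst p) (snd p)) \<in> V" for ps
    by (induction ps) (auto intro: subspace_0 subspace_add assms)
  then show ?thesis unfolding tsum_def .
qed

lemma lin_tsum [lin]:
  "vector_space s \<Longrightarrow> vector_space s' \<Longrightarrow> (\<And>a b. linear_map s s' (\<lambda>x. F x a b)) \<Longrightarrow>
    linear_map s s' (\<lambda>x. tsum s1 s2 (F x) t)"
  unfolding tsum_def by (rule lin_sum_list)

text \<open>
  A map that is multilinear on pure tensors need not be linear in its remaining arguments when a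
  tensor argument lies outside the span of pure tensors. Composing with a projection onto that span
  repairs this; it is how maps out of threefold tensor products are constructed below.
\<close>

lemma linear_projection:
  assumes "vector_space s" "module.subspace s V"
  obtains p where "linear_map s s p" "\<And>x. p x \<in> V" "\<And>x. x \<in> V \<Longrightarrow> p x = x"
proof -
  interpret vector_space s by fact
  interpret vector_space_pair s s ..
  from linear_exists_left_inverse_on[OF lin_id[OF assms(1)] assms(2)] show thesis
    using that by (auto simp: image_subset_iff)
qed


section \<open>Graded components and induction on forms\<close>

locale dg_algebra =
  fixes \<Omega> :: "('k::field, 'a, 'o::ab_group_add) dcalc"
  assumes is_dga: "is_dga \<Omega>"
begin

lemma vector_space_dscale [lin]: "vector_space (dscale \<Omega>)"
  using is_dga unfolding is_dga_def by blast

sublocale vector_space "dscale \<Omega>"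
  by (rule vector_space_dscale)

lemma subspace_dpart: "subspace (dpart \<Omega> n)"
  using is_dga unfolding is_dga_def by blast

lemma bilinear_wedge: "bilinear_map (dscale \<Omega>) (dscale \<Omega>) (dscale \<Omega>) (wedge \<Omega>)"
  using is_dga unfolding is_dga_def by blast

lemmas lin_wedge [lin] = bilinear_mapD[OF bilinear_wedge]

lemma linear_dd: "linear_map (dscale \<Omega>) (dscale \<Omega>) (dd \<Omega>)"
  using is_dga unfolding is_dga_def by blast

lemmas lin_dd [lin] = linear_map_comp[OF linear_dd]

lemma wedge_assoc: "wedge \<Omega> (wedge \<Omega> x y) z = wedge \<Omega> x (wedge \<Omega> y z)"
  and wedge_unit [simp]: "wedge \<Omega> (dunit \<Omega>) x = x" "wedge \<Omega> x (dunit \<Omega>) = x"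
  and dunit_dpart: "dunit \<Omega> \<in> dpart \<Omega> 0"
  using is_dga unfolding is_dga_def by blast+

lemma wedge_dpart: "x \<in> dpart \<Omega> m \<Longrightarrow> y \<in> dpart \<Omega> n \<Longrightarrow> wedge \<Omega> x y \<in> dpart \<Omega> (m + n)"
  using is_dga unfolding is_dga_def by blast

lemma dd_dpart: "x \<in> dpart \<Omega> n \<Longrightarrow> dd \<Omega> x \<in> dpart \<Omega> (Suc n)"
  using is_dga unfolding is_dga_def by blast

lemma is_decomp_hcomp: "is_decomp \<Omega> x (\<lambda>n. hcomp \<Omega> n x)"
proof -
  have "\<exists>!c. is_decomp \<Omega> x c" using is_dga unfolding is_dga_def by blast
  from theI'[OF this] show ?thesis unfolding hcomp_def .
qed

lemma hcomp_eqI: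
  assumes "\<And>n. c n \<in> dpart \<Omega> n" "finite K" "\<And>n. n \<notin> K \<Longrightarrow> c n = 0" "x = (\<Sum>n\<in>K. c n)"
  shows "hcomp \<Omega> n x = c n"
proof -
  have sub: "{n. c n \<noteq> 0} \<subseteq> K" using assms(3) by auto
  have "is_decomp \<Omega> x c"
    unfolding is_decomp_def assms(4) using assms(1) finite_subset[OF sub assms(2)] sub
    by (auto intro!: sum.mono_neutral_right[OF assms(2)])
  moreover have "\<exists>!c. is_decomp \<Omega> x c" using is_dga unfolding is_dga_def by blast
  ultimately have "c = (\<lambda>n. hcomp \<Omega> n x)" using is_decomp_hcomp by blast
  then show ?thesis by simp
qed

lemma hcomp_dpart: "hcomp \<Omega> n x \<in> dpart \<Omega> n"
  and finite_hcomp: "finite {n. hcomp \<Omega> n x \<noteq> 0}"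
  and hcomp_sum: "x = (\<Sum>n | hcomp \<Omega> n x \<noteq> 0. hcomp \<Omega> n x)"
  using is_decomp_hcomp[of x] unfolding is_decomp_def by auto

lemma hcomp_sum_superset:
  assumes "finite K" "{n. hcomp \<Omega> n x \<noteq> 0} \<subseteq> K"
  shows "x = (\<Sum>n\<in>K. hcomp \<Omega> n x)"
  by (subst hcomp_sum, rule sum.mono_neutral_left) (use assms in auto)

lemma linear_hcomp: "linear_map (dscale \<Omega>) (dscale \<Omega>) (hcomp \<Omega> n)"
  unfolding linear_map_iff
proof (intro conjI allI vector_space_dscale)
  fix x y c
  let ?K = "{n. hcomp \<Omega> n x \<noteq> 0} \<union> {n. hcomp \<Omega> n y \<noteq> 0}"
  have K: "finite ?K" using finite_hcomp by auto
  show "hcomp \<Omega> n (x + y) = hcomp \<Omega> n x + hcomp \<Omega> n y"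
  proof (rule hcomp_eqI[OF _ K])
    show "x + y = (\<Sum>n\<in>?K. hcomp \<Omega> n x + hcomp \<Omega> n y)"
      unfolding sum.distrib using hcomp_sum_superset[OF K, of x] hcomp_sum_superset[OF K, of y] by auto
  qed (auto intro: subspace_add subspace_dpart hcomp_dpart)
  show "hcomp \<Omega> n (dscale \<Omega> c x) = dscale \<Omega> c (hcomp \<Omega> n x)"
  proof (rule hcomp_eqI[OF _ finite_hcomp[of x]])
    show "dscale \<Omega> c x = (\<Sum>n | hcomp \<Omega> n x \<noteq> 0. dscale \<Omega> c (hcomp \<Omega> n x))"
      unfolding scale_sum_right[symmetric] using hcomp_sum[of x] by simp
  qed (auto intro: subspace_scale subspace_dpart hcomp_dpart)
qed

lemmas lin_hcomp [lin] = linear_map_comp[OF linear_hcomp]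

lemma hcomp_homogeneous: "x \<in> dpart \<Omega> n \<Longrightarrow> hcomp \<Omega> k x = (if k = n then x else 0)"
  by (rule hcomp_eqI[where K = "{n}"]) (auto intro: subspace_0 subspace_dpart)

lemma hext_homogeneous: "x \<in> dpart \<Omega> n \<Longrightarrow> f n 0 = 0 \<Longrightarrow> hext \<Omega> f x = f n x"
  unfolding hext_def by (cases "x = 0") (simp_all add: hcomp_homogeneous)

lemma hext_superset:
  assumes "finite K" "{n. hcomp \<Omega> n x \<noteq> 0} \<subseteq> K" "\<And>n. f n 0 = 0"
  shows "hext \<Omega> f x = (\<Sum>n\<in>K. f n (hcomp \<Omega> n x))"
  unfolding hext_def by (rule sum.mono_neutral_left) (use assms in auto)

lemma linear_hext:
  assumes f: "\<And>n. linear_map (dscale \<Omega>) s (f n)"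
  shows "linear_map (dscale \<Omega>) s (hext \<Omega> f)"
  unfolding linear_map_iff
proof (intro conjI allI vector_space_dscale linear_map_vs2[OF f])
  fix x y c
  interpret s: vector_space s by (rule linear_map_vs2[OF f])
  note f0 = linear_map_zero[OF f] and hc = linear_hcomp
  let ?K = "{n. hcomp \<Omega> n x \<noteq> 0} \<union> {n. hcomp \<Omega> n y \<noteq> 0}"
  have K: "finite ?K" using finite_hcomp by auto
  have sub: "{n. hcomp \<Omega> n (x + y) \<noteq> 0} \<subseteq> ?K" "{n. hcomp \<Omega> n (dscale \<Omega> c x) \<noteq> 0} \<subseteq> ?K"
    by (auto simp: linear_map_add[OF hc] linear_map_scale[OF hc])
  have *: "hext \<Omega> f z = (\<Sum>n\<in>?K. f n (hcomp \<Omega> n z))" if "{n. hcomp \<Omega> n z \<noteq> 0} \<subseteq> ?K" for z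
    by (rule hext_superset[OF K that]) (rule f0)
  have **: "hext \<Omega> f x = (\<Sum>n\<in>?K. f n (hcomp \<Omega> n x))" "hext \<Omega> f y = (\<Sum>n\<in>?K. f n (hcomp \<Omega> n y))"
    by (rule *; blast)+
  show "hext \<Omega> f (x + y) = hext \<Omega> f x + hext \<Omega> f y"
    unfolding *[OF sub(1)] **
    by (simp add: linear_map_add[OF hc] linear_map_add[OF f] sum.distrib)
  show "hext \<Omega> f (dscale \<Omega> c x) = s c (hext \<Omega> f x)"
    unfolding *[OF sub(2)] **
    by (simp add: linear_map_scale[OF hc] linear_map_scale[OF f] s.scale_sum_right)
qed

lemma lin_hext [lin]:
  "(\<And>n. linear_map (dscale \<Omega>) s' (f n)) \<Longrightarrow> linear_map s (dscale \<Omega>) g \<Longrightarrow> linear_map s s' (\<lambda>x. hext \<Omega> f (g x))"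
  by (rule linear_map_comp[OF linear_hext])

lemma lin_hext_family [lin]:
  "vector_space s \<Longrightarrow> vector_space s' \<Longrightarrow> (\<And>n w. linear_map s s' (\<lambda>x. F x n w)) \<Longrightarrow>
    linear_map s s' (\<lambda>x. hext \<Omega> (F x) w)"
  unfolding hext_def by (rule lin_sum)

lemma linear_eq_homogeneousI:
  assumes f: "linear_map (dscale \<Omega>) s f" and g: "linear_map (dscale \<Omega>) s g"
    and eq: "\<And>n x. x \<in> dpart \<Omega> n \<Longrightarrow> f x = g x"
  shows "f x = g x"
proof -
  have "f (\<Sum>n | hcomp \<Omega> n x \<noteq> 0. hcomp \<Omega> n x) = g (\<Sum>n | hcomp \<Omega> n x \<noteq> 0. hcomp \<Omega> n x)"
    unfolding linear_map_sum[OF f] linear_map_sum[OF g]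
    by (rule sum.cong) (auto intro: eq hcomp_dpart)
  then show ?thesis unfolding hcomp_sum[symmetric] .
qed

lemma hext_same:
  assumes "linear_map (dscale \<Omega>) s f" shows "hext \<Omega> (\<lambda>_. f) x = f x"
  unfolding hext_def linear_map_sum[OF assms, symmetric] by (subst hcomp_sum[symmetric]) (rule refl)

lemma wedge_list_Cons: "wedge_list \<Omega> (x # xs) = wedge \<Omega> x (wedge_list \<Omega> xs)"
  by (cases xs) simp_all

lemma wedge_list_append: "wedge_list \<Omega> (xs @ ys) = wedge \<Omega> (wedge_list \<Omega> xs) (wedge_list \<Omega> ys)"
  by (induction xs) (simp_all add: wedge_list_Cons wedge_assoc)

end

locale calculus = dg_algebra \<Omega>
  for \<Omega> :: "('k::field, 'a::{ring,monoid_mult}, 'o::ab_group_add) dcalc" +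
  fixes s :: "'k \<Rightarrow> 'a \<Rightarrow> 'a"
  assumes is_dc: "is_dc s \<Omega>"
begin

lemma linear_dcincl: "linear_map s (dscale \<Omega>) (dcincl \<Omega>)"
  and inj_dcincl: "inj (dcincl \<Omega>)"
  and range_dcincl: "range (dcincl \<Omega>) = dpart \<Omega> 0"
  and dcincl_one: "dcincl \<Omega> 1 = dunit \<Omega>"
  and dcincl_mult: "dcincl \<Omega> (a * b) = wedge \<Omega> (dcincl \<Omega> a) (dcincl \<Omega> b)"
  using is_dc unfolding is_dc_def by blast+

lemmas lin_dcincl [lin] = linear_map_comp[OF linear_dcincl]

lemma dpart_span:
  "dpart \<Omega> n = span {wedge_list \<Omega> (form_factors \<Omega> a0 as) | a0 as. length as = n}"
  using is_dc unfolding is_dc_def by blast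

lemma dcincl_dpart: "dcincl \<Omega> a \<in> dpart \<Omega> 0"
  using range_dcincl by blast

lemma vector_space_s [lin]: "vector_space s"
  by (rule linear_map_vs1[OF linear_dcincl])

lemma form_dpart: "wedge_list \<Omega> (form_factors \<Omega> a0 as) \<in> dpart \<Omega> (length as)"
  unfolding dpart_span by (rule span_base) auto

text \<open>
  Every form is a linear combination of products \<open>a\<^sup>0 da\<^sup>1 \<and> \<dots> \<and> da\<^sup>n\<close>, and these are built from the
  right by multiplying with elements \<open>a\<close> and differentials \<open>da\<close>, starting from \<open>1\<close>.
\<close>

lemma form_induct [case_names add incl mult diff]:
  assumes add: "\<And>c x y. P x \<Longrightarrow> P y \<Longrightarrow> P (dscale \<Omega> c x + y)"
    and incl: "\<And>a. P (dcincl \<Omega> a)"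
    and mult: "\<And>a x. P x \<Longrightarrow> P (wedge \<Omega> (dcincl \<Omega> a) x)"
    and diff: "\<And>a x. P x \<Longrightarrow> P (wedge \<Omega> (dd \<Omega> (dcincl \<Omega> a)) x)"
  shows "P x"
proof -
  have P0: "P 0" using incl[of 0] linear_map_zero[OF linear_dcincl] by simp
  have list: "P (wedge_list \<Omega> (map (\<lambda>a. dd \<Omega> (dcincl \<Omega> a)) as))" for as
    by (induction as) (simp_all add: wedge_list_Cons diff incl dcincl_one[symmetric])
  have homog: "P x" if "x \<in> dpart \<Omega> n" for x n
    using that unfolding dpart_span
    by (induction rule: span_induct_alt)
      (auto simp: P0 form_factors_def wedge_list_Cons intro!: add mult list)
  have add1: "P (u + v)" if "P u" "P v" for u v
    using add[OF that, of 1] by simp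
  have "P (\<Sum>n\<in>K. hcomp \<Omega> n x)" for K
    by (induction K rule: infinite_finite_induct) (auto simp: P0 intro!: add1 homog[OF hcomp_dpart])
  from this[of "{n. hcomp \<Omega> n x \<noteq> 0}"] show ?thesis unfolding hcomp_sum[symmetric] .
qed

lemma linear_eq_formI:
  assumes f: "linear_map (dscale \<Omega>) s' f" and g: "linear_map (dscale \<Omega>) s' g"
    and incl: "\<And>a. f (dcincl \<Omega> a) = g (dcincl \<Omega> a)"
    and mult: "\<And>a x. f x = g x \<Longrightarrow> f (wedge \<Omega> (dcincl \<Omega> a) x) = g (wedge \<Omega> (dcincl \<Omega> a) x)"
    and diff: "\<And>a x. f x = g x \<Longrightarrow>
      f (wedge \<Omega> (dd \<Omega> (dcincl \<Omega> a)) x) = g (wedge \<Omega> (dd \<Omega> (dcincl \<Omega> a)) x)"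
  shows "f x = g x"
  by (induction x rule: form_induct)
    (simp_all add: incl mult diff linear_mapD(3,4)[OF f] linear_mapD(3,4)[OF g])

text \<open>
  The product \<open>a\<^sup>0 da\<^sup>1 \<and> \<dots> \<and> da\<^bsup>m+n\<^esup>\<close> is cut after \<open>da\<^sup>m\<close>, and the second piece is given the leading
  coefficient \<open>1\<close>.
\<close>

lemma dpart_add_span:
  "dpart \<Omega> (m + n) \<subseteq> span {wedge \<Omega> x y | x y. x \<in> dpart \<Omega> m \<and> y \<in> dpart \<Omega> n}"
proof -
  have "wedge_list \<Omega> (form_factors \<Omega> a0 as) \<in> span {wedge \<Omega> x y | x y. x \<in> dpart \<Omega> m \<and> y \<in> dpart \<Omega> n}"
    if len: "length as = m + n" for a0 as
  proof -
    let ?x = "wedge_list \<Omega> (form_factors \<Omega> a0 (take m as))"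
    let ?y = "wedge_list \<Omega> (form_factors \<Omega> 1 (drop m as))"
    have "form_factors \<Omega> a0 as = form_factors \<Omega> a0 (take m as) @ map (\<lambda>a. dd \<Omega> (dcincl \<Omega> a)) (drop m as)"
      unfolding form_factors_def by (simp add: map_append[symmetric] del: map_append)
    then have "wedge_list \<Omega> (form_factors \<Omega> a0 as) = wedge \<Omega> ?x ?y"
      unfolding form_factors_def[of \<Omega> 1] by (simp add: wedge_list_append wedge_list_Cons dcincl_one)
    moreover have "?x \<in> dpart \<Omega> m" "?y \<in> dpart \<Omega> n"
      using form_dpart[of a0 "take m as"] form_dpart[of 1 "drop m as"] len by simp_all
    ultimately show ?thesis by (intro span_base) auto
  qed
  then show ?thesis unfolding dpart_span by (intro span_minimal) auto
qed

end

section \<open>Sweedler calculus in a Hopf algebra\<close>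

locale hopf_algebra =
  fixes H :: "('k::field, 'h::{ring,monoid_mult}) hopf"
  assumes is_hopf: "is_hopf H"
begin

abbreviation "sH \<equiv> hscale H"

lemma is_algebra_H: "is_algebra sH"
  using is_hopf unfolding is_hopf_def by blast

lemma vector_space_sH [lin]: "vector_space sH"
  and scale_mult_left: "sH c (x * y) = sH c x * y"
  and scale_mult_right: "sH c (x * y) = x * sH c y"
  using is_algebra_H unfolding is_algebra_def by blast+

lemma bilinear_mult: "bilinear_map sH sH sH (*)"
  unfolding bilinear_map_def linear_map_iff
  by (simp add: vector_space_sH distrib_left distrib_right scale_mult_left[symmetric] scale_mult_right[symmetric])

lemmas lin_mult [lin] = bilinear_mapD[OF bilinear_mult]

lemma linear_comul: "linear_map sH tscale (comul H)"
  and linear_counit: "linear_map sH (*) (counit H)"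
  and linear_antipode: "linear_map sH sH (antipode H)"
  using is_hopf unfolding is_hopf_def by blast+

lemmas lin_comul [lin] = linear_map_comp[OF linear_comul]
  and lin_counit [lin] = linear_map_comp[OF linear_counit]
  and lin_antipode [lin] = linear_map_comp[OF linear_antipode]

lemma comul_tprod: "comul H h \<in> tprod sH sH UNIV UNIV"
  using is_hopf unfolding is_hopf_def by blast

text \<open>
  \<open>SW f h\<close> is \<open>f h\<^sub>1 h\<^sub>2\<close>. Identities between iterated coproducts are stated in this form for all
  multilinear \<open>f\<close>, which avoids threefold tensor products.
\<close>

definition SW :: "('h \<Rightarrow> 'h \<Rightarrow> 'c::comm_monoid_add) \<Rightarrow> 'h \<Rightarrow> 'c" where
  "SW f h = tsum sH sH f (comul H h)"

lemma tlift_comul: "bilinear_map sH sH s f \<Longrightarrow> tlift sH sH s f (comul H h) = SW f h"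
  unfolding SW_def by (rule tlift_eq_tsum[OF _ comul_tprod])

lemma sw_SW: "bilinear_map sH sH s f \<Longrightarrow> sw H s f h = SW f h"
  unfolding sw_def by (rule tlift_comul)

lemma lin_SW_family [lin]:
  "vector_space s \<Longrightarrow> vector_space s' \<Longrightarrow> (\<And>a b. linear_map s s' (\<lambda>x. F x a b)) \<Longrightarrow>
    linear_map s s' (\<lambda>x. SW (F x) h)"
  unfolding SW_def by (rule lin_tsum)

lemma linear_SW: "bilinear_map sH sH s f \<Longrightarrow> linear_map sH s (SW f)"
  using linear_map_comp[OF tlift(1) linear_comul] tlift_comul by force

lemma lin_SW [lin]:
  "bilinear_map sH sH s' f \<Longrightarrow> linear_map s sH g \<Longrightarrow> linear_map s s' (\<lambda>x. SW f (g x))"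
  by (rule linear_map_comp[OF linear_SW])

lemma SW_linear: "linear_map s s' g \<Longrightarrow> g (SW f h) = SW (\<lambda>a b. g (f a b)) h"
  unfolding SW_def by (rule tsum_linear)

lemma SW_cong: "(\<And>a b. f a b = g a b) \<Longrightarrow> SW f h = SW g h"
  unfolding SW_def by (rule tsum_cong)

lemma SW_one: assumes f: "bilinear_map sH sH s f" shows "SW f 1 = f 1 1"
proof -
  have "comul H 1 = htens H 1 1" using is_hopf unfolding is_hopf_def by blast
  then show ?thesis by (simp add: tlift_comul[OF f, symmetric] tlift(2)[OF f])
qed

lemma SW_mult:
  assumes f: "bilinear_map sH sH s f"
  shows "SW f (g * h) = SW (\<lambda>g1 g2. SW (\<lambda>h1 h2. f (g1 * h1) (g2 * h2)) h) g"
proof -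
  have "comul H (g * h) = sw H tscale (\<lambda>g1 g2. sw H tscale (\<lambda>h1 h2. htens H (g1 * h1) (g2 * h2)) h) g"
    using is_hopf unfolding is_hopf_def by blast
  also have "\<dots> = SW (\<lambda>g1 g2. SW (\<lambda>h1 h2. htens H (g1 * h1) (g2 * h2)) h) g"
  proof -
    have *: "sw H tscale (\<lambda>h1 h2. htens H (g1 * h1) (g2 * h2)) h = SW (\<lambda>h1 h2. htens H (g1 * h1) (g2 * h2)) h"
      for g1 g2 by (intro sw_SW lin)
    show ?thesis unfolding * by (intro sw_SW lin)
  qed
  finally have eq: "comul H (g * h) = \<dots>" .
  show ?thesis
    unfolding tlift_comul[OF f, symmetric] eq SW_linear[OF tlift(1)[OF f]] tlift(2)[OF f] ..
qed

text \<open>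
  The coassociativity axiom is an equation in \<open>H \<otimes> (H \<otimes> H)\<close>; applying to it the linear map induced by
  \<open>f\<close> gives the identity.
\<close>

lemma SW_coassoc:
  assumes f: "trilinear_map sH sH sH s f"
  shows "SW (\<lambda>x z. SW (\<lambda>x1 x2. f x1 x2 z) x) h = SW (\<lambda>x z. SW (\<lambda>z1 z2. f x z1 z2) z) h"
proof -
  note [lin] = trilinear_mapD[OF f] trilinear_map_vs[OF f]
  have bil: "bilinear_map sH sH s (f x)" for x by (intro lin)
  obtain p where p: "linear_map tscale tscale p" "\<And>t. p t \<in> tprod sH sH UNIV UNIV"
    "\<And>t. t \<in> tprod sH sH UNIV UNIV \<Longrightarrow> p t = t"
    using linear_projection[OF vector_space_tscale subspace_tprod, of sH sH UNIV UNIV] by blast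
  note [lin] = linear_map_comp[OF p(1)]
  let ?g = "\<lambda>x t. tlift sH sH s (f x) (p t)"
  have g_tens: "?g x (htens H y z) = f x y z" for x y z
    using tlift(2)[OF bil] p(3)[OF tens_in_tprod] by simp
  have "linear_map sH s (\<lambda>x. ?g x t)" for t
    unfolding tlift_eq_tsum[OF bil p(2)] by (intro lin)
  then have g: "bilinear_map sH tscale s ?g" by (intro lin bil)
  let ?L = "tlift sH tscale s ?g"
  have 1: "sw H tscale (\<lambda>x z. sw H tscale (\<lambda>x1 x2. tens sH tscale x1 (htens H x2 z)) x) h =
      SW (\<lambda>x z. SW (\<lambda>x1 x2. tens sH tscale x1 (htens H x2 z)) x) h"
  proof -
    have *: "sw H tscale (\<lambda>x1 x2. tens sH tscale x1 (htens H x2 z)) x = SW (\<lambda>x1 x2. tens sH tscale x1 (htens H x2 z)) x"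
      for x z by (intro sw_SW lin)
    show ?thesis unfolding * by (intro sw_SW lin)
  qed
  have 2: "sw H tscale (\<lambda>x z. sw H tscale (\<lambda>z1 z2. tens sH tscale x (htens H z1 z2)) z) h =
      SW (\<lambda>x z. SW (\<lambda>z1 z2. tens sH tscale x (htens H z1 z2)) z) h"
  proof -
    have *: "sw H tscale (\<lambda>z1 z2. tens sH tscale x (htens H z1 z2)) z = SW (\<lambda>z1 z2. tens sH tscale x (htens H z1 z2)) z"
      for x z by (intro sw_SW lin)
    show ?thesis unfolding * by (intro sw_SW lin)
  qed
  have "SW (\<lambda>x z. SW (\<lambda>x1 x2. tens sH tscale x1 (htens H x2 z)) x) h =
      SW (\<lambda>x z. SW (\<lambda>z1 z2. tens sH tscale x (htens H z1 z2)) z) h"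
    using is_hopf unfolding is_hopf_def 1[symmetric] 2[symmetric] by blast
  then have "?L (SW (\<lambda>x z. SW (\<lambda>x1 x2. tens sH tscale x1 (htens H x2 z)) x) h) =
      ?L (SW (\<lambda>x z. SW (\<lambda>z1 z2. tens sH tscale x (htens H z1 z2)) z) h)"
    by (rule arg_cong)
  then show ?thesis
    unfolding SW_linear[OF tlift(1)[OF g]] tlift(2)[OF g] g_tens .
qed

lemma SW_counit_left: "linear_map sH s f \<Longrightarrow> SW (\<lambda>h1 h2. s (counit H h1) (f h2)) h = f h"
proof -
  assume f: "linear_map sH s f"
  have "SW (\<lambda>h1 h2. sH (counit H h1) h2) h = sw H sH (\<lambda>h1 h2. sH (counit H h1) h2) h"
    by (rule sw_SW[symmetric], intro lin)
  also have "\<dots> = h" using is_hopf unfolding is_hopf_def by blast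
  finally have "f (SW (\<lambda>h1 h2. sH (counit H h1) h2) h) = f h" by simp
  then show ?thesis unfolding SW_linear[OF f] linear_map_scale[OF f] .
qed

lemma SW_counit_right: "linear_map sH s f \<Longrightarrow> SW (\<lambda>h1 h2. s (counit H h2) (f h1)) h = f h"
proof -
  assume f: "linear_map sH s f"
  have "SW (\<lambda>h1 h2. sH (counit H h2) h1) h = sw H sH (\<lambda>h1 h2. sH (counit H h2) h1) h"
    by (rule sw_SW[symmetric], intro lin)
  also have "\<dots> = h" using is_hopf unfolding is_hopf_def by blast
  finally have "f (SW (\<lambda>h1 h2. sH (counit H h2) h1) h) = f h" by simp
  then show ?thesis unfolding SW_linear[OF f] linear_map_scale[OF f] .
qed

lemma SW_antipode_left: "SW (\<lambda>h1 h2. antipode H h1 * h2) h = sH (counit H h) 1"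
proof -
  have "SW (\<lambda>h1 h2. antipode H h1 * h2) h = sw H sH (\<lambda>h1 h2. antipode H h1 * h2) h"
    by (rule sw_SW[symmetric], intro lin)
  also have "\<dots> = sH (counit H h) 1" using is_hopf unfolding is_hopf_def by blast
  finally show ?thesis .
qed

lemma SW_antipode_right: "SW (\<lambda>h1 h2. h1 * antipode H h2) h = sH (counit H h) 1"
proof -
  have "SW (\<lambda>h1 h2. h1 * antipode H h2) h = sw H sH (\<lambda>h1 h2. h1 * antipode H h2) h"
    by (rule sw_SW[symmetric], intro lin)
  also have "\<dots> = sH (counit H h) 1" using is_hopf unfolding is_hopf_def by blast
  finally show ?thesis .
qed

lemma counit_one: "counit H 1 = 1" and counit_mult: "counit H (g * h) = counit H g * counit H h"
  using is_hopf unfolding is_hopf_def by blast+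

end

section \<open>The left coaction on forms\<close>

context calculus
begin

definition proj0 :: "'o \<Rightarrow> 'a" where
  "proj0 x = inv (dcincl \<Omega>) (hcomp \<Omega> 0 x)"

lemma dcincl_proj0: "dcincl \<Omega> (proj0 x) = hcomp \<Omega> 0 x"
  unfolding proj0_def using hcomp_dpart[of 0 x] unfolding range_dcincl[symmetric] by (rule f_inv_into_f)

lemma proj0_dcincl [simp]: "proj0 (dcincl \<Omega> a) = a"
  unfolding proj0_def by (simp add: hcomp_homogeneous[OF dcincl_dpart] inv_f_f[OF inj_dcincl])

lemma linear_proj0: "linear_map (dscale \<Omega>) s proj0"
  unfolding linear_map_iff
  by (intro conjI allI vector_space_s vector_space_dscale; rule injD[OF inj_dcincl])
    (simp_all add: dcincl_proj0 linear_mapD(3,4)[OF linear_dcincl] linear_mapD(3,4)[OF linear_hcomp])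

lemmas lin_proj0 [lin] = linear_map_comp[OF linear_proj0]

lemma proj0_positive: "x \<in> dpart \<Omega> n \<Longrightarrow> n > 0 \<Longrightarrow> proj0 x = 0"
  by (rule injD[OF inj_dcincl])
    (simp add: dcincl_proj0 hcomp_homogeneous linear_map_zero[OF linear_dcincl])

lemma dpart_0E: assumes "x \<in> dpart \<Omega> 0" obtains a where "x = dcincl \<Omega> a"
  using assms range_dcincl by blast

lemma proj0_dd: "proj0 (wedge \<Omega> (dd \<Omega> y) x) = 0" if "y \<in> dpart \<Omega> m"
proof (rule linear_eq_homogeneousI[where s = s and f = "\<lambda>x. proj0 (wedge \<Omega> (dd \<Omega> y) x)" and g = "\<lambda>_. 0"])
  show "proj0 (wedge \<Omega> (dd \<Omega> y) x) = 0" if "x \<in> dpart \<Omega> n" for x n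
    using wedge_dpart[OF dd_dpart[OF \<open>y \<in> dpart \<Omega> m\<close>] that] by (rule proj0_positive) simp
qed (intro lin)+

end

lemma tensor_part_eqI:
  assumes "linear_map tscale s f" "linear_map tscale s g" "t \<in> tensor_part \<Omega> \<Omega>' n"
    and "\<And>i x y. i \<le> n \<Longrightarrow> x \<in> dpart \<Omega> (n - i) \<Longrightarrow> y \<in> dpart \<Omega>' i \<Longrightarrow>
      f (otens \<Omega> \<Omega>' x y) = g (otens \<Omega> \<Omega>' x y)"
  shows "f t = g t"
proof (rule linear_eq_on_span[OF assms(1-2) assms(3)[unfolded tensor_part_def]])
  fix t assume "t \<in> (\<Union>i\<le>n. tprod (dscale \<Omega>) (dscale \<Omega>') (dpart \<Omega> (n - i)) (dpart \<Omega>' i))"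
  then obtain i where "i \<le> n" and t: "t \<in> tprod (dscale \<Omega>) (dscale \<Omega>') (dpart \<Omega> (n - i)) (dpart \<Omega>' i)"
    by auto
  then show "f t = g t"
    by (intro tensor_maps_eqI[OF assms(1,2) _ t] assms(4)) auto
qed

lemma tensor_part_subset: "tensor_part \<Omega> \<Omega>' n \<subseteq> tprod (dscale \<Omega>) (dscale \<Omega>') UNIV UNIV"
proof -
  interpret t: vector_space tscale by (rule vector_space_tscale)
  show ?thesis unfolding tensor_part_def
    by (intro t.span_minimal subspace_tprod UN_least tprod_mono subset_UNIV)
qed

locale hopf_calculus = hopf_algebra H + calculus \<Omega> "hscale H"
  for H :: "('k::field, 'h::{ring,monoid_mult}) hopf" and \<Omega> :: "('k, 'h, 'p::ab_group_add) dcalc" +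
  assumes comul_differentiable: "comul_differentiable H \<Omega>"
begin

abbreviation "sO \<equiv> dscale \<Omega>"
abbreviation "\<iota> \<equiv> dcincl \<Omega>"
abbreviation forms_wedge (infixr "\<and>\<^sub>\<Omega>" 70) where "x \<and>\<^sub>\<Omega> y \<equiv> wedge \<Omega> x y"

abbreviation "TD \<equiv> tensor_dc sH sH \<Omega> \<Omega>"

text \<open>
  The product \<open>(x \<otimes> y) \<and> (x' \<otimes> y') = (-1)\<^bsup>|y||x'|\<^esup> (x \<and> x') \<otimes> (y \<and> y')\<close> of the tensor product calculus,
  as a map that is linear in each of the four forms.
\<close>

definition koszul :: "'p \<Rightarrow> 'p \<Rightarrow> 'p \<Rightarrow> 'p \<Rightarrow> ('k, 'p, 'p) tensor" where
  "koszul x y x' y' = hext \<Omega> (\<lambda>j y. hext \<Omega> (\<lambda>k x'.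
     tscale ((- 1) ^ (j * k)) (otens \<Omega> \<Omega> (x \<and>\<^sub>\<Omega> x') (y \<and>\<^sub>\<Omega> y'))) x') y"

lemma bilinear_koszul_right: "bilinear_map sO sO tscale (koszul x y)"
  unfolding koszul_def by (intro lin)

lemma bilinear_koszul_left: "bilinear_map sO sO tscale (\<lambda>x y. koszul x y x' y')"
  unfolding koszul_def by (intro lin)

lemmas lin_koszul [lin] = bilinear_mapD[OF bilinear_koszul_right] bilinear_mapD[OF bilinear_koszul_left]

lemma wedge_TD: "wedge TD u u' = olift \<Omega> \<Omega> tscale (\<lambda>x y. olift \<Omega> \<Omega> tscale (koszul x y) u') u"
  unfolding tensor_dc_def koszul_def by simp

lemma wedge_TD_tens:
  assumes "u' \<in> tprod sO sO UNIV UNIV"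
  shows "wedge TD (otens \<Omega> \<Omega> x y) u' = tsum sO sO (koszul x y) u'"
    and "linear_map tscale tscale (\<lambda>u. wedge TD u u')"
proof -
  have *: "olift \<Omega> \<Omega> tscale (koszul x y) u' = tsum sO sO (koszul x y) u'" for x y
    by (rule tlift_eq_tsum[OF _ assms]) (intro lin)
  show "wedge TD (otens \<Omega> \<Omega> x y) u' = tsum sO sO (koszul x y) u'"
    unfolding wedge_TD * by (rule tlift(2)) (intro lin)
  show "linear_map tscale tscale (\<lambda>u. wedge TD u u')"
    unfolding wedge_TD * by (intro lin)
qed

abbreviation "\<Delta>F \<equiv> dcomul H \<Omega>"

text \<open>
  A morphism of calculi is determined by its restriction to degree 0, by induction on forms; so the
  extension chosen in \<open>dcomul\<close> is the one that exists by differentiability.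
\<close>

lemma morphism_comul: "dc_morphism \<Omega> TD (comul H) \<Delta>F"
proof -
  obtain F where F: "dc_morphism \<Omega> TD (comul H) F"
    using comul_differentiable unfolding comul_differentiable_def differentiable_map_def by blast
  have "G = F" if G: "dc_morphism \<Omega> TD (comul H) G" for G
  proof
    fix x
    note M = F[unfolded dc_morphism_def] G[unfolded dc_morphism_def]
    show "G x = F x"
      by (rule linear_eq_formI[where f = G and g = F and s' = "dscale TD"])
        (use M in \<open>auto\<close>)
  qed
  then show ?thesis
    unfolding dcomul_def dc_ext_def by (intro theI[of "dc_morphism \<Omega> TD (comul H)"]) (use F in auto)
qed

lemma linear_comul_forms: "linear_map sO tscale \<Delta>F"
  using morphism_comul unfolding dc_morphism_def by (simp add: tensor_dc_def)

lemmas lin_comul_forms [lin] = linear_map_comp[OF linear_comul_forms]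

lemma comul_forms_part: "x \<in> dpart \<Omega> n \<Longrightarrow> \<Delta>F x \<in> tensor_part \<Omega> \<Omega> n"
  using morphism_comul unfolding dc_morphism_def by (auto simp: tensor_dc_def)

lemma comul_forms_tprod: "\<Delta>F x \<in> tprod sO sO UNIV UNIV"
proof -
  interpret t: vector_space tscale by (rule vector_space_tscale)
  have "\<Delta>F (\<Sum>n | hcomp \<Omega> n x \<noteq> 0. hcomp \<Omega> n x) \<in> tprod sO sO UNIV UNIV"
    unfolding linear_map_sum[OF linear_comul_forms]
    by (intro t.subspace_sum subspace_tprod) (use comul_forms_part hcomp_dpart tensor_part_subset in blast)
  then show ?thesis unfolding hcomp_sum[symmetric] .
qed

lemma comul_forms_dcincl: "\<Delta>F (\<iota> a) = SW (\<lambda>a1 a2. otens \<Omega> \<Omega> (\<iota> a1) (\<iota> a2)) a"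
proof -
  have "\<Delta>F (\<iota> a) = tlift sH sH tscale (\<lambda>a1 a2. otens \<Omega> \<Omega> (\<iota> a1) (\<iota> a2)) (comul H a)"
    using morphism_comul unfolding dc_morphism_def by (simp add: tensor_dc_def tensor_incl_def)
  also have "\<dots> = SW (\<lambda>a1 a2. otens \<Omega> \<Omega> (\<iota> a1) (\<iota> a2)) a"
    by (rule tlift_comul) (intro lin)
  finally show ?thesis .
qed

lemma bilinear_tensor_dd: "bilinear_map sO sO tscale (\<lambda>\<omega> \<gamma>. otens \<Omega> \<Omega> (dd \<Omega> \<omega>) \<gamma> +
       hext \<Omega> (\<lambda>i \<omega>. tscale ((- 1) ^ i) (otens \<Omega> \<Omega> \<omega> (dd \<Omega> \<gamma>))) \<omega>)"
  by (intro lin)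

lemma comul_forms_dd: "\<Delta>F (dd \<Omega> (\<iota> a)) =
    SW (\<lambda>a1 a2. otens \<Omega> \<Omega> (dd \<Omega> (\<iota> a1)) (\<iota> a2) + otens \<Omega> \<Omega> (\<iota> a1) (dd \<Omega> (\<iota> a2))) a"
proof -
  note B = bilinear_tensor_dd
  have "\<Delta>F (dd \<Omega> (\<iota> a)) = tensor_dd \<Omega> \<Omega> (\<Delta>F (\<iota> a))"
    using morphism_comul unfolding dc_morphism_def by (simp add: tensor_dc_def)
  also have "\<dots> = SW (\<lambda>a1 a2. otens \<Omega> \<Omega> (dd \<Omega> (\<iota> a1)) (\<iota> a2) +
      hext \<Omega> (\<lambda>i \<omega>. tscale ((- 1) ^ i) (otens \<Omega> \<Omega> \<omega> (dd \<Omega> (\<iota> a2)))) (\<iota> a1)) a"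
    unfolding comul_forms_dcincl tensor_dd_def SW_linear[OF tlift(1)[OF B]] tlift(2)[OF B] ..
  also have "\<dots> = SW (\<lambda>a1 a2. otens \<Omega> \<Omega> (dd \<Omega> (\<iota> a1)) (\<iota> a2) + otens \<Omega> \<Omega> (\<iota> a1) (dd \<Omega> (\<iota> a2))) a"
  proof -
    have "hext \<Omega> (\<lambda>i \<omega>. tscale ((- 1) ^ i) (otens \<Omega> \<Omega> \<omega> (dd \<Omega> (\<iota> a2)))) (\<iota> a1) =
        otens \<Omega> \<Omega> (\<iota> a1) (dd \<Omega> (\<iota> a2))" for a1 a2
    proof -
      have z: "tscale ((- 1) ^ 0) (otens \<Omega> \<Omega> 0 (dd \<Omega> (\<iota> a2))) = 0"
        by (rule linear_map_zero[where s = sO and s' = tscale and f = "\<lambda>w. tscale ((- 1) ^ 0) (otens \<Omega> \<Omega> w (dd \<Omega> (\<iota> a2)))"])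
          (intro lin)
      have "hext \<Omega> (\<lambda>i \<omega>. tscale ((- 1) ^ i) (otens \<Omega> \<Omega> \<omega> (dd \<Omega> (\<iota> a2)))) (\<iota> a1) =
          tscale ((- 1) ^ 0) (otens \<Omega> \<Omega> (\<iota> a1) (dd \<Omega> (\<iota> a2)))"
        by (rule hext_homogeneous[OF dcincl_dpart, where f = "\<lambda>i \<omega>. tscale ((- 1) ^ i) (otens \<Omega> \<Omega> \<omega> (dd \<Omega> (\<iota> a2)))"]) (rule z)
      also have "\<dots> = otens \<Omega> \<Omega> (\<iota> a1) (dd \<Omega> (\<iota> a2))" by (simp add: tscale_def)
      finally show ?thesis .
    qed
    then show ?thesis by simp
  qed
  finally show ?thesis .
qed

lemma comul_forms_wedge: "\<Delta>F (x \<and>\<^sub>\<Omega> y) = wedge TD (\<Delta>F x) (\<Delta>F y)"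
  using morphism_comul unfolding dc_morphism_def by blast

text \<open>
  There is no sign because the inner factor has degree 0.
\<close>

lemma koszul_dcincl: "koszul x (\<iota> a) x' y' = otens \<Omega> \<Omega> (x \<and>\<^sub>\<Omega> x') (\<iota> a \<and>\<^sub>\<Omega> y')"
proof -
  let ?f = "\<lambda>j y. hext \<Omega> (\<lambda>k x'. tscale ((- 1) ^ (j * k)) (otens \<Omega> \<Omega> (x \<and>\<^sub>\<Omega> x') (y \<and>\<^sub>\<Omega> y'))) x'"
  have "linear_map sO tscale (?f 0)" by (intro lin)
  then have "koszul x (\<iota> a) x' y' = hext \<Omega> (\<lambda>k x'. tscale ((- 1) ^ (0 * k)) (otens \<Omega> \<Omega> (x \<and>\<^sub>\<Omega> x') (\<iota> a \<and>\<^sub>\<Omega> y'))) x'"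
    unfolding koszul_def by (intro hext_homogeneous[OF dcincl_dpart, where f = ?f] linear_map_zero)
  also have "\<dots> = hext \<Omega> (\<lambda>_ x'. otens \<Omega> \<Omega> (x \<and>\<^sub>\<Omega> x') (\<iota> a \<and>\<^sub>\<Omega> y')) x'"
    by (simp add: tscale_def)
  also have "\<dots> = otens \<Omega> \<Omega> (x \<and>\<^sub>\<Omega> x') (\<iota> a \<and>\<^sub>\<Omega> y')"
    by (rule hext_same[where s = tscale]) (intro lin)
  finally show ?thesis .
qed

end

context hopf_calculus
begin

text \<open>
  Since \<open>\<Omega>(\<Delta>)\<gamma>\<close> has the total degree of \<open>\<gamma>\<close>, its component with left degree 0 has the degree of \<open>\<gamma>\<close>
  on the right, so only the left factor has to be projected.
\<close>

lemma coact_eq: "coact H \<Omega> \<gamma> = olift \<Omega> \<Omega> tscale (\<lambda>x y. tens sH sO (proj0 x) y) (\<Delta>F \<gamma>)"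
proof (rule linear_eq_homogeneousI[where s = tscale and f = "coact H \<Omega>"])
  show "linear_map sO tscale (coact H \<Omega>)"
    unfolding coact_def dsw_def proj0_def[symmetric] by (intro lin)
  show "linear_map sO tscale (\<lambda>\<gamma>. olift \<Omega> \<Omega> tscale (\<lambda>x y. tens sH sO (proj0 x) y) (\<Delta>F \<gamma>))"
    by (intro lin)
  fix n \<gamma> assume \<gamma>: "\<gamma> \<in> dpart \<Omega> n"
  have bil: "bilinear_map sO sO tscale (\<lambda>x y. tens sH sO (proj0 x) y)"
    "bilinear_map sO sO tscale (\<lambda>x y. tens sH sO (proj0 x) (hcomp \<Omega> n y))"
    by (intro lin)+
  have "coact H \<Omega> \<gamma> = dsw H \<Omega> 0 n tscale (\<lambda>x y. tens sH sO (inv \<iota> x) y) \<gamma>"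
    unfolding coact_def
  proof (rule hext_homogeneous[OF \<gamma>])
    have "linear_map sO tscale (dsw H \<Omega> 0 n tscale (\<lambda>x y. tens sH sO (inv \<iota> x) y))"
      unfolding dsw_def proj0_def[symmetric] by (intro lin)
    then show "dsw H \<Omega> 0 n tscale (\<lambda>x y. tens sH sO (inv \<iota> x) y) 0 = 0"
      by (rule linear_map_zero)
  qed
  also have "\<dots> = olift \<Omega> \<Omega> tscale (\<lambda>x y. tens sH sO (proj0 x) (hcomp \<Omega> n y)) (\<Delta>F \<gamma>)"
    unfolding dsw_def proj0_def ..
  also have "\<dots> = olift \<Omega> \<Omega> tscale (\<lambda>x y. tens sH sO (proj0 x) y) (\<Delta>F \<gamma>)"
  proof (rule tensor_part_eqI[OF tlift(1)[OF bil(2)] tlift(1)[OF bil(1)] comul_forms_part[OF \<gamma>]])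
    fix i x y assume i: "i \<le> n" "x \<in> dpart \<Omega> (n - i)" "y \<in> dpart \<Omega> i"
    have z: "tens sH sO 0 y = 0" for y
      by (rule linear_map_zero[where s = sH and s' = tscale and f = "\<lambda>x. tens sH sO x y"]) (intro lin)
    show "olift \<Omega> \<Omega> tscale (\<lambda>x y. tens sH sO (proj0 x) (hcomp \<Omega> n y)) (otens \<Omega> \<Omega> x y) =
        olift \<Omega> \<Omega> tscale (\<lambda>x y. tens sH sO (proj0 x) y) (otens \<Omega> \<Omega> x y)"
      unfolding tlift(2)[OF bil(1)] tlift(2)[OF bil(2)]
      using i by (cases "i = n") (simp_all add: hcomp_homogeneous proj0_positive z)
  qed
  finally show "coact H \<Omega> \<gamma> = olift \<Omega> \<Omega> tscale (\<lambda>x y. tens sH sO (proj0 x) y) (\<Delta>F \<gamma>)" .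
qed

lemma linear_coact: "linear_map sO tscale (coact H \<Omega>)"
  unfolding coact_eq by (intro lin)

lemma coact_tprod: "coact H \<Omega> \<gamma> \<in> tprod sH sO UNIV UNIV"
proof -
  have "olift \<Omega> \<Omega> tscale (\<lambda>x y. tens sH sO (proj0 x) y) (\<Delta>F \<gamma>) =
      tsum sO sO (\<lambda>x y. tens sH sO (proj0 x) y) (\<Delta>F \<gamma>)"
    by (rule tlift_eq_tsum[OF _ comul_forms_tprod]) (intro lin)
  then show ?thesis unfolding coact_eq
    by (auto intro!: tsum_in_subspace[OF vector_space_tscale subspace_tprod] tens_in_tprod)
qed

text \<open>
  \<open>CSW f \<gamma>\<close> is \<open>f \<gamma>\<^bsub>-1\<^esub> \<gamma>\<^sub>0\<close>.
\<close>

definition CSW :: "('h \<Rightarrow> 'p \<Rightarrow> 'c::comm_monoid_add) \<Rightarrow> 'p \<Rightarrow> 'c" where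
  "CSW f \<gamma> = tsum sH sO f (coact H \<Omega> \<gamma>)"

lemma tlift_coact: "bilinear_map sH sO s f \<Longrightarrow> tlift sH sO s f (coact H \<Omega> \<gamma>) = CSW f \<gamma>"
  unfolding CSW_def by (rule tlift_eq_tsum[OF _ coact_tprod])

lemma csw_CSW: "bilinear_map sH sO s f \<Longrightarrow> csw H \<Omega> s f \<gamma> = CSW f \<gamma>"
  unfolding csw_def by (rule tlift_coact)

lemma coact_CSW: "coact H \<Omega> \<gamma> = CSW (tens sH sO) \<gamma>"
  unfolding CSW_def by (simp add: tsum_tens vector_space_sH vector_space_dscale coact_tprod)

lemma lin_CSW_family [lin]:
  "vector_space s \<Longrightarrow> vector_space s' \<Longrightarrow> (\<And>a b. linear_map s s' (\<lambda>x. F x a b)) \<Longrightarrow>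
    linear_map s s' (\<lambda>x. CSW (F x) \<gamma>)"
  unfolding CSW_def by (rule lin_tsum)

lemma linear_CSW: "bilinear_map sH sO s f \<Longrightarrow> linear_map sO s (CSW f)"
  using linear_map_comp[OF tlift(1) linear_coact] tlift_coact by force

lemma lin_CSW [lin]:
  "bilinear_map sH sO s' f \<Longrightarrow> linear_map s sO g \<Longrightarrow> linear_map s s' (\<lambda>x. CSW f (g x))"
  by (rule linear_map_comp[OF linear_CSW])

lemma CSW_linear: "linear_map s s' g \<Longrightarrow> g (CSW f \<gamma>) = CSW (\<lambda>a b. g (f a b)) \<gamma>"
  unfolding CSW_def by (rule tsum_linear)

lemma CSW_cong: "(\<And>a b. f a b = g a b) \<Longrightarrow> CSW f \<gamma> = CSW g \<gamma>"
  unfolding CSW_def by (rule tsum_cong)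

lemma CSW_SW_swap: "CSW (\<lambda>x y. SW (\<lambda>a b. F x y a b) h) \<gamma> = SW (\<lambda>a b. CSW (\<lambda>x y. F x y a b) \<gamma>) h"
  unfolding SW_def CSW_def by (rule tsum_swap)

lemma CSW_comul_forms:
  assumes f: "bilinear_map sH sO s f"
  shows "CSW f \<gamma> = tlift sO sO s (\<lambda>x y. f (proj0 x) y) (\<Delta>F \<gamma>)"
    and "CSW f \<gamma> = tsum sO sO (\<lambda>x y. f (proj0 x) y) (\<Delta>F \<gamma>)"
proof -
  note [lin] = bilinear_mapD[OF f]
  have 1: "olift \<Omega> \<Omega> tscale (\<lambda>x y. tens sH sO (proj0 x) y) (\<Delta>F \<gamma>) = tsum sO sO (\<lambda>x y. tens sH sO (proj0 x) y) (\<Delta>F \<gamma>)"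
    by (rule tlift_eq_tsum[OF _ comul_forms_tprod]) (intro lin)
  show 2: "CSW f \<gamma> = tsum sO sO (\<lambda>x y. f (proj0 x) y) (\<Delta>F \<gamma>)"
    unfolding tlift_coact[OF f, symmetric] coact_eq 1 tsum_linear[OF tlift(1)[OF f]] tlift(2)[OF f] ..
  show "CSW f \<gamma> = tlift sO sO s (\<lambda>x y. f (proj0 x) y) (\<Delta>F \<gamma>)"
    unfolding 2 by (rule tlift_eq_tsum[OF _ comul_forms_tprod, symmetric]) (intro lin)
qed

lemma CSW_dcincl:
  assumes f: "bilinear_map sH sO s f"
  shows "CSW f (\<iota> a) = SW (\<lambda>a1 a2. f a1 (\<iota> a2)) a"
proof -
  note [lin] = bilinear_mapD[OF f]
  have b: "bilinear_map sO sO s (\<lambda>x y. f (proj0 x) y)" by (intro lin)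
  show ?thesis
    unfolding CSW_comul_forms(1)[OF f] comul_forms_dcincl SW_linear[OF tlift(1)[OF b]] tlift(2)[OF b]
    by simp
qed

lemma CSW_unit: assumes f: "bilinear_map sH sO s f" shows "CSW f (dunit \<Omega>) = f 1 (dunit \<Omega>)"
proof -
  note [lin] = bilinear_mapD[OF f]
  have "SW (\<lambda>a1 a2. f a1 (\<iota> a2)) 1 = f 1 (\<iota> 1)"
    by (rule SW_one[where s = s]) (intro lin)
  then show ?thesis using CSW_dcincl[OF f, of 1] by (simp add: dcincl_one)
qed

lemma proj0_mult: "proj0 (\<iota> a \<and>\<^sub>\<Omega> x) = a * proj0 x"
proof (rule linear_eq_homogeneousI[where s = sH and f = "\<lambda>x. proj0 (\<iota> a \<and>\<^sub>\<Omega> x)"])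
  fix n x assume x: "x \<in> dpart \<Omega> n"
  show "proj0 (\<iota> a \<and>\<^sub>\<Omega> x) = a * proj0 x"
  proof (cases "n = 0")
    case True
    then obtain b where "x = \<iota> b" using x by (auto elim: dpart_0E)
    then show ?thesis by (simp add: dcincl_mult[symmetric])
  next
    case False
    then show ?thesis
      using proj0_positive[OF wedge_dpart[OF dcincl_dpart x]] proj0_positive[OF x] by simp
  qed
qed (intro lin)+

text \<open>
  The left factor of \<open>\<Omega>(\<Delta>)(a\<gamma>) = (a\<^sub>1 \<otimes> a\<^sub>2) \<and> \<Omega>(\<Delta>)\<gamma>\<close> is projected to degree 0, and this projection is
  multiplicative.
\<close>

lemma CSW_mult:
  assumes f: "bilinear_map sH sO s f"
  shows "CSW f (\<iota> a \<and>\<^sub>\<Omega> \<gamma>) = SW (\<lambda>a1 a2. CSW (\<lambda>h y. f (a1 * h) (\<iota> a2 \<and>\<^sub>\<Omega> y)) \<gamma>) a"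
proof -
  note [lin] = bilinear_mapD[OF f]
  have b: "bilinear_map sO sO s (\<lambda>x y. f (proj0 x) y)" by (intro lin)
  note W = wedge_TD_tens[OF comul_forms_tprod]
  have "\<Delta>F (\<iota> a \<and>\<^sub>\<Omega> \<gamma>) = SW (\<lambda>a1 a2. tsum sO sO (koszul (\<iota> a1) (\<iota> a2)) (\<Delta>F \<gamma>)) a"
    unfolding comul_forms_wedge comul_forms_dcincl SW_linear[OF W(2)] W(1) ..
  then have "CSW f (\<iota> a \<and>\<^sub>\<Omega> \<gamma>) =
      SW (\<lambda>a1 a2. tsum sO sO (\<lambda>x y. f (a1 * proj0 x) (\<iota> a2 \<and>\<^sub>\<Omega> y)) (\<Delta>F \<gamma>)) a"
    unfolding CSW_comul_forms(1)[OF f]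
    by (simp add: SW_linear[OF tlift(1)[OF b]] tsum_linear[OF tlift(1)[OF b]] koszul_dcincl
        tlift(2)[OF b] proj0_mult)
  also have "\<dots> = SW (\<lambda>a1 a2. CSW (\<lambda>h y. f (a1 * h) (\<iota> a2 \<and>\<^sub>\<Omega> y)) \<gamma>) a"
    by (intro SW_cong CSW_comul_forms(2)[where s = s, symmetric] lin)
  finally show ?thesis .
qed

text \<open>
  In \<open>\<Omega>(\<Delta>)(da \<and> \<gamma>) = (da\<^sub>1 \<otimes> a\<^sub>2 + a\<^sub>1 \<otimes> da\<^sub>2) \<and> \<Omega>(\<Delta>)\<gamma>\<close> the first summand has no component of degree 0
  in the left factor. In the second one, the Koszul sign depends on the degree of the left factor of
  \<open>\<Omega>(\<Delta>)\<gamma>\<close>, and it is \<open>1\<close> in the only degree that contributes.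
\<close>

lemma CSW_diff:
  assumes f: "bilinear_map sH sO s f"
  shows "CSW f (dd \<Omega> (\<iota> a) \<and>\<^sub>\<Omega> \<gamma>) = SW (\<lambda>a1 a2. CSW (\<lambda>h y. f (a1 * h) (dd \<Omega> (\<iota> a2) \<and>\<^sub>\<Omega> y)) \<gamma>) a"
proof -
  note [lin] = bilinear_mapD[OF f]
  let ?b = "\<lambda>x y. f (proj0 x) y"
  have b: "bilinear_map sO sO s ?b" by (intro lin)
  note L = tlift(1)[OF b]
  note W = wedge_TD_tens[OF comul_forms_tprod]
  have f0: "f 0 y = 0" for y
    by (rule linear_map_zero[where s = sH and s' = s and f = "\<lambda>x. f x y"]) (intro lin)
  have "\<Delta>F (dd \<Omega> (\<iota> a) \<and>\<^sub>\<Omega> \<gamma>) = SW (\<lambda>a1 a2. tsum sO sO (koszul (dd \<Omega> (\<iota> a1)) (\<iota> a2)) (\<Delta>F \<gamma>) +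
      tsum sO sO (koszul (\<iota> a1) (dd \<Omega> (\<iota> a2))) (\<Delta>F \<gamma>)) a"
    unfolding comul_forms_wedge comul_forms_dd SW_linear[OF W(2)] linear_map_add[OF W(2)] W(1) ..
  then have "CSW f (dd \<Omega> (\<iota> a) \<and>\<^sub>\<Omega> \<gamma>) =
      SW (\<lambda>a1 a2. tsum sO sO (\<lambda>x y. tlift sO sO s ?b (koszul (dd \<Omega> (\<iota> a1)) (\<iota> a2) x y)) (\<Delta>F \<gamma>) +
        tsum sO sO (\<lambda>x y. tlift sO sO s ?b (koszul (\<iota> a1) (dd \<Omega> (\<iota> a2)) x y)) (\<Delta>F \<gamma>)) a"
    unfolding CSW_comul_forms(1)[OF f]
    by (simp only: SW_linear[OF L] tsum_linear[OF L] linear_map_add[OF L])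
  moreover have "tsum sO sO (\<lambda>x y. tlift sO sO s ?b (koszul (dd \<Omega> (\<iota> a1)) (\<iota> a2) x y)) (\<Delta>F \<gamma>) = 0" for a1 a2
    unfolding koszul_dcincl tlift(2)[OF b] proj0_dd[OF dcincl_dpart] f0 by (simp add: tsum_def)
  moreover have "tlift sO sO s ?b (koszul (\<iota> a1) (dd \<Omega> (\<iota> a2)) x y) = f (a1 * proj0 x) (dd \<Omega> (\<iota> a2) \<and>\<^sub>\<Omega> y)"
    for a1 a2 x y
  proof (rule linear_eq_homogeneousI[where s = s and f = "\<lambda>x. tlift sO sO s ?b (koszul (\<iota> a1) (dd \<Omega> (\<iota> a2)) x y)"])
    show "linear_map sO s (\<lambda>x. tlift sO sO s ?b (koszul (\<iota> a1) (dd \<Omega> (\<iota> a2)) x y))"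
      by (intro lin)
    fix n x assume x: "x \<in> dpart \<Omega> n"
    let ?k = "\<lambda>j k z x'. tscale ((- 1) ^ (j * k)) (otens \<Omega> \<Omega> (\<iota> a1 \<and>\<^sub>\<Omega> x') (z \<and>\<^sub>\<Omega> y))"
    have 1: "linear_map sO tscale (\<lambda>z. hext \<Omega> (\<lambda>k x'. ?k 1 k z x') x)"
      and 2: "linear_map sO tscale (\<lambda>x'. ?k 1 n (dd \<Omega> (\<iota> a2)) x')" by (intro lin)+
    have "koszul (\<iota> a1) (dd \<Omega> (\<iota> a2)) x y = hext \<Omega> (\<lambda>k x'. ?k 1 k (dd \<Omega> (\<iota> a2)) x') x"
      unfolding koszul_def
      using hext_homogeneous[OF dd_dpart[OF dcincl_dpart], where f = "\<lambda>j z. hext \<Omega> (\<lambda>k x'. ?k j k z x') x"]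
        linear_map_zero[OF 1] by simp
    also have "\<dots> = ?k 1 n (dd \<Omega> (\<iota> a2)) x"
      using hext_homogeneous[OF x, where f = "\<lambda>k x'. ?k 1 k (dd \<Omega> (\<iota> a2)) x'"] linear_map_zero[OF 2] by simp
    finally have "tlift sO sO s ?b (koszul (\<iota> a1) (dd \<Omega> (\<iota> a2)) x y) =
        s ((- 1) ^ n) (f (a1 * proj0 x) (dd \<Omega> (\<iota> a2) \<and>\<^sub>\<Omega> y))"
      by (simp add: linear_map_scale[OF L] tlift(2)[OF b] proj0_mult)
    moreover have "s 1 v = v" for v
      using bilinear_map_vs(3)[OF f] by (simp add: vector_space_def)
    ultimately show "tlift sO sO s ?b (koszul (\<iota> a1) (dd \<Omega> (\<iota> a2)) x y) =
        f (a1 * proj0 x) (dd \<Omega> (\<iota> a2) \<and>\<^sub>\<Omega> y)"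
      using proj0_positive[OF x] linear_map_zero[OF linear_map_comp[OF lin_scale[OF lin_id[OF bilinear_map_vs(3)[OF f]]] lin_id[OF bilinear_map_vs(3)[OF f]]]]
      by (cases "n = 0") (simp_all add: f0)
  qed (intro lin)
  ultimately have "CSW f (dd \<Omega> (\<iota> a) \<and>\<^sub>\<Omega> \<gamma>) =
      SW (\<lambda>a1 a2. tsum sO sO (\<lambda>x y. f (a1 * proj0 x) (dd \<Omega> (\<iota> a2) \<and>\<^sub>\<Omega> y)) (\<Delta>F \<gamma>)) a"
    by simp
  also have "\<dots> = SW (\<lambda>a1 a2. CSW (\<lambda>h y. f (a1 * h) (dd \<Omega> (\<iota> a2) \<and>\<^sub>\<Omega> y)) \<gamma>) a"
    by (intro SW_cong CSW_comul_forms(2)[where s = s, symmetric] lin)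
  finally show ?thesis .
qed

end

section \<open>Forms as a Hopf module and its coinvariants\<close>

context hopf_calculus
begin

text \<open>
  The inductive step of coassociativity, for both ways of enlarging a form: \<open>D a\<close> is either \<open>a\<close> or \<open>da\<close>.
  Both sides are expanded with the rule for the coaction of \<open>D a \<and> \<gamma>\<close>; by the hypothesis on \<open>\<gamma>\<close> the
  results are the two sides of the coassociativity of \<open>\<Delta>\<close> at \<open>a\<close>.
\<close>

lemma CSW_coassoc_step:
  assumes D: "linear_map sH sO D"
    and law: "\<And>g a \<gamma>. bilinear_map sH sO s g \<Longrightarrow>
      CSW g (D a \<and>\<^sub>\<Omega> \<gamma>) = SW (\<lambda>a1 a2. CSW (\<lambda>h y. g (a1 * h) (D a2 \<and>\<^sub>\<Omega> y)) \<gamma>) a"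
    and IH: "\<And>g. trilinear_map sH sH sO s g \<Longrightarrow>
      CSW (\<lambda>x y. CSW (g x) y) \<gamma> = CSW (\<lambda>x z. SW (\<lambda>x1 x2. g x1 x2 z) x) \<gamma>"
    and f: "trilinear_map sH sH sO s f"
  shows "CSW (\<lambda>x y. CSW (f x) y) (D a \<and>\<^sub>\<Omega> \<gamma>) = CSW (\<lambda>x z. SW (\<lambda>x1 x2. f x1 x2 z) x) (D a \<and>\<^sub>\<Omega> \<gamma>)"
proof -
  note [lin] = linear_map_comp[OF D] trilinear_mapD[OF f] trilinear_map_vs(4)[OF f]
  have bil: "bilinear_map sH sO s (f x)" for x by (intro lin)
  let ?T = "\<lambda>a1 b1 b2. CSW (\<lambda>x z. SW (\<lambda>x1 x2. f (a1 * x1) (b1 * x2) (D b2 \<and>\<^sub>\<Omega> z)) x) \<gamma>"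
  have "CSW (\<lambda>x y. CSW (f x) y) (D a \<and>\<^sub>\<Omega> \<gamma>) =
      SW (\<lambda>a1 a2. CSW (\<lambda>x y. CSW (f (a1 * x)) (D a2 \<and>\<^sub>\<Omega> y)) \<gamma>) a"
    by (rule law) (intro lin)
  also have "\<dots> = SW (\<lambda>a1 a2. SW (\<lambda>b1 b2.
      CSW (\<lambda>x y. CSW (\<lambda>h z. f (a1 * x) (b1 * h) (D b2 \<and>\<^sub>\<Omega> z)) y) \<gamma>) a2) a"
    unfolding law[OF bil] CSW_SW_swap ..
  also have "\<dots> = SW (\<lambda>a1 a2. SW (\<lambda>b1 b2. ?T a1 b1 b2) a2) a"
    by (intro SW_cong IH lin)
  also have "\<dots> = SW (\<lambda>a1 a2. SW (\<lambda>c1 c2. ?T c1 c2 a2) a1) a"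
    by (rule SW_coassoc[symmetric, where s = s]) (intro lin)
  also have "\<dots> = SW (\<lambda>a1 a2. CSW (\<lambda>x z. SW (\<lambda>x1 x2. f x1 x2 (D a2 \<and>\<^sub>\<Omega> z)) (a1 * x)) \<gamma>) a"
  proof -
    have "SW (\<lambda>x1 x2. f x1 x2 w) (b * x) = SW (\<lambda>c1 c2. SW (\<lambda>x1 x2. f (c1 * x1) (c2 * x2) w) x) b" for w b x
      by (rule SW_mult[where s = s]) (intro lin)
    then show ?thesis by (simp add: CSW_SW_swap)
  qed
  also have "\<dots> = CSW (\<lambda>x z. SW (\<lambda>x1 x2. f x1 x2 z) x) (D a \<and>\<^sub>\<Omega> \<gamma>)"
    by (rule law[symmetric]) (intro lin)
  finally show ?thesis .
qed

text \<open>
  The statement is proved for all \<open>f\<close> simultaneously, since the inductive step changes \<open>f\<close>.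
\<close>

lemma CSW_coassoc:
  assumes "trilinear_map sH sH sO s f"
  shows "CSW (\<lambda>x y. CSW (f x) y) \<gamma> = CSW (\<lambda>x z. SW (\<lambda>x1 x2. f x1 x2 z) x) \<gamma>"
  using assms
proof (induction \<gamma> arbitrary: f rule: form_induct)
  case (add c x y)
  note [lin] = trilinear_mapD[OF add.prems] trilinear_map_vs(4)[OF add.prems]
  have "linear_map sO s (CSW (\<lambda>x y. CSW (f x) y))" "linear_map sO s (CSW (\<lambda>x z. SW (\<lambda>x1 x2. f x1 x2 z) x))"
    by (intro lin)+
  then show ?case
    using add.IH(1)[OF add.prems] add.IH(2)[OF add.prems] by (simp add: linear_mapD(3,4))
next
  case (incl a)
  note [lin] = trilinear_mapD[OF incl] trilinear_map_vs(4)[OF incl]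
  have 1: "CSW (f x) (\<iota> b) = SW (\<lambda>b1 b2. f x b1 (\<iota> b2)) b" for x b
    by (rule CSW_dcincl[where s = s]) (intro lin)
  have "CSW (\<lambda>x y. CSW (f x) y) (\<iota> a) = SW (\<lambda>a1 a2. CSW (f a1) (\<iota> a2)) a"
    by (rule CSW_dcincl[where s = s]) (intro lin)
  also have "\<dots> = SW (\<lambda>a1 a2. SW (\<lambda>b1 b2. f b1 b2 (\<iota> a2)) a1) a"
    unfolding 1 by (rule SW_coassoc[symmetric, where s = s]) (intro lin)
  also have "\<dots> = CSW (\<lambda>x z. SW (\<lambda>x1 x2. f x1 x2 z) x) (\<iota> a)"
    by (rule CSW_dcincl[where s = s, symmetric]) (intro lin)
  finally show ?case .
next
  case (mult a x)
  show ?case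
    by (rule CSW_coassoc_step[where D = \<iota> and s = s])
      (use CSW_mult mult linear_dcincl in auto)
next
  case (diff a x)
  show ?case
    by (rule CSW_coassoc_step[where D = "\<lambda>a. dd \<Omega> (\<iota> a)" and s = s])
      (use CSW_diff diff lin_dd[OF linear_dcincl] in auto)
qed

lemma CSW_counit:
  assumes f: "linear_map sO s f"
  shows "CSW (\<lambda>h y. s (counit H h) (f y)) \<gamma> = f \<gamma>"
proof -
  have bil: "bilinear_map sH sO sO (\<lambda>h y. sO (counit H h) y)" by (intro lin)
  have step: "CSW (\<lambda>h y. sO (counit H h) y) (D a \<and>\<^sub>\<Omega> \<gamma>) = D a \<and>\<^sub>\<Omega> \<gamma>"
    if law: "CSW (\<lambda>h y. sO (counit H h) y) (D a \<and>\<^sub>\<Omega> \<gamma>) =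
        SW (\<lambda>a1 a2. CSW (\<lambda>h y. sO (counit H (a1 * h)) (D a2 \<and>\<^sub>\<Omega> y)) \<gamma>) a"
      and D: "linear_map sH sO D"
      and IH: "CSW (\<lambda>h y. sO (counit H h) y) \<gamma> = \<gamma>" for D a \<gamma>
  proof -
    note [lin] = linear_map_comp[OF D]
    have "CSW (\<lambda>h y. sO (counit H (a1 * h)) (D a2 \<and>\<^sub>\<Omega> y)) \<gamma> = sO (counit H a1) (D a2 \<and>\<^sub>\<Omega> \<gamma>)" for a1 a2
    proof -
      have l: "linear_map sO sO (\<lambda>y. sO (counit H a1) (D a2 \<and>\<^sub>\<Omega> y))" by (intro lin)
      have "sO (counit H a1) (D a2 \<and>\<^sub>\<Omega> \<gamma>) = sO (counit H a1) (D a2 \<and>\<^sub>\<Omega> CSW (\<lambda>h y. sO (counit H h) y) \<gamma>)"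
        unfolding IH ..
      also have "\<dots> = CSW (\<lambda>h y. sO (counit H a1) (D a2 \<and>\<^sub>\<Omega> sO (counit H h) y)) \<gamma>"
        by (rule CSW_linear[OF l])
      also have "\<dots> = CSW (\<lambda>h y. sO (counit H (a1 * h)) (D a2 \<and>\<^sub>\<Omega> y)) \<gamma>"
        by (rule CSW_cong, subst linear_map_scale[OF l]) (simp add: counit_mult mult.commute)
      finally show ?thesis ..
    qed
    moreover have "SW (\<lambda>a1 a2. sO (counit H a1) (D a2 \<and>\<^sub>\<Omega> \<gamma>)) a = D a \<and>\<^sub>\<Omega> \<gamma>"
      by (rule SW_counit_left) (intro lin)
    ultimately show ?thesis unfolding law by simp
  qed
  have "CSW (\<lambda>h y. sO (counit H h) y) \<gamma> = \<gamma>"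
  proof (rule linear_eq_formI[where s' = sO and f = "CSW (\<lambda>h y. sO (counit H h) y)" and g = "\<lambda>y. y"])
    show "CSW (\<lambda>h y. sO (counit H h) y) (\<iota> a) = \<iota> a" for a
      unfolding CSW_dcincl[OF bil] by (rule SW_counit_left[OF linear_dcincl])
    show "CSW (\<lambda>h y. sO (counit H h) y) (\<iota> a \<and>\<^sub>\<Omega> x) = \<iota> a \<and>\<^sub>\<Omega> x"
      if "CSW (\<lambda>h y. sO (counit H h) y) x = x" for a x
      by (rule step[OF CSW_mult[OF bil] linear_dcincl that])
    show "CSW (\<lambda>h y. sO (counit H h) y) (dd \<Omega> (\<iota> a) \<and>\<^sub>\<Omega> x) = dd \<Omega> (\<iota> a) \<and>\<^sub>\<Omega> x"
      if "CSW (\<lambda>h y. sO (counit H h) y) x = x" for a x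
      by (rule step[of "\<lambda>a. dd \<Omega> (\<iota> a)", OF CSW_diff[OF bil] lin_dd[OF linear_dcincl] that])
  qed (intro lin)+
  then have "f (CSW (\<lambda>h y. sO (counit H h) y) \<gamma>) = f \<gamma>" by simp
  then show ?thesis unfolding CSW_linear[OF f] linear_map_scale[OF f] .
qed

text \<open>
  The coaction preserves the degree: the component of \<open>\<Omega>(\<Delta>)\<gamma>\<close> of degree 0 in the left factor has in
  the right factor the degree of \<open>\<gamma>\<close>.
\<close>

lemma CSW_homogeneous:
  assumes f: "bilinear_map sH sO s f" and \<gamma>: "\<gamma> \<in> dpart \<Omega> n"
  shows "CSW f \<gamma> = CSW (\<lambda>h y. f h (hcomp \<Omega> n y)) \<gamma>"
proof -
  note [lin] = bilinear_mapD[OF f]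
  have f0: "f 0 y = 0" for y
    by (rule linear_map_zero[where s = sH and s' = s and f = "\<lambda>x. f x y"]) (intro lin)
  have g: "bilinear_map sH sO s (\<lambda>h y. f h (hcomp \<Omega> n y))"
    and b: "bilinear_map sO sO s (\<lambda>x y. f (proj0 x) y)" "bilinear_map sO sO s (\<lambda>x y. f (proj0 x) (hcomp \<Omega> n y))"
    by (intro lin)+
  show ?thesis
    unfolding CSW_comul_forms(1)[OF f] CSW_comul_forms(1)[OF g]
  proof (rule tensor_part_eqI[OF tlift(1)[OF b(1)] tlift(1)[OF b(2)] comul_forms_part[OF \<gamma>]])
    fix i x y assume "i \<le> n" "x \<in> dpart \<Omega> (n - i)" "y \<in> dpart \<Omega> i"
    then show "tlift sO sO s (\<lambda>x y. f (proj0 x) y) (otens \<Omega> \<Omega> x y) =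
        tlift sO sO s (\<lambda>x y. f (proj0 x) (hcomp \<Omega> n y)) (otens \<Omega> \<Omega> x y)"
      unfolding tlift(2)[OF b(1)] tlift(2)[OF b(2)]
      by (cases "i = n") (simp_all add: hcomp_homogeneous proj0_positive f0)
  qed
qed

lemma CSW_in_subspace:
  assumes f: "bilinear_map sH sO s f" and \<gamma>: "\<gamma> \<in> dpart \<Omega> n"
    and V: "module.subspace s V" "\<And>h y. y \<in> dpart \<Omega> n \<Longrightarrow> f h y \<in> V"
  shows "CSW f \<gamma> \<in> V"
  unfolding CSW_homogeneous[OF f \<gamma>] unfolding CSW_def
  by (rule tsum_in_subspace[OF bilinear_map_vs(3)[OF f] V(1)]) (intro V(2) hcomp_dpart)

text \<open>
  \<open>\<gamma> \<mapsto> S(\<gamma>\<^bsub>-1\<^esub>)\<gamma>\<^sub>0\<close>, the projection of a Hopf module onto its coinvariants.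
\<close>

definition coinv_proj :: "'p \<Rightarrow> 'p" where
  "coinv_proj \<gamma> = CSW (\<lambda>h y. \<iota> (antipode H h) \<and>\<^sub>\<Omega> y) \<gamma>"

lemma linear_coinv_proj: "linear_map sO sO coinv_proj"
  unfolding coinv_proj_def by (intro lin)

lemmas lin_coinv_proj [lin] = linear_map_comp[OF linear_coinv_proj]

lemma coinv_proj_dpart: "\<gamma> \<in> dpart \<Omega> n \<Longrightarrow> coinv_proj \<gamma> \<in> dpart \<Omega> n"
  unfolding coinv_proj_def
proof (rule CSW_in_subspace[where s = sO])
  show "\<iota> (antipode H h) \<and>\<^sub>\<Omega> y \<in> dpart \<Omega> n" if "y \<in> dpart \<Omega> n" for h y
    using wedge_dpart[OF dcincl_dpart that] by simp
qed (intro lin subspace_dpart | assumption)+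

lemma mult_coinv_proj: "CSW (\<lambda>h y. \<iota> h \<and>\<^sub>\<Omega> coinv_proj y) \<gamma> = \<gamma>"
proof -
  have l: "linear_map sO sO (\<lambda>w. \<iota> h \<and>\<^sub>\<Omega> w)" for h by (intro lin)
  have "CSW (\<lambda>h y. \<iota> h \<and>\<^sub>\<Omega> coinv_proj y) \<gamma> =
      CSW (\<lambda>h y. CSW (\<lambda>k z. \<iota> (h * antipode H k) \<and>\<^sub>\<Omega> z) y) \<gamma>"
    unfolding coinv_proj_def CSW_linear[OF l] dcincl_mult wedge_assoc ..
  also have "\<dots> = CSW (\<lambda>h z. SW (\<lambda>h1 h2. \<iota> (h1 * antipode H h2) \<and>\<^sub>\<Omega> z) h) \<gamma>"
    by (rule CSW_coassoc[where s = sO]) (intro lin)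
  also have "\<dots> = CSW (\<lambda>h z. sO (counit H h) z) \<gamma>"
  proof (rule CSW_cong)
    fix h z
    have l: "linear_map sH sO (\<lambda>k. \<iota> k \<and>\<^sub>\<Omega> z)" by (intro lin)
    show "SW (\<lambda>h1 h2. \<iota> (h1 * antipode H h2) \<and>\<^sub>\<Omega> z) h = sO (counit H h) z"
      unfolding SW_linear[OF l, symmetric] SW_antipode_right linear_map_scale[OF l]
      by (simp add: dcincl_one)
  qed
  also have "\<dots> = \<gamma>" by (rule CSW_counit) (intro lin)
  finally show ?thesis .
qed

text \<open>
  Write \<open>P\<close> for \<open>coinv_proj\<close> and \<open>\<delta>\<close> for the coaction. From \<open>\<gamma> = \<gamma>\<^bsub>-1\<^esub>P(\<gamma>\<^sub>0)\<close> and coassociativity one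
  gets \<open>\<delta>(\<gamma>) = \<Delta>(\<gamma>\<^bsub>-1\<^esub>)(1 \<otimes> P(\<gamma>\<^sub>0))\<close>. Inserting this into \<open>\<delta>(P\<gamma>) = \<Delta>(S\<gamma>\<^bsub>-1\<^esub>)\<delta>(\<gamma>\<^sub>0)\<close> yields
  \<open>\<Delta>(S(\<gamma>\<^bsub>-2\<^esub>)\<gamma>\<^bsub>-1\<^esub>)(1 \<otimes> P(\<gamma>\<^sub>0)) = 1 \<otimes> P\<gamma>\<close>.
\<close>

lemma coact_coinv_proj: "coact H \<Omega> (coinv_proj \<gamma>) = tens sH sO 1 (coinv_proj \<gamma>)"
proof -
  define G where "G z a b = tens sH sO a (\<iota> b \<and>\<^sub>\<Omega> coinv_proj z)" for z a b
  have G1 [lin]: "linear_map s sH g \<Longrightarrow> linear_map s tscale (\<lambda>x. G z (g x) b)"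
    and G2 [lin]: "linear_map s sH g \<Longrightarrow> linear_map s tscale (\<lambda>x. G z a (g x))"
    and G3 [lin]: "linear_map s sO k \<Longrightarrow> linear_map s tscale (\<lambda>x. G (k x) a b)" for s g z a b k
    unfolding G_def by (intro lin; assumption)+
  \<comment> \<open>\<open>\<delta>(y) = \<Delta>(y\<^bsub>-1\<^esub>)(1 \<otimes> P(y\<^sub>0))\<close>, multiplied from the left by \<open>s1 \<otimes> s2\<close>\<close>
  have coact_form: "CSW (\<lambda>k z. tens sH sO (s1 * k) (\<iota> s2 \<and>\<^sub>\<Omega> z)) y =
      CSW (\<lambda>k z. SW (\<lambda>k1 k2. G z (s1 * k1) (s2 * k2)) k) y" for s1 s2 y
  proof -
    let ?f = "\<lambda>k z. tens sH sO (s1 * k) (\<iota> s2 \<and>\<^sub>\<Omega> z)"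
    have l: "linear_map sO tscale (?f k)" for k by (intro lin)
    have "CSW ?f y = CSW (\<lambda>k z. ?f k (CSW (\<lambda>u w. \<iota> u \<and>\<^sub>\<Omega> coinv_proj w) z)) y"
      unfolding mult_coinv_proj ..
    also have "\<dots> = CSW (\<lambda>k z. CSW (\<lambda>u w. G w (s1 * k) (s2 * u)) z) y"
      unfolding CSW_linear[OF l] G_def dcincl_mult wedge_assoc ..
    also have "\<dots> = CSW (\<lambda>k z. SW (\<lambda>k1 k2. G z (s1 * k1) (s2 * k2)) k) y"
      by (rule CSW_coassoc[where s = tscale]) (intro lin)
    finally show ?thesis .
  qed
  have bt: "bilinear_map sH sO tscale (tens sH sO)" by (intro lin)
  have bG: "bilinear_map sH sH tscale (G z)" for z by (intro lin)
  have "coact H \<Omega> (coinv_proj \<gamma>) = CSW (\<lambda>h y. coact H \<Omega> (\<iota> (antipode H h) \<and>\<^sub>\<Omega> y)) \<gamma>"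
    unfolding coinv_proj_def by (rule CSW_linear[OF linear_coact])
  also have "\<dots> = CSW (\<lambda>h y. SW (\<lambda>s1 s2. CSW (\<lambda>k z. tens sH sO (s1 * k) (\<iota> s2 \<and>\<^sub>\<Omega> z)) y) (antipode H h)) \<gamma>"
    unfolding coact_CSW CSW_mult[OF bt] ..
  also have "\<dots> = CSW (\<lambda>h y. CSW (\<lambda>k z. SW (G z) (antipode H h * k)) y) \<gamma>"
    unfolding coact_form SW_mult[OF bG] CSW_SW_swap ..
  also have "\<dots> = CSW (\<lambda>h z. SW (\<lambda>h1 h2. SW (G z) (antipode H h1 * h2)) h) \<gamma>"
    by (rule CSW_coassoc[where s = tscale]) (intro lin)
  also have "\<dots> = CSW (\<lambda>h z. tscale (counit H h) (tens sH sO 1 (coinv_proj z))) \<gamma>"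
  proof (rule CSW_cong)
    fix h z
    have l: "linear_map sH tscale (SW (G z))" by (intro lin)
    show "SW (\<lambda>h1 h2. SW (G z) (antipode H h1 * h2)) h = tscale (counit H h) (tens sH sO 1 (coinv_proj z))"
      unfolding SW_linear[OF l, symmetric] SW_antipode_left linear_map_scale[OF l] SW_one[OF bG]
      by (simp add: G_def dcincl_one)
  qed
  also have "\<dots> = tens sH sO 1 (coinv_proj \<gamma>)"
    by (rule CSW_counit) (intro lin)
  finally show ?thesis .
qed

lemma coinv_proj_coinv: "\<gamma> \<in> dpart \<Omega> n \<Longrightarrow> coinv_proj \<gamma> \<in> coinv H \<Omega> n"
  unfolding coinv_def by (simp add: coinv_proj_dpart coact_coinv_proj)

lemma CSW_mult_coinv:
  assumes f: "bilinear_map sH sO s f" and \<gamma>: "\<gamma> \<in> coinv H \<Omega> n"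
  shows "CSW f (\<iota> a \<and>\<^sub>\<Omega> \<gamma>) = SW (\<lambda>a1 a2. f a1 (\<iota> a2 \<and>\<^sub>\<Omega> \<gamma>)) a"
proof -
  note [lin] = bilinear_mapD[OF f]
  have "CSW (\<lambda>h y. f (a1 * h) (\<iota> a2 \<and>\<^sub>\<Omega> y)) \<gamma> = f a1 (\<iota> a2 \<and>\<^sub>\<Omega> \<gamma>)" for a1 a2
  proof -
    have b: "bilinear_map sH sO s (\<lambda>h y. f (a1 * h) (\<iota> a2 \<and>\<^sub>\<Omega> y))" by (intro lin)
    show ?thesis
      using \<gamma> unfolding tlift_coact[OF b, symmetric] coinv_def by (simp add: tlift(2)[OF b])
  qed
  then show ?thesis unfolding CSW_mult[OF f] by simp
qed

text \<open>
  For a coinvariant \<open>\<gamma>\<close> the map \<open>\<gamma>' \<mapsto> \<gamma>'\<^bsub>-2\<^esub> \<otimes> S(\<gamma>'\<^bsub>-1\<^esub>)\<gamma>'\<^sub>0\<close> sends \<open>a\<gamma>\<close> to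
  \<open>a\<^sub>1 \<otimes> S(a\<^sub>2)a\<^sub>3\<gamma> = a \<otimes> \<gamma>\<close>.
\<close>

lemma CSW_coinv_proj_mult:
  assumes f: "bilinear_map sH sO s f" and \<gamma>: "\<gamma> \<in> coinv H \<Omega> n"
  shows "CSW (\<lambda>h y. f h (coinv_proj y)) (\<iota> a \<and>\<^sub>\<Omega> \<gamma>) = f a \<gamma>"
proof -
  note [lin] = bilinear_mapD[OF f]
  have b: "bilinear_map sH sO s (\<lambda>h y. f h (coinv_proj y))"
    "bilinear_map sH sO sO (\<lambda>h y. \<iota> (antipode H h) \<and>\<^sub>\<Omega> y)" by (intro lin)+
  have "coinv_proj (\<iota> a \<and>\<^sub>\<Omega> \<gamma>) = sO (counit H a) \<gamma>" for a
  proof -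
    have l: "linear_map sH sO (\<lambda>k. \<iota> k \<and>\<^sub>\<Omega> \<gamma>)" by (intro lin)
    have "coinv_proj (\<iota> a \<and>\<^sub>\<Omega> \<gamma>) = SW (\<lambda>a1 a2. \<iota> (antipode H a1 * a2) \<and>\<^sub>\<Omega> \<gamma>) a"
      unfolding coinv_proj_def CSW_mult_coinv[OF b(2) \<gamma>] dcincl_mult wedge_assoc ..
    also have "\<dots> = sO (counit H a) \<gamma>"
      unfolding SW_linear[OF l, symmetric] SW_antipode_left linear_map_scale[OF l]
      by (simp add: dcincl_one)
    finally show ?thesis .
  qed
  moreover have "f h (sO c \<gamma>) = s c (f h \<gamma>)" for h c
    using linear_map_scale[OF bilinear_mapD(2)[OF f lin_id[OF vector_space_dscale]]] .
  ultimately have "CSW (\<lambda>h y. f h (coinv_proj y)) (\<iota> a \<and>\<^sub>\<Omega> \<gamma>) = SW (\<lambda>a1 a2. s (counit H a2) (f a1 \<gamma>)) a"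
    unfolding CSW_mult_coinv[OF b(1) \<gamma>] by simp
  also have "\<dots> = f a \<gamma>" by (rule SW_counit_right) (intro lin)
  finally show ?thesis .
qed

end

section \<open>The crossed product calculus\<close>

locale crossed_calculus = hopf_calculus H \<Omega> + B: calculus \<Omega>B "bscale B"
  for H :: "('k::field, 'h::{ring,monoid_mult}) hopf" and \<Omega> :: "('k, 'h, 'p::ab_group_add) dcalc"
    and B :: "('k, 'h, 'b::{ring,monoid_mult}) twisted_alg" and \<Omega>B :: "('k, 'b, 'o::ab_group_add) dcalc" +
  fixes act :: "'h \<Rightarrow> 'o \<Rightarrow> 'o"
  assumes twisted_algebra: "is_twisted_module_algebra H B"
    and twisted_dc: "is_twisted_module_dc H B \<Omega>B act"
begin

abbreviation "sB \<equiv> bscale B"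
abbreviation "sOB \<equiv> dscale \<Omega>B"
abbreviation "\<iota>B \<equiv> dcincl \<Omega>B"
abbreviation base_forms_wedge (infixr "\<and>\<^sub>B" 70) where "x \<and>\<^sub>B y \<equiv> wedge \<Omega>B x y"
abbreviation "CD \<equiv> crossed_dc H B \<Omega>B act \<Omega>"

lemma is_algebra_B: "is_algebra sB"
  using twisted_algebra unfolding is_twisted_module_algebra_def by blast

lemma bilinear_mult_B: "bilinear_map sB sB sB (*)"
proof -
  have "sB c (x * y) = sB c x * y" "sB c (x * y) = x * sB c y" for c x y
    using is_algebra_B unfolding is_algebra_def by blast+
  then show ?thesis
    unfolding bilinear_map_def linear_map_iff
    by (simp add: B.vector_space_s distrib_left distrib_right)
qed

lemma bilinear_act: "bilinear_map sH sOB sOB act"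
  using twisted_dc unfolding is_twisted_module_dc_def by blast

lemma bilinear_meas: "bilinear_map sH sB sB (meas B)"
  and bilinear_cocyc: "bilinear_map sH sH sB (cocyc B)"
  and meas_one: "meas B 1 b = b"
  and cocyc_one: "cocyc B 1 h = sB (counit H h) 1"
  using twisted_algebra unfolding is_twisted_module_algebra_def by blast+

lemmas lin_mult_B [lin] = bilinear_mapD[OF bilinear_mult_B]
  and lin_act [lin] = bilinear_mapD[OF bilinear_act]
  and lin_meas [lin] = bilinear_mapD[OF bilinear_meas]
  and lin_cocyc [lin] = bilinear_mapD[OF bilinear_cocyc]

lemma linear_sw_wedge_list: "linear_map sH sOB (\<lambda>h. sw_wedge_list H \<Omega>B act h xs)"
proof (induction xs rule: induct_list012)
  case (3 x y zs)
  note [lin] = linear_map_comp[OF "3.IH"(2)]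
  have "sw H sOB (\<lambda>h1 h2. act h1 x \<and>\<^sub>B sw_wedge_list H \<Omega>B act h2 (y # zs)) h =
      SW (\<lambda>h1 h2. act h1 x \<and>\<^sub>B sw_wedge_list H \<Omega>B act h2 (y # zs)) h" for h
    by (intro sw_SW lin)
  then show ?case by (simp del: sw_wedge_list.simps(2) add: sw_wedge_list.simps(3)) (intro lin)
qed (simp_all, (intro lin)+)

lemma sw_wedge_list_one: "(\<And>x. x \<in> set xs \<Longrightarrow> act 1 x = x) \<Longrightarrow> sw_wedge_list H \<Omega>B act 1 xs = wedge_list \<Omega>B xs"
proof (induction xs rule: induct_list012)
  case 1
  then show ?case by (simp add: counit_one)
next
  case (2 x)
  then show ?case by simp
next
  case (3 x y zs)
  note [lin] = linear_map_comp[OF linear_sw_wedge_list]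
  have b: "bilinear_map sH sH sOB (\<lambda>h1 h2. act h1 x \<and>\<^sub>B sw_wedge_list H \<Omega>B act h2 (y # zs))"
    by (intro lin)
  show ?case using 3 by (simp add: sw_SW[OF b] SW_one[OF b])
qed

text \<open>
  Both \<open>1 \<cdot> b = b\<close> and \<open>1 \<cdot> db = db\<close> hold, and \<open>1\<close> is grouplike, so it acts as the identity on products
  of such factors.
\<close>

lemma act_one: "act 1 \<omega> = \<omega>"
proof (rule B.linear_eq_homogeneousI[where s = sOB and f = "act 1"])
  fix n \<omega> assume "\<omega> \<in> dpart \<Omega>B n"
  then show "act 1 \<omega> = \<omega>"
    unfolding B.dpart_span
  proof (rule linear_eq_on_span[where s' = sOB and f = "act 1" and g = "\<lambda>x. x", rotated 2])
    fix y assume "y \<in> {wedge_list \<Omega>B (form_factors \<Omega>B a0 as) | a0 as. length as = n}"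
    then obtain a0 as where y: "y = wedge_list \<Omega>B (form_factors \<Omega>B a0 as)" by blast
    have "act 1 (\<iota>B b) = \<iota>B b" "act 1 (dd \<Omega>B (\<iota>B b)) = dd \<Omega>B (\<iota>B b)" for b
      using twisted_dc unfolding is_twisted_module_dc_def by (simp_all add: meas_one)
    then have "sw_wedge_list H \<Omega>B act 1 (form_factors \<Omega>B a0 as) = y"
      unfolding y by (intro sw_wedge_list_one) (auto simp: form_factors_def)
    moreover have "act 1 y = sw_wedge_list H \<Omega>B act 1 (form_factors \<Omega>B a0 as)"
      using twisted_dc unfolding is_twisted_module_dc_def y by blast
    ultimately show "act 1 y = y" by simp
  qed (intro lin)+
qed (intro lin)+

text \<open>
  The product \<open>(\<omega> \<otimes> \<gamma>) \<and> (\<omega>' \<otimes> \<gamma>')\<close> of the crossed product calculus, as a map that is linear in each of the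
  four forms.
\<close>

definition crossed_wedge :: "'o \<Rightarrow> 'p \<Rightarrow> 'o \<Rightarrow> 'p \<Rightarrow> ('k, 'o, 'p) tensor" where
  "crossed_wedge \<omega> \<gamma> \<omega>' \<gamma>' = hext \<Omega> (\<lambda>j \<gamma>. hext \<Omega>B (\<lambda>k \<omega>'. tscale ((- 1) ^ (j * k))
     (CSW (\<lambda>h1 x. CSW (\<lambda>h2 \<gamma>0. CSW (\<lambda>h2' \<gamma>0'.
        otens \<Omega>B \<Omega> ((\<omega> \<and>\<^sub>B act h1 \<omega>') \<and>\<^sub>B \<iota>B (cocyc B h2 h2')) (\<gamma>0 \<and>\<^sub>\<Omega> \<gamma>0')) \<gamma>') x) \<gamma>)) \<omega>') \<gamma>"

lemma wedge_CD: "wedge CD u u' =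
    olift \<Omega>B \<Omega> tscale (\<lambda>\<omega> \<gamma>. olift \<Omega>B \<Omega> tscale (\<lambda>\<omega>' \<gamma>'. crossed_wedge \<omega> \<gamma> \<omega>' \<gamma>') u') u"
proof -
  let ?t = "\<lambda>\<omega> \<omega>' h1 h2 \<gamma>0 h2' \<gamma>0'.
    otens \<Omega>B \<Omega> ((\<omega> \<and>\<^sub>B act h1 \<omega>') \<and>\<^sub>B \<iota>B (cocyc B h2 h2')) (\<gamma>0 \<and>\<^sub>\<Omega> \<gamma>0')"
  have 1: "csw H \<Omega> tscale (?t \<omega> \<omega>' h1 h2 \<gamma>0) \<gamma>' = CSW (?t \<omega> \<omega>' h1 h2 \<gamma>0) \<gamma>'" for \<omega> \<omega>' h1 h2 \<gamma>0 \<gamma>'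
    by (intro csw_CSW lin)
  have 2: "csw H \<Omega> tscale (\<lambda>h2 \<gamma>0. CSW (?t \<omega> \<omega>' h1 h2 \<gamma>0) \<gamma>') x =
      CSW (\<lambda>h2 \<gamma>0. CSW (?t \<omega> \<omega>' h1 h2 \<gamma>0) \<gamma>') x" for \<omega> \<omega>' h1 x \<gamma>'
    by (intro csw_CSW lin)
  have 3: "csw H \<Omega> tscale (\<lambda>h1 x. CSW (\<lambda>h2 \<gamma>0. CSW (?t \<omega> \<omega>' h1 h2 \<gamma>0) \<gamma>') x) \<gamma> =
      CSW (\<lambda>h1 x. CSW (\<lambda>h2 \<gamma>0. CSW (?t \<omega> \<omega>' h1 h2 \<gamma>0) \<gamma>') x) \<gamma>" for \<omega> \<omega>' \<gamma> \<gamma>'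
    by (intro csw_CSW lin)
  show ?thesis
    unfolding crossed_dc_def crossed_wedge_def csw3_def 1 2 3 by simp
qed

lemma bilinear_crossed_wedge:
  "bilinear_map sOB sO tscale (crossed_wedge \<omega> \<gamma>)"
  "bilinear_map sOB sO tscale (\<lambda>\<omega> \<gamma>. crossed_wedge \<omega> \<gamma> \<omega>' \<gamma>')"
  unfolding crossed_wedge_def by (intro lin)+

lemmas lin_crossed_wedge [lin] =
  bilinear_mapD[OF bilinear_crossed_wedge(1)] bilinear_mapD[OF bilinear_crossed_wedge(2)]

lemma crossed_wedge_base: "crossed_wedge \<omega> (dunit \<Omega>) \<omega>' \<gamma>' = otens \<Omega>B \<Omega> (\<omega> \<and>\<^sub>B \<omega>') \<gamma>'"
proof -
  let ?t = "\<lambda>\<omega>' h1 h2 \<gamma>0 h2' \<gamma>0'.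
    otens \<Omega>B \<Omega> ((\<omega> \<and>\<^sub>B act h1 \<omega>') \<and>\<^sub>B \<iota>B (cocyc B h2 h2')) (\<gamma>0 \<and>\<^sub>\<Omega> \<gamma>0')"
  let ?f = "\<lambda>j \<gamma>. hext \<Omega>B (\<lambda>k \<omega>'. tscale ((- 1) ^ (j * k))
     (CSW (\<lambda>h1 x. CSW (\<lambda>h2 \<gamma>0. CSW (?t \<omega>' h1 h2 \<gamma>0) \<gamma>') x) \<gamma>)) \<omega>'"
  have l: "linear_map sO tscale (?f 0)" by (intro lin)
  have inner: "CSW (\<lambda>h1 x. CSW (\<lambda>h2 \<gamma>0. CSW (?t \<omega>' h1 h2 \<gamma>0) \<gamma>') x) (dunit \<Omega>) =
      otens \<Omega>B \<Omega> (\<omega> \<and>\<^sub>B \<omega>') \<gamma>'" for \<omega>'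
  proof -
    have b1: "bilinear_map sH sO tscale (\<lambda>h1 x. CSW (\<lambda>h2 \<gamma>0. CSW (?t \<omega>' h1 h2 \<gamma>0) \<gamma>') x)"
      and b2: "bilinear_map sH sO tscale (\<lambda>h2 \<gamma>0. CSW (?t \<omega>' 1 h2 \<gamma>0) \<gamma>')" by (intro lin)+
    have l: "linear_map sB tscale (\<lambda>b. otens \<Omega>B \<Omega> ((\<omega> \<and>\<^sub>B \<omega>') \<and>\<^sub>B \<iota>B b) y)" for y by (intro lin)
    have t: "?t \<omega>' 1 1 (dunit \<Omega>) h y = tscale (counit H h) (otens \<Omega>B \<Omega> (\<omega> \<and>\<^sub>B \<omega>') y)" for h y
      by (simp add: act_one cocyc_one linear_map_scale[OF l] B.dcincl_one)
    have "CSW (\<lambda>h1 x. CSW (\<lambda>h2 \<gamma>0. CSW (?t \<omega>' h1 h2 \<gamma>0) \<gamma>') x) (dunit \<Omega>) =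
        CSW (\<lambda>h y. tscale (counit H h) (otens \<Omega>B \<Omega> (\<omega> \<and>\<^sub>B \<omega>') y)) \<gamma>'"
      unfolding CSW_unit[OF b1] CSW_unit[OF b2] t ..
    also have "\<dots> = otens \<Omega>B \<Omega> (\<omega> \<and>\<^sub>B \<omega>') \<gamma>'" by (rule CSW_counit) (intro lin)
    finally show ?thesis .
  qed
  have "crossed_wedge \<omega> (dunit \<Omega>) \<omega>' \<gamma>' = ?f 0 (dunit \<Omega>)"
    unfolding crossed_wedge_def
    by (rule hext_homogeneous[OF dunit_dpart, where f = ?f]) (rule linear_map_zero[OF l])
  also have "\<dots> = hext \<Omega>B (\<lambda>_ \<omega>'. otens \<Omega>B \<Omega> (\<omega> \<and>\<^sub>B \<omega>') \<gamma>') \<omega>'"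
    unfolding inner by (simp add: tscale_def)
  also have "\<dots> = otens \<Omega>B \<Omega> (\<omega> \<and>\<^sub>B \<omega>') \<gamma>'" by (rule B.hext_same[where s = tscale]) (intro lin)
  finally show ?thesis .
qed

lemma wedge_CD_base:
  assumes "u' \<in> tprod sOB sO UNIV UNIV"
  shows "wedge CD (otens \<Omega>B \<Omega> \<omega> (dunit \<Omega>)) u' =
    olift \<Omega>B \<Omega> tscale (\<lambda>\<omega>' \<gamma>'. otens \<Omega>B \<Omega> (\<omega> \<and>\<^sub>B \<omega>') \<gamma>') u'"
proof -
  have *: "olift \<Omega>B \<Omega> tscale (crossed_wedge \<omega> \<gamma>) u' = tsum sOB sO (crossed_wedge \<omega> \<gamma>) u'" for \<omega> \<gamma>
    by (rule tlift_eq_tsum[OF bilinear_crossed_wedge(1) assms])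
  have "bilinear_map sOB sO tscale (\<lambda>\<omega> \<gamma>. olift \<Omega>B \<Omega> tscale (crossed_wedge \<omega> \<gamma>) u')"
    unfolding * by (intro lin)
  moreover have "crossed_wedge \<omega> (dunit \<Omega>) = (\<lambda>\<omega>' \<gamma>'. otens \<Omega>B \<Omega> (\<omega> \<and>\<^sub>B \<omega>') \<gamma>')"
    by (intro ext crossed_wedge_base)
  ultimately show ?thesis unfolding wedge_CD using tlift(2) by fastforce
qed

text \<open>
  Step \<open>n\<close> of the filtration of \<open>\<Omega>\<^bsup>m+n\<^esup>(B #\<^sub>\<sigma> H)\<close> by the degree along \<open>H\<close>.
\<close>

definition filtration :: "nat \<Rightarrow> nat \<Rightarrow> ('k, 'o, 'p) tensor set" where
  "filtration m n = tspan (\<Union>i\<le>n. tprod sOB sO (dpart \<Omega>B (m + n - i)) (dpart \<Omega> i))"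

lemma otens_filtration:
  "i \<le> n \<Longrightarrow> \<omega> \<in> dpart \<Omega>B (m + n - i) \<Longrightarrow> \<gamma> \<in> dpart \<Omega> i \<Longrightarrow> otens \<Omega>B \<Omega> \<omega> \<gamma> \<in> filtration m n"
proof -
  interpret t: vector_space tscale by (rule vector_space_tscale)
  assume "i \<le> n" "\<omega> \<in> dpart \<Omega>B (m + n - i)" "\<gamma> \<in> dpart \<Omega> i"
  then show ?thesis unfolding filtration_def by (intro t.span_base) (auto intro!: tens_in_tprod)
qed

text \<open>
  Left multiplication by \<open>\<omega> \<otimes> 1\<close> only affects the factor in \<open>\<Omega>(B)\<close>, and \<open>\<Omega>\<^sup>m(B) \<and> \<Omega>\<^bsup>n-i\<^esup>(B)\<close> spans
  \<open>\<Omega>\<^bsup>m+n-i\<^esup>(B)\<close>.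
\<close>

lemma base_wedge_eq: "base_wedge H B \<Omega>B act \<Omega> m n = filtration m n"
proof -
  interpret t: vector_space tscale by (rule vector_space_tscale)
  let ?G = "{wedge CD (otens \<Omega>B \<Omega> \<omega> (dunit \<Omega>)) x | \<omega> x. \<omega> \<in> dpart \<Omega>B m \<and> x \<in> dpart CD n}"
  have part: "dpart CD n = tensor_part \<Omega>B \<Omega> n" by (simp add: crossed_dc_def)
  have wedge_gen: "wedge CD (otens \<Omega>B \<Omega> \<omega> (dunit \<Omega>)) (otens \<Omega>B \<Omega> \<omega>' \<gamma>) = otens \<Omega>B \<Omega> (\<omega> \<and>\<^sub>B \<omega>') \<gamma>"
    for \<omega> \<omega>' \<gamma>
    unfolding wedge_CD_base[OF tens_in_tprod[OF UNIV_I UNIV_I]] by (rule tlift(2)) (intro lin)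
  have sub: "t.subspace (filtration m n)" unfolding filtration_def by simp
  have "?G \<subseteq> filtration m n"
  proof safe
    fix \<omega> x assume \<omega>: "\<omega> \<in> dpart \<Omega>B m" and x: "x \<in> dpart CD n"
    let ?L = "olift \<Omega>B \<Omega> tscale (\<lambda>\<omega>' \<gamma>'. otens \<Omega>B \<Omega> (\<omega> \<and>\<^sub>B \<omega>') \<gamma>')"
    have b: "bilinear_map sOB sO tscale (\<lambda>\<omega>' \<gamma>'. otens \<Omega>B \<Omega> (\<omega> \<and>\<^sub>B \<omega>') \<gamma>')" by (intro lin)
    note L = tlift[OF b]
    have x': "x \<in> tensor_part \<Omega>B \<Omega> n" using x part by simp
    have "?L x \<in> filtration m n"
    proof (rule linear_image_span[OF L(1) x'[unfolded tensor_part_def] sub])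
      fix y assume "y \<in> (\<Union>i\<le>n. tprod sOB sO (dpart \<Omega>B (n - i)) (dpart \<Omega> i))"
      then obtain i where i: "i \<le> n" and y: "y \<in> tprod sOB sO (dpart \<Omega>B (n - i)) (dpart \<Omega> i)" by auto
      show "?L y \<in> filtration m n"
      proof (rule tprod_image[OF L(1) sub y])
        fix a c assume "a \<in> dpart \<Omega>B (n - i)" "c \<in> dpart \<Omega> i"
        then show "?L (otens \<Omega>B \<Omega> a c) \<in> filtration m n"
          unfolding L(2) using i B.wedge_dpart[OF \<omega>, of a "n - i"] by (intro otens_filtration[of i]) auto
      qed
    qed
    then show "wedge CD (otens \<Omega>B \<Omega> \<omega> (dunit \<Omega>)) x \<in> filtration m n"
      unfolding wedge_CD_base[OF subsetD[OF tensor_part_subset x']] .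
  qed
  moreover have "(\<Union>i\<le>n. tprod sOB sO (dpart \<Omega>B (m + n - i)) (dpart \<Omega> i)) \<subseteq> tspan ?G"
  proof safe
    fix i t assume i: "i \<le> n" and t: "t \<in> tprod sOB sO (dpart \<Omega>B (m + n - i)) (dpart \<Omega> i)"
    show "t \<in> tspan ?G"
    proof (rule tprod_image[where f = "\<lambda>t. t", OF lin_id[OF vector_space_tscale] t.subspace_span t])
      fix w \<gamma> assume w: "w \<in> dpart \<Omega>B (m + n - i)" and \<gamma>: "\<gamma> \<in> dpart \<Omega> i"
      have l: "linear_map sOB tscale (\<lambda>w. otens \<Omega>B \<Omega> w \<gamma>)" by (intro lin)
      have "w \<in> B.span {x \<and>\<^sub>B y | x y. x \<in> dpart \<Omega>B m \<and> y \<in> dpart \<Omega>B (n - i)}"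
        using w i B.dpart_add_span[of m "n - i"] by auto
      then show "otens \<Omega>B \<Omega> w \<gamma> \<in> tspan ?G"
      proof (rule linear_image_span[OF l _ t.subspace_span])
        fix z assume "z \<in> {x \<and>\<^sub>B y | x y. x \<in> dpart \<Omega>B m \<and> y \<in> dpart \<Omega>B (n - i)}"
        then obtain x y where xy: "x \<in> dpart \<Omega>B m" "y \<in> dpart \<Omega>B (n - i)" "z = x \<and>\<^sub>B y" by auto
        have "otens \<Omega>B \<Omega> y \<gamma> \<in> dpart CD n"
          unfolding part tensor_part_def using i xy \<gamma> by (intro t.span_base) (auto intro!: tens_in_tprod)
        then have "wedge CD (otens \<Omega>B \<Omega> x (dunit \<Omega>)) (otens \<Omega>B \<Omega> y \<gamma>) \<in> tspan ?G"
          using xy(1) by (intro t.span_base) blast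
        then show "otens \<Omega>B \<Omega> z \<gamma> \<in> tspan ?G"
          unfolding wedge_gen xy(3) .
      qed
    qed
  qed
  ultimately have "tspan ?G = filtration m n"
    unfolding filtration_def by (intro equalityI t.span_minimal) auto
  then show ?thesis unfolding base_wedge_def .
qed

end

section \<open>The vertical map and the short exact sequence\<close>

lemma btens_add_left:
  "x \<in> mcar M \<Longrightarrow> x' \<in> mcar M \<Longrightarrow> y \<in> mcar N \<Longrightarrow> btens M N (x + x') y = btens M N x y + btens M N x' y"
  and btens_add_right:
  "x \<in> mcar M \<Longrightarrow> y \<in> mcar N \<Longrightarrow> y' \<in> mcar N \<Longrightarrow> btens M N x (y + y') = btens M N x y + btens M N x y'"
  and btens_scale_left:
  "x \<in> mcar M \<Longrightarrow> y \<in> mcar N \<Longrightarrow> btens M N (mscale M c x) y = tscale c (btens M N x y)"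
  and btens_scale_right:
  "x \<in> mcar M \<Longrightarrow> y \<in> mcar N \<Longrightarrow> btens M N x (mscale N c y) = tscale c (btens M N x y)"
  and btens_balanced:
  "x \<in> mcar M \<Longrightarrow> y \<in> mcar N \<Longrightarrow> btens M N (mact M r x) y = btens M N x (mact N r y)"
  by (auto simp: btens_def tscale_def fun_eq_iff balanced_form_def)

context crossed_calculus
begin

text \<open>
  The vertical map on pure tensors \<open>\<omega> \<otimes> \<gamma>\<close>, with the summation over the components of \<open>\<Omega>(\<Delta>)\<gamma>\<close> made
  explicit.
\<close>

definition ver_form :: "nat \<Rightarrow> 'o \<Rightarrow> 'p \<Rightarrow> ('k, ('k, 'o, 'p) tensor, 'p) tensor" where
  "ver_form n \<omega> \<gamma> = hext \<Omega> (\<lambda>j \<gamma>. if j < n then 0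
     else tsum sO sO (\<lambda>x y. tens tscale sO (otens \<Omega>B \<Omega> \<omega> (hcomp \<Omega> (j - n) x)) (coinv_proj (hcomp \<Omega> n y))) (\<Delta>F \<gamma>)) \<gamma>"

lemma tlift_comul_forms: "bilinear_map sO sO s f \<Longrightarrow> tlift sO sO s f (\<Delta>F \<gamma>) = tsum sO sO f (\<Delta>F \<gamma>)"
  by (rule tlift_eq_tsum[OF _ comul_forms_tprod])

lemma lin_tsum_comul_forms [lin]:
  assumes f: "bilinear_map sO sO s' f" and g: "linear_map s sO g"
  shows "linear_map s s' (\<lambda>x. tsum sO sO f (\<Delta>F (g x)))"
proof -
  have "linear_map s s' (\<lambda>x. tlift sO sO s' f (\<Delta>F (g x)))"
    by (intro lin f g)
  then show ?thesis unfolding tlift_comul_forms[OF f] .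
qed

lemma bilinear_ver_form: "bilinear_map sOB sO tscale (ver_form n)"
  unfolding ver_form_def by (intro lin)

lemma ver_eq: "ver H \<Omega>B \<Omega> n = olift \<Omega>B \<Omega> tscale (ver_form n)"
proof -
  have 1: "csw H \<Omega> sO (\<lambda>h \<gamma>0. \<iota> (antipode H h) \<and>\<^sub>\<Omega> \<gamma>0) \<gamma> = coinv_proj \<gamma>" for \<gamma>
    unfolding coinv_proj_def by (intro csw_CSW lin)
  have 2: "dsw H \<Omega> (j - n) n tscale (\<lambda>\<gamma>1 \<gamma>2. tens tscale sO (otens \<Omega>B \<Omega> \<omega> \<gamma>1) (coinv_proj \<gamma>2)) \<gamma> =
      tsum sO sO (\<lambda>x y. tens tscale sO (otens \<Omega>B \<Omega> \<omega> (hcomp \<Omega> (j - n) x)) (coinv_proj (hcomp \<Omega> n y))) (\<Delta>F \<gamma>)"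
    for j \<omega> \<gamma> unfolding dsw_def by (intro tlift_comul_forms lin)
  have "(\<lambda>\<omega> \<gamma>. hext \<Omega> (\<lambda>j \<gamma>. if j < n then 0 else dsw H \<Omega> (j - n) n tscale (\<lambda>\<gamma>1 \<gamma>2.
      tens tscale sO (otens \<Omega>B \<Omega> \<omega> \<gamma>1) (coinv_proj \<gamma>2)) \<gamma>) \<gamma>) = ver_form n"
    unfolding 2 ver_form_def by (intro ext refl)
  then show ?thesis unfolding ver_def 1 by simp
qed

lemma linear_ver: "linear_map tscale tscale (ver H \<Omega>B \<Omega> n)"
  unfolding ver_eq by (rule tlift(1)[OF bilinear_ver_form])

lemma ver_otens_low:
  assumes "\<gamma> \<in> dpart \<Omega> j" "j < n"
  shows "ver H \<Omega>B \<Omega> n (otens \<Omega>B \<Omega> \<omega> \<gamma>) = 0"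
  unfolding ver_eq tlift(2)[OF bilinear_ver_form] ver_form_def
  using assms by (subst hext_homogeneous[of \<gamma> j]) auto

text \<open>
  For \<open>\<gamma>\<close> of degree \<open>n\<close> the left factor of \<open>\<Omega>(\<Delta>)\<gamma>\<close> is taken in degree 0, so only the coaction enters.
\<close>

lemma ver_otens_top:
  assumes \<gamma>: "\<gamma> \<in> dpart \<Omega> n"
  shows "ver H \<Omega>B \<Omega> n (otens \<Omega>B \<Omega> \<omega> \<gamma>) =
    CSW (\<lambda>h y. tens tscale sO (otens \<Omega>B \<Omega> \<omega> (\<iota> h)) (coinv_proj y)) \<gamma>"
proof -
  let ?f = "\<lambda>j \<gamma>. if j < n then 0
     else tsum sO sO (\<lambda>x y. tens tscale sO (otens \<Omega>B \<Omega> \<omega> (hcomp \<Omega> (j - n) x)) (coinv_proj (hcomp \<Omega> n y))) (\<Delta>F \<gamma>)"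
  have l: "linear_map sO tscale (?f n)" by (intro lin)
  have b: "bilinear_map sH sO tscale (\<lambda>h y. tens tscale sO (otens \<Omega>B \<Omega> \<omega> (\<iota> h)) (coinv_proj y))"
    "bilinear_map sH sO tscale (\<lambda>h y. tens tscale sO (otens \<Omega>B \<Omega> \<omega> (\<iota> h)) (coinv_proj (hcomp \<Omega> n y)))"
    by (intro lin)+
  have "ver H \<Omega>B \<Omega> n (otens \<Omega>B \<Omega> \<omega> \<gamma>) = ?f n \<gamma>"
    unfolding ver_eq tlift(2)[OF bilinear_ver_form] ver_form_def
    by (rule hext_homogeneous[OF \<gamma>, where f = ?f]) (rule linear_map_zero[OF l])
  also have "\<dots> = CSW (\<lambda>h y. tens tscale sO (otens \<Omega>B \<Omega> \<omega> (\<iota> h)) (coinv_proj (hcomp \<Omega> n y))) \<gamma>"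
    unfolding CSW_comul_forms(2)[OF b(2)] dcincl_proj0 by simp
  also have "\<dots> = CSW (\<lambda>h y. tens tscale sO (otens \<Omega>B \<Omega> \<omega> (\<iota> h)) (coinv_proj y)) \<gamma>"
    by (rule CSW_homogeneous[OF b(1) \<gamma>, symmetric])
  finally show ?thesis .
qed

text \<open>
  As \<open>1\<close> is grouplike, \<open>1 \<cdot> b = b\<close> and \<open>\<sigma>(1 \<otimes> h) = \<epsilon>(h)\<close>, neither the measure nor the cocycle is seen by the
  left \<open>B\<close>-action.
\<close>

lemma cp_mult_base:
  assumes u: "u \<in> tprod sB sH UNIV UNIV"
  shows "cp_mult H B (tens sB sH r 1) u = tlift sB sH tscale (\<lambda>b h. tens sB sH (r * b) h) u"
proof -
  let ?Z = "\<lambda>b h b' h'. SW (\<lambda>h1 x. SW (\<lambda>h2 h3. SW (\<lambda>h1' h2'.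
    tens sB sH (b * meas B h1 b' * cocyc B h2 h1') (h3 * h2')) h') x) h"
  let ?t = "\<lambda>b b' h1 h2 h3 h1' h2'. tens sB sH (b * meas B h1 b' * cocyc B h2 h1') (h3 * h2')"
  have 1: "sw H tscale (\<lambda>h1' h2'. ?t b b' h1 h2 h3 h1' h2') h' = SW (\<lambda>h1' h2'. ?t b b' h1 h2 h3 h1' h2') h'"
    for b b' h1 h2 h3 h' by (intro sw_SW lin)
  have 2: "sw H tscale (\<lambda>h2 h3. SW (\<lambda>h1' h2'. ?t b b' h1 h2 h3 h1' h2') h') x =
      SW (\<lambda>h2 h3. SW (\<lambda>h1' h2'. ?t b b' h1 h2 h3 h1' h2') h') x" for b b' h1 x h'
    by (intro sw_SW lin)
  have 3: "sw H tscale (\<lambda>h1 x. SW (\<lambda>h2 h3. SW (\<lambda>h1' h2'. ?t b b' h1 h2 h3 h1' h2') h') x) h = ?Z b h b' h'" for b b' h h'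
    by (intro sw_SW lin)
  have "bilinear_map sB sH tscale (?Z b h)" for b h by (intro lin)
  then have 4: "tlift sB sH tscale (?Z b h) u = tsum sB sH (?Z b h) u" for b h
    using tlift_eq_tsum u by blast
  have 5: "bilinear_map sB sH tscale (\<lambda>b h. tlift sB sH tscale (?Z b h) u)"
    unfolding 4 by (intro lin)
  have 6: "?Z r 1 = (\<lambda>b h. tens sB sH (r * b) h)"
  proof (rule ext, rule ext)
    fix b h
    have b1: "bilinear_map sH sH tscale (\<lambda>h1 x. SW (\<lambda>h2 h3. SW (\<lambda>h1' h2'. ?t r b h1 h2 h3 h1' h2') h) x)"
      and b2: "bilinear_map sH sH tscale (\<lambda>h2 h3. SW (\<lambda>h1' h2'. ?t r b 1 h2 h3 h1' h2') h)" by (intro lin)+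
    have l: "linear_map sB tscale (\<lambda>x. tens sB sH (r * b * x) y)" for y by (intro lin)
    have t: "?t r b 1 1 1 h1' h2' = tscale (counit H h1') (tens sB sH (r * b) h2')" for h1' h2'
      by (simp add: meas_one cocyc_one linear_map_scale[OF l])
    have "?Z r 1 b h = SW (\<lambda>h1' h2'. tscale (counit H h1') (tens sB sH (r * b) h2')) h"
      unfolding SW_one[OF b1] SW_one[OF b2] t ..
    also have "\<dots> = tens sB sH (r * b) h" by (rule SW_counit_left) (intro lin)
    finally show "?Z r 1 b h = tens sB sH (r * b) h" .
  qed
  have "cp_mult H B (tens sB sH r 1) u = tlift sB sH tscale (?Z r 1) u"
    unfolding cp_mult_def sw3_def 1 2 3 by (rule tlift(2)[OF 5])
  then show ?thesis unfolding 6 .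
qed

abbreviation "MB \<equiv> forms_right_module \<Omega>B"
abbreviation "NB \<equiv> crossed_left_module H B"

lemma module_simps [simp]:
  "mscale (MB m) = sOB" "mcar (MB m) = dpart \<Omega>B m" "mact (MB m) b \<omega> = \<omega> \<and>\<^sub>B \<iota>B b"
  "mscale NB = tscale" "mcar NB = tprod sB sH UNIV UNIV"
  "mact NB b u = cp_mult H B (tens sB sH b 1) u"
  unfolding forms_right_module_def crossed_left_module_def by simp_all

lemma tens_in_NB: "tens sB sH b h \<in> tprod sB sH UNIV UNIV"
  by (simp add: tens_in_tprod)

lemma btens_move: "\<omega> \<in> dpart \<Omega>B m \<Longrightarrow> btens (MB m) NB \<omega> (tens sB sH b h) = btens (MB m) NB (\<omega> \<and>\<^sub>B \<iota>B b) (tens sB sH 1 h)"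
proof -
  assume \<omega>: "\<omega> \<in> dpart \<Omega>B m"
  have "bilinear_map sB sH tscale (\<lambda>b' h. tens sB sH (b * b') h)" by (intro lin)
  then have "cp_mult H B (tens sB sH b 1) (tens sB sH 1 h) = tens sB sH b h"
    using tlift(2) unfolding cp_mult_base[OF tens_in_NB] by fastforce
  then show ?thesis
    using btens_balanced[of \<omega> "MB m" "tens sB sH 1 h" NB b] \<omega> tens_in_NB by simp
qed

text \<open>
  The defining condition of \<open>target_ident\<close> can be met: on \<open>\<Omega>(B) \<otimes> \<Omega>(H)\<close> one projects the first factor
  to degree \<open>m\<close> and the second to degree 0, which makes the prescribed map bilinear everywhere.
\<close>

lemma target_ident:
  shows "linear_map tscale tscale (target_ident H B \<Omega>B \<Omega> m)"
    and "\<omega> \<in> dpart \<Omega>B m \<Longrightarrow>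
      target_ident H B \<Omega>B \<Omega> m (tens tscale sO (otens \<Omega>B \<Omega> \<omega> (\<iota> h)) \<gamma>) =
      tens tscale sO (btens (MB m) NB \<omega> (tens sB sH 1 h)) \<gamma>"
proof -
  let ?a = "\<lambda>\<omega> x. btens (MB m) NB (hcomp \<Omega>B m \<omega>) (tens sB sH 1 (proj0 x))"
  have tl: "linear_map sO tscale (\<lambda>x. tens sB sH 1 (proj0 x))" by (intro lin)
  have a: "bilinear_map sOB sO tscale ?a"
  proof (rule bilinear_mapI)
    show "linear_map sOB tscale (\<lambda>\<omega>. ?a \<omega> x)" for x
      unfolding linear_map_iff
      using btens_add_left[of _ "MB m" _ _ NB] btens_scale_left[of _ "MB m" _ NB]
      by (simp add: linear_mapD[OF B.linear_hcomp] vector_space_tscale B.hcomp_dpart tens_in_NB)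
    show "linear_map sO tscale (?a \<omega>)" for \<omega>
      unfolding linear_map_iff
      using btens_add_right[of _ "MB m" _ NB] btens_scale_right[of _ "MB m" _ NB]
      by (simp add: linear_mapD[OF tl] vector_space_dscale vector_space_tscale B.hcomp_dpart tens_in_NB)
  qed
  let ?\<alpha> = "olift \<Omega>B \<Omega> tscale ?a"
  note [lin] = linear_map_comp[OF tlift(1)[OF a]]
  have b: "bilinear_map tscale sO tscale (\<lambda>t \<gamma>. tens tscale sO (?\<alpha> t) \<gamma>)" by (intro lin)
  have "\<exists>g. linear_map tscale tscale g \<and> (\<forall>\<omega>\<in>dpart \<Omega>B m. \<forall>h \<gamma>.
      g (tens tscale sO (otens \<Omega>B \<Omega> \<omega> (\<iota> h)) \<gamma>) =
      tens tscale sO (btens (MB m) NB \<omega> (tens sB sH 1 h)) \<gamma>)"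
    by (intro exI[of _ "tlift tscale sO tscale (\<lambda>t \<gamma>. tens tscale sO (?\<alpha> t) \<gamma>)"] conjI tlift(1)[OF b])
      (simp add: tlift(2)[OF b] tlift(2)[OF a] B.hcomp_homogeneous)
  from someI_ex[OF this, folded target_ident_def]
  show "linear_map tscale tscale (target_ident H B \<Omega>B \<Omega> m)"
    and "\<omega> \<in> dpart \<Omega>B m \<Longrightarrow>
      target_ident H B \<Omega>B \<Omega> m (tens tscale sO (otens \<Omega>B \<Omega> \<omega> (\<iota> h)) \<gamma>) =
      tens tscale sO (btens (MB m) NB \<omega> (tens sB sH 1 h)) \<gamma>"
    by blast+
qed

text \<open>
  The inverse \<open>\<omega> \<otimes>\<^sub>B (b \<otimes> h) \<mapsto> \<omega>b \<otimes> h\<close> of the identification of \<open>\<Omega>\<^sup>m(B) \<otimes> H\<close> with \<open>\<Omega>\<^sup>m(B) \<otimes>\<^sub>B (B #\<^sub>\<sigma> H)\<close>.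
  It is balanced by associativity, because \<open>B\<close> acts on \<open>B #\<^sub>\<sigma> H\<close> through the factor \<open>B\<close>.
\<close>

lemma balanced_retraction:
  obtains \<beta> where "linear_map tscale tscale \<beta>"
    "\<And>\<omega> h. \<omega> \<in> dpart \<Omega>B m \<Longrightarrow> \<beta> (btens (MB m) NB \<omega> (tens sB sH 1 h)) = otens \<Omega>B \<Omega> \<omega> (\<iota> h)"
proof -
  let ?q = "\<lambda>\<omega> b h. otens \<Omega>B \<Omega> (\<omega> \<and>\<^sub>B \<iota>B b) (\<iota> h)"
  let ?f = "\<lambda>\<omega> u. tlift sB sH tscale (?q \<omega>) u"
  have q: "bilinear_map sB sH tscale (?q \<omega>)" for \<omega> by (intro lin)
  note f = tlift[OF q]
  have f_tsum: "?f \<omega> u = tsum sB sH (?q \<omega>) u" if "u \<in> tprod sB sH UNIV UNIV" for \<omega> u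
    by (rule tlift_eq_tsum[OF q that])
  have f_left: "linear_map sOB tscale (\<lambda>\<omega>. tsum sB sH (?q \<omega>) u)" for u by (intro lin)
  have bal: "?f (\<omega> \<and>\<^sub>B \<iota>B r) u = ?f \<omega> (cp_mult H B (tens sB sH r 1) u)"
    if u: "u \<in> tprod sB sH UNIV UNIV" for \<omega> r u
  proof -
    have c: "bilinear_map sB sH tscale (\<lambda>b h. tens sB sH (r * b) h)" by (intro lin)
    have "?f (\<omega> \<and>\<^sub>B \<iota>B r) u = ?f \<omega> (tlift sB sH tscale (\<lambda>b h. tens sB sH (r * b) h) u)"
      by (rule tensor_maps_eqI[OF f(1) linear_map_comp[OF f(1) tlift(1)[OF c]] _ u])
        (unfold f(2) tlift(2)[OF c], simp only: B.dcincl_mult B.wedge_assoc)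
    then show ?thesis unfolding cp_mult_base[OF u] .
  qed
  have bal': "?f \<omega> (cp_mult H B (tens sB sH r 1) u) = tsum sB sH (?q (\<omega> \<and>\<^sub>B \<iota>B r)) u"
    if "u \<in> tprod sB sH UNIV UNIV" for \<omega> r u
    using bal[OF that] f_tsum[OF that] by simp
  note simps = f_tsum linear_mapD(3,4)[OF f_left] linear_mapD(3,4)[OF f(1)] bal'
  have "linear_map tscale tscale (blift (MB m) NB tscale ?f)"
    by (rule blift(1)[OF vector_space_tscale]; simp add: simps)
  moreover have "blift (MB m) NB tscale ?f (btens (MB m) NB \<omega> u) = ?f \<omega> u"
    if "\<omega> \<in> mcar (MB m)" "u \<in> mcar NB" for \<omega> u
    by (rule blift(2)[OF vector_space_tscale _ _ _ _ _ that]; simp add: simps)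
  moreover have "?f \<omega> (tens sB sH 1 h) = otens \<Omega>B \<Omega> \<omega> (\<iota> h)" for \<omega> h
    by (simp add: f(2) B.dcincl_one)
  ultimately show thesis using that tens_in_NB by simp
qed

text \<open>
  The multiplication \<open>\<omega> \<otimes> h \<otimes> \<gamma> \<mapsto> \<omega> \<otimes> h\<gamma>\<close>, which undoes the vertical map on the top summand.
\<close>

lemma mult_map:
  obtains \<mu> where "linear_map tscale tscale \<mu>"
    "\<And>\<omega> x \<gamma>. \<mu> (tens tscale sO (otens \<Omega>B \<Omega> \<omega> x) \<gamma>) = otens \<Omega>B \<Omega> \<omega> (x \<and>\<^sub>\<Omega> \<gamma>)"
proof -
  obtain p where p: "linear_map tscale tscale p" "\<And>t. p t \<in> tprod sOB sO UNIV UNIV"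
    "\<And>t. t \<in> tprod sOB sO UNIV UNIV \<Longrightarrow> p t = t"
    using linear_projection[OF vector_space_tscale subspace_tprod, of sOB sO UNIV UNIV] by blast
  note [lin] = linear_map_comp[OF p(1)]
  have q: "bilinear_map sOB sO tscale (\<lambda>\<omega> x. otens \<Omega>B \<Omega> \<omega> (x \<and>\<^sub>\<Omega> \<gamma>))" for \<gamma> by (intro lin)
  let ?g = "\<lambda>t \<gamma>. olift \<Omega>B \<Omega> tscale (\<lambda>\<omega> x. otens \<Omega>B \<Omega> \<omega> (x \<and>\<^sub>\<Omega> \<gamma>)) (p t)"
  have "linear_map sO tscale (?g t)" for t
    unfolding tlift_eq_tsum[OF q p(2)] by (intro lin)
  then have g: "bilinear_map tscale sO tscale ?g" by (intro bilinear_mapI) (intro lin)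
  show thesis
    by (rule that[OF tlift(1)[OF g]]) (simp add: tlift(2)[OF g] p(3) tens_in_tprod tlift(2)[OF q])
qed

text \<open>
  The larger space is the sum of the smaller one and the top summand \<open>\<Omega>\<^sup>m(B) \<otimes> \<Omega>\<^sup>n(H)\<close>. The vertical
  map vanishes on the former and maps the latter bijectively onto the target.
\<close>

theorem crossed_exact_sequence:
  assumes n: "n > 0"
  shows "short_exact tscale tscale tscale
           (base_wedge H B \<Omega>B act \<Omega> (m + 1) (n - 1)) (base_wedge H B \<Omega>B act \<Omega> m n)
           (ver_target H B \<Omega>B \<Omega> m n)
           (\<lambda>x. x) (\<lambda>x. target_ident H B \<Omega>B \<Omega> m (ver H \<Omega>B \<Omega> n x))"
proof -
  interpret t: vector_space tscale by (rule vector_space_tscale)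
  let ?X = "filtration (m + 1) (n - 1)" and ?Y = "filtration m n" and ?Z = "ver_target H B \<Omega>B \<Omega> m n"
  let ?p = "\<lambda>x. target_ident H B \<Omega>B \<Omega> m (ver H \<Omega>B \<Omega> n x)"
  let ?T = "tprod sOB sO (dpart \<Omega>B m) (dpart \<Omega> n)"
  let ?tp = "\<lambda>\<omega> h \<gamma>. tens tscale sO (btens (MB m) NB \<omega> (tens sB sH 1 h)) \<gamma>"
  have p: "linear_map tscale tscale ?p"
    by (rule linear_map_comp[OF target_ident(1) linear_ver])
  interpret p: Vector_Spaces.linear tscale tscale ?p by (rule p)
  have sub: "t.subspace (filtration m n)" for m n unfolding filtration_def by simp
  have subZ: "t.subspace ?Z" unfolding ver_target_def by (rule subspace_tprod)
  have split: "(\<Union>i\<le>n. tprod sOB sO (dpart \<Omega>B (m + n - i)) (dpart \<Omega> i)) =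
      (\<Union>i\<le>n - 1. tprod sOB sO (dpart \<Omega>B (m + 1 + (n - 1) - i)) (dpart \<Omega> i)) \<union> ?T"
  proof -
    have "{..n} = insert n {..n - 1}" using n by auto
    then show ?thesis using n by auto
  qed
  have Y_split: "\<exists>x z. x \<in> ?X \<and> z \<in> ?T \<and> y = x + z" if "y \<in> ?Y" for y
  proof -
    have "t.span ?T = ?T" by (rule t.span_eq_iff[THEN iffD2, OF subspace_tprod])
    then show ?thesis
      using that unfolding filtration_def split t.span_Un \<open>t.span ?T = ?T\<close> by blast
  qed
  have XY: "?X \<subseteq> ?Y"
    unfolding filtration_def split by (intro t.span_mono) blast
  have TY: "?T \<subseteq> ?Y"
    unfolding filtration_def split by (intro order_trans[OF _ t.span_superset]) blast
  have pX: "?p x = 0" if "x \<in> ?X" for x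
    using that unfolding filtration_def
  proof (rule linear_eq_on_span[OF p lin_zero[OF vector_space_tscale vector_space_tscale]])
    fix y assume "y \<in> (\<Union>i\<le>n - 1. tprod sOB sO (dpart \<Omega>B (m + 1 + (n - 1) - i)) (dpart \<Omega> i))"
    then obtain i where i: "i \<le> n - 1" and y: "y \<in> tprod sOB sO (dpart \<Omega>B (m + 1 + (n - 1) - i)) (dpart \<Omega> i)"
      by auto
    show "?p y = 0"
    proof (rule tensor_maps_eqI[OF p lin_zero[OF vector_space_tscale vector_space_tscale] _ y])
      fix \<omega> \<gamma> assume "\<gamma> \<in> dpart \<Omega> i"
      then show "?p (otens \<Omega>B \<Omega> \<omega> \<gamma>) = 0"
        using i n linear_map_zero[OF target_ident(1)] by (simp add: ver_otens_low[of \<gamma> i])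
    qed
  qed
  have bil: "bilinear_map sH sO tscale (\<lambda>h y. ?tp \<omega> h y)" if \<omega>: "\<omega> \<in> dpart \<Omega>B m" for \<omega>
  proof -
    have l: "linear_map sH tscale (\<lambda>h. tens sB sH 1 h)" by (intro lin)
    have [lin]: "linear_map sH tscale (\<lambda>h. btens (MB m) NB \<omega> (tens sB sH 1 h))"
      unfolding linear_map_iff
      using \<omega> btens_add_right[of _ "MB m" _ NB] btens_scale_right[of _ "MB m" _ NB]
      by (simp add: linear_mapD[OF l] vector_space_sH vector_space_tscale tens_in_NB)
    show ?thesis by (intro lin)
  qed
  have p_top: "?p (otens \<Omega>B \<Omega> \<omega> \<gamma>) = CSW (\<lambda>h y. ?tp \<omega> h (coinv_proj y)) \<gamma>"
    if "\<omega> \<in> dpart \<Omega>B m" "\<gamma> \<in> dpart \<Omega> n" for \<omega> \<gamma>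
    unfolding ver_otens_top[OF that(2)] CSW_linear[OF target_ident(1)] target_ident(2)[OF that(1)] ..
  \<comment> \<open>Undo first the identification over \<open>B\<close> with \<open>\<beta>\<close>, then the Hopf module isomorphism with \<open>\<mu>\<close>.\<close>
  have p_inj: "z = 0" if z: "z \<in> ?T" and "?p z = 0" for z
  proof -
    obtain \<beta> where \<beta>: "linear_map tscale tscale \<beta>"
      "\<And>\<omega> h. \<omega> \<in> dpart \<Omega>B m \<Longrightarrow> \<beta> (btens (MB m) NB \<omega> (tens sB sH 1 h)) = otens \<Omega>B \<Omega> \<omega> (\<iota> h)"
      using balanced_retraction[of m] by blast
    obtain \<mu> where \<mu>: "linear_map tscale tscale \<mu>"
      "\<And>\<omega> x \<gamma>. \<mu> (tens tscale sO (otens \<Omega>B \<Omega> \<omega> x) \<gamma>) = otens \<Omega>B \<Omega> \<omega> (x \<and>\<^sub>\<Omega> \<gamma>)"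
      using mult_map by blast
    note [lin] = linear_map_comp[OF \<beta>(1)]
    have b: "bilinear_map tscale sO tscale (\<lambda>t \<gamma>. tens tscale sO (\<beta> t) \<gamma>)" by (intro lin)
    let ?\<rho> = "tlift tscale sO tscale (\<lambda>t \<gamma>. tens tscale sO (\<beta> t) \<gamma>)"
    have \<rho>: "linear_map tscale tscale (\<lambda>x. \<mu> (?\<rho> x))"
      by (rule linear_map_comp[OF \<mu>(1) tlift(1)[OF b]])
    have "\<mu> (?\<rho> (?p z)) = z"
    proof (rule tensor_maps_eqI[OF linear_map_comp[OF \<rho> p] lin_id[OF vector_space_tscale] _ z])
      fix \<omega> \<gamma> assume \<omega>: "\<omega> \<in> dpart \<Omega>B m" and \<gamma>: "\<gamma> \<in> dpart \<Omega> n"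
      have l: "linear_map sO tscale (otens \<Omega>B \<Omega> \<omega>)" by (intro lin)
      have "\<mu> (?\<rho> (?p (otens \<Omega>B \<Omega> \<omega> \<gamma>))) = CSW (\<lambda>h y. otens \<Omega>B \<Omega> \<omega> (\<iota> h \<and>\<^sub>\<Omega> coinv_proj y)) \<gamma>"
        unfolding p_top[OF \<omega> \<gamma>] CSW_linear[OF \<rho>] tlift(2)[OF b] \<beta>(2)[OF \<omega>] \<mu>(2) ..
      also have "\<dots> = otens \<Omega>B \<Omega> \<omega> \<gamma>"
        unfolding CSW_linear[OF l, symmetric] mult_coinv_proj ..
      finally show "\<mu> (?\<rho> (?p (otens \<Omega>B \<Omega> \<omega> \<gamma>))) = otens \<Omega>B \<Omega> \<omega> \<gamma>" .
    qed
    then show "z = 0" using that(2) linear_map_zero[OF \<rho>] by simp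
  qed
  have pZ: "?p z \<in> ?Z" if "z \<in> ?T" for z
  proof (rule tprod_image[OF p subZ that])
    fix \<omega> \<gamma> assume \<omega>: "\<omega> \<in> dpart \<Omega>B m" and \<gamma>: "\<gamma> \<in> dpart \<Omega> n"
    note [lin] = bilinear_mapD[OF bil[OF \<omega>]]
    have b: "bilinear_map sH sO tscale (\<lambda>h y. ?tp \<omega> h (coinv_proj y))" by (intro lin)
    show "?p (otens \<Omega>B \<Omega> \<omega> \<gamma>) \<in> ?Z"
      unfolding p_top[OF \<omega> \<gamma>]
    proof (rule CSW_in_subspace[OF b \<gamma> subZ])
      fix h y assume y: "y \<in> dpart \<Omega> n"
      have "btens (MB m) NB \<omega> (tens sB sH 1 h) \<in> btprod (MB m) NB"
        unfolding btprod_def using \<omega> tens_in_NB by (intro t.span_base) auto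
      then show "?tp \<omega> h (coinv_proj y) \<in> ?Z"
        unfolding ver_target_def by (rule tens_in_tprod) (rule coinv_proj_coinv[OF y])
    qed
  qed
  have subI: "t.subspace (?p ` ?Y)" by (rule p.subspace_image[OF sub])
  have gen: "?tp \<omega> h \<gamma> \<in> ?p ` ?Y" if \<omega>: "\<omega> \<in> dpart \<Omega>B m" and \<gamma>: "\<gamma> \<in> coinv H \<Omega> n" for \<omega> h \<gamma>
  proof -
    have \<gamma>': "\<iota> h \<and>\<^sub>\<Omega> \<gamma> \<in> dpart \<Omega> n"
      using wedge_dpart[OF dcincl_dpart, of \<gamma> n h] \<gamma> by (simp add: coinv_def)
    have "?p (otens \<Omega>B \<Omega> \<omega> (\<iota> h \<and>\<^sub>\<Omega> \<gamma>)) = ?tp \<omega> h \<gamma>"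
      unfolding p_top[OF \<omega> \<gamma>'] by (rule CSW_coinv_proj_mult[OF bil[OF \<omega>] \<gamma>])
    moreover have "otens \<Omega>B \<Omega> \<omega> (\<iota> h \<and>\<^sub>\<Omega> \<gamma>) \<in> ?Y"
      using TY tens_in_tprod[OF \<omega> \<gamma>'] by blast
    ultimately show ?thesis by (metis imageI)
  qed
  have ZI: "?Z \<subseteq> ?p ` ?Y"
  proof
    fix z assume z: "z \<in> ?Z"
    show "z \<in> ?p ` ?Y"
    proof (rule tprod_image[OF lin_id[OF vector_space_tscale] subI z[unfolded ver_target_def]])
      fix t \<gamma> assume t: "t \<in> btprod (MB m) NB" and \<gamma>: "\<gamma> \<in> coinv H \<Omega> n"
      have l: "linear_map tscale tscale (\<lambda>t. tens tscale sO t \<gamma>)" by (intro lin)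
      show "tens tscale sO t \<gamma> \<in> ?p ` ?Y"
      proof (rule linear_image_span[OF l t[unfolded btprod_def] subI])
        fix s assume "s \<in> {btens (MB m) NB x y | x y. x \<in> mcar (MB m) \<and> y \<in> mcar NB}"
        then obtain \<omega> u where s: "s = btens (MB m) NB \<omega> u" and \<omega>: "\<omega> \<in> dpart \<Omega>B m"
          and u: "u \<in> tprod sB sH UNIV UNIV" by auto
        \<comment> \<open>\<open>btens\<close> is additive in \<open>u\<close> only on the carrier of the module, hence the projection \<open>q\<close>.\<close>
        obtain q where q: "linear_map tscale tscale q" "\<And>t. q t \<in> tprod sB sH UNIV UNIV"
          "\<And>t. t \<in> tprod sB sH UNIV UNIV \<Longrightarrow> q t = t"
          using linear_projection[OF vector_space_tscale subspace_tprod, of sB sH UNIV UNIV] by blast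
        have [lin]: "linear_map tscale tscale (\<lambda>u. btens (MB m) NB \<omega> (q u))"
          unfolding linear_map_iff
          using \<omega> btens_add_right[of _ "MB m" _ NB] btens_scale_right[of _ "MB m" _ NB]
          by (simp add: linear_mapD[OF q(1)] vector_space_tscale q(2))
        have l': "linear_map tscale tscale (\<lambda>u. tens tscale sO (btens (MB m) NB \<omega> (q u)) \<gamma>)"
          by (intro lin)
        have "tens tscale sO (btens (MB m) NB \<omega> (q u)) \<gamma> \<in> ?p ` ?Y"
        proof (rule tprod_image[OF l' subI u])
          fix b h
          have "\<omega> \<and>\<^sub>B \<iota>B b \<in> dpart \<Omega>B m"
            using B.wedge_dpart[OF \<omega> B.dcincl_dpart] by simp
          then show "tens tscale sO (btens (MB m) NB \<omega> (q (tens sB sH b h))) \<gamma> \<in> ?p ` ?Y"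
            unfolding q(3)[OF tens_in_NB] btens_move[OF \<omega>] by (rule gen[OF _ \<gamma>])
        qed
        then show "tens tscale sO s \<gamma> \<in> ?p ` ?Y" unfolding s q(3)[OF u] .
      qed
    qed
  qed
  have IZ: "?p ` ?Y \<subseteq> ?Z"
  proof safe
    fix y assume "y \<in> ?Y"
    then obtain x z where "x \<in> ?X" "z \<in> ?T" "y = x + z" using Y_split by blast
    then show "?p y \<in> ?Z" using pX pZ by (simp add: p.add)
  qed
  have ker: "?X = {y \<in> ?Y. ?p y = 0}"
  proof safe
    fix y assume "y \<in> ?Y" "?p y = 0"
    then obtain x z where xz: "x \<in> ?X" "z \<in> ?T" "y = x + z" using Y_split by blast
    then have "?p z = 0" using pX \<open>?p y = 0\<close> by (simp add: p.add)
    then have "z = 0" using p_inj xz(2) by blast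
    then show "y \<in> ?X" using xz by simp
  qed (use XY pX in auto)
  show ?thesis
    unfolding short_exact_def base_wedge_eq
  proof (intro conjI)
    show "(\<lambda>x. x) ` ?X = {y \<in> ?Y. ?p y = 0}" unfolding image_ident by (rule ker)
  qed (use XY IZ ZI in \<open>auto intro: lin_id vector_space_tscale p sub subZ\<close>)
qed

end

theorem corollary3p23:
  fixes H :: "('k::field, 'h::{ring,monoid_mult}) hopf"
    and B :: "('k, 'h, 'b::{ring,monoid_mult}) twisted_alg"
    and \<Omega>B :: "('k, 'b, 'o::ab_group_add) dcalc"
    and act :: "'h \<Rightarrow> 'o \<Rightarrow> 'o"
    and \<Omega>H :: "('k, 'h, 'p::ab_group_add) dcalc"
    and m n :: nat
  assumes "is_hopf H" and "bij (antipode H)"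
    and "is_twisted_module_algebra H B"
    and "is_twisted_module_dc H B \<Omega>B act"
    and "is_dc (hscale H) \<Omega>H" and "comul_differentiable H \<Omega>H"
    and "\<And>l. l > 0 \<Longrightarrow> flat_right_module (bscale B) (forms_right_module \<Omega>B l)"
    and "n > 0"
  shows "short_exact tscale tscale tscale
           (base_wedge H B \<Omega>B act \<Omega>H (m + 1) (n - 1))
           (base_wedge H B \<Omega>B act \<Omega>H m n)
           (ver_target H B \<Omega>B \<Omega>H m n)
           (\<lambda>x. x)
           (\<lambda>x. target_ident H B \<Omega>B \<Omega>H m (ver H \<Omega>B \<Omega>H n x))"
proof -
  have "is_dc (bscale B) \<Omega>B"
    using assms(4) unfolding is_twisted_module_dc_def by blast
  then interpret crossed_calculus H \<Omega>H B \<Omega>B act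
    using assms(1,3-6) by unfold_locales (auto simp: is_dc_def)
  show ?thesis using assms(8) by (rule crossed_exact_sequence)
qed

end
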